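(* Let $n\geq 2$. The Lie ring $\mathrm{Lie}(hP\Sigma_n)$ associated with the lower central series of $hP\Sigma_n$ decomposes as a semi-direct product \[\mathrm{Lie}(hP\Sigma_n)\cong\left[\left(\prod_{i<n}\langle y_i\rangle\right)\rtimes R\mathfrak L_{n-1}\right]\rtimes\mathrm{Lie}(hP\Sigma_{n-1}),\] where $R\mathfrak L_{n-1}$ is the reduced free Lie ring on $y_1,\dots,y_{n-1}$, $\langle y_i\rangle$ is the Lie ideal generated by $y_i$ inside $R\mathfrak L_{n-1}$, and the action of $R\mathfrak L_{n-1}$ on the product is the diagonal one.
   Context: For a group $G$ with lower central series $\Gamma_*(G)$, $\mathrm{Lie}(G)=\bigoplus_{k\geq1}\Gamma_k(G)/\Gamma_{k+1}(G)$ with bracket induced by commutators $[x,y]=xyx^{-1}y^{-1}$. $RF_n=\langle x_1,\dots,x_n\mid [x_i,y^{-1}x_iy]=1\ (y\in F_n)\rangle$ is the reduced free group and $hP\Sigma_n$ the subgroup of $\mathrm{Aut}(RF_n)$ of automorphisms sending each $x_i$ to a conjugate of $x_i$. The reduced free Lie ring $R\mathfrak L_{m}$ is the Lie ring generated by $y_1,\dots,y_m$ with relations $[y_{i_1},[y_{i_2},[\cdots[y_{i_{s-1}},y_{i_s}]\cdots]]]=0$ whenever two indices coincide. *)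

theory Defs
  imports "HOL-Algebra.Algebra"
begin

type_synonym fword = "(nat \<times> bool) list"

definition fg_step :: "nat \<times> bool \<Rightarrow> fword \<Rightarrow> fword" where
  "fg_step x acc = (case acc of [] \<Rightarrow> [x]
      | y # ys \<Rightarrow> (if y = (fst x, \<not> snd x) then ys else x # acc))"

definition fg_reduce :: "fword \<Rightarrow> fword" where
  "fg_reduce w = foldr fg_step w []"

text \<open>The free group on generators 0,...,n-1 (letters (i,True) = x_i, (i,False) = x_i inverse).\<close>
definition free_grp :: "nat \<Rightarrow> fword monoid" where
  "free_grp n = \<lparr>carrier = {w. (\<forall>x\<in>set w. fst x < n) \<and> fg_reduce w = w},
                 monoid.mult = (\<lambda>v w. fg_reduce (v @ w)),
                 monoid.one = []\<rparr>"

definition fgen :: "nat \<Rightarrow> fword" where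
  "fgen i = [(i, True)]"

definition gcomm :: "('a, 'b) monoid_scheme \<Rightarrow> 'a \<Rightarrow> 'a \<Rightarrow> 'a" where
  "gcomm G x y = x \<otimes>\<^bsub>G\<^esub> y \<otimes>\<^bsub>G\<^esub> inv\<^bsub>G\<^esub> x \<otimes>\<^bsub>G\<^esub> inv\<^bsub>G\<^esub> y"

definition normal_closure :: "('a, 'b) monoid_scheme \<Rightarrow> 'a set \<Rightarrow> 'a set" where
  "normal_closure G S =
     generate G (\<Union>g\<in>carrier G. (\<lambda>s. g \<otimes>\<^bsub>G\<^esub> s \<otimes>\<^bsub>G\<^esub> inv\<^bsub>G\<^esub> g) ` S)"

text \<open>Lower central series: lcs G k = Gamma_(k+1)(G).\<close>
fun lcs :: "('a, 'b) monoid_scheme \<Rightarrow> nat \<Rightarrow> 'a set" where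
  "lcs G 0 = carrier G"
| "lcs G (Suc k) = generate G {gcomm G x y | x y. x \<in> carrier G \<and> y \<in> lcs G k}"

definition RF_rels :: "nat \<Rightarrow> fword set" where
  "RF_rels n = {gcomm (free_grp n) (fgen i)
                  (inv\<^bsub>free_grp n\<^esub> y \<otimes>\<^bsub>free_grp n\<^esub> fgen i \<otimes>\<^bsub>free_grp n\<^esub> y)
               | i y. i < n \<and> y \<in> carrier (free_grp n)}"

definition RF :: "nat \<Rightarrow> fword set monoid" where
  "RF n = free_grp n Mod normal_closure (free_grp n) (RF_rels n)"

definition rgen :: "nat \<Rightarrow> nat \<Rightarrow> fword set" where
  "rgen n i = normal_closure (free_grp n) (RF_rels n) #>\<^bsub>free_grp n\<^esub> fgen i"

definition hPSigma :: "nat \<Rightarrow> (fword set \<Rightarrow> fword set) monoid" where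
  "hPSigma n = (AutoGroup (RF n))\<lparr>carrier :=
     {\<phi> \<in> auto (RF n). \<forall>i<n. \<exists>g\<in>carrier (RF n).
        \<phi> (rgen n i) = g \<otimes>\<^bsub>RF n\<^esub> rgen n i \<otimes>\<^bsub>RF n\<^esub> inv\<^bsub>RF n\<^esub> g}\<rparr>"

record 'a liering =
  lcarrier :: "'a set"
  ladd :: "'a \<Rightarrow> 'a \<Rightarrow> 'a"
  lzero :: 'a
  lneg :: "'a \<Rightarrow> 'a"
  lbr :: "'a \<Rightarrow> 'a \<Rightarrow> 'a"

definition lie_iso :: "'a liering \<Rightarrow> 'b liering \<Rightarrow> ('a \<Rightarrow> 'b) \<Rightarrow> bool" where
  "lie_iso L M f \<longleftrightarrow> bij_betw f (lcarrier L) (lcarrier M) \<and>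
     (\<forall>x\<in>lcarrier L. \<forall>y\<in>lcarrier L.
        f (ladd L x y) = ladd M (f x) (f y) \<and> f (lbr L x y) = lbr M (f x) (f y))"

inductive_set lideal :: "'a liering \<Rightarrow> 'a set \<Rightarrow> 'a set" for L S where
  gen: "s \<in> S \<Longrightarrow> s \<in> lideal L S"
| zero: "lzero L \<in> lideal L S"
| add: "x \<in> lideal L S \<Longrightarrow> y \<in> lideal L S \<Longrightarrow> ladd L x y \<in> lideal L S"
| neg: "x \<in> lideal L S \<Longrightarrow> lneg L x \<in> lideal L S"
| brl: "a \<in> lcarrier L \<Longrightarrow> x \<in> lideal L S \<Longrightarrow> lbr L a x \<in> lideal L S"
| brr: "a \<in> lcarrier L \<Longrightarrow> x \<in> lideal L S \<Longrightarrow> lbr L x a \<in> lideal L S"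

definition lprod :: "nat \<Rightarrow> (nat \<Rightarrow> 'a liering) \<Rightarrow> (nat \<Rightarrow> 'a) liering" where
  "lprod m Ls = \<lparr>lcarrier = {a. (\<forall>i<m. a i \<in> lcarrier (Ls i)) \<and> (\<forall>i\<ge>m. a i = undefined)},
     ladd = (\<lambda>a b i. if i < m then ladd (Ls i) (a i) (b i) else undefined),
     lzero = (\<lambda>i. if i < m then lzero (Ls i) else undefined),
     lneg = (\<lambda>a i. if i < m then lneg (Ls i) (a i) else undefined),
     lbr = (\<lambda>a b i. if i < m then lbr (Ls i) (a i) (b i) else undefined)\<rparr>"

definition lsemi :: "'a liering \<Rightarrow> 'b liering \<Rightarrow> ('b \<Rightarrow> 'a \<Rightarrow> 'a) \<Rightarrow> ('a \<times> 'b) liering" where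
  "lsemi A R act = \<lparr>lcarrier = lcarrier A \<times> lcarrier R,
     ladd = (\<lambda>(a, r) (a', r'). (ladd A a a', ladd R r r')),
     lzero = (lzero A, lzero R),
     lneg = (\<lambda>(a, r). (lneg A a, lneg R r)),
     lbr = (\<lambda>(a, r) (a', r').
        (ladd A (ladd A (lbr A a a') (act r a')) (lneg A (act r' a)), lbr R r r'))\<rparr>"

definition lie_action :: "'b liering \<Rightarrow> 'a liering \<Rightarrow> ('b \<Rightarrow> 'a \<Rightarrow> 'a) \<Rightarrow> bool" where
  "lie_action K B \<rho> \<longleftrightarrow>
     (\<forall>k\<in>lcarrier K. \<forall>b\<in>lcarrier B. \<rho> k b \<in> lcarrier B) \<and>
     (\<forall>k\<in>lcarrier K. \<forall>b\<in>lcarrier B. \<forall>b'\<in>lcarrier B.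
        \<rho> k (ladd B b b') = ladd B (\<rho> k b) (\<rho> k b') \<and>
        \<rho> k (lbr B b b') = ladd B (lbr B (\<rho> k b) b') (lbr B b (\<rho> k b'))) \<and>
     (\<forall>k\<in>lcarrier K. \<forall>k'\<in>lcarrier K. \<forall>b\<in>lcarrier B.
        \<rho> (ladd K k k') b = ladd B (\<rho> k b) (\<rho> k' b) \<and>
        \<rho> (lbr K k k') b = ladd B (\<rho> k (\<rho> k' b)) (lneg B (\<rho> k' (\<rho> k b))))"

definition diag_act :: "nat \<Rightarrow> 'a liering \<Rightarrow> 'a \<Rightarrow> (nat \<Rightarrow> 'a) \<Rightarrow> (nat \<Rightarrow> 'a)" where
  "diag_act m R r a = (\<lambda>i. if i < m then lbr R r (a i) else undefined)"

definition lcs_quot :: "('a, 'b) monoid_scheme \<Rightarrow> nat \<Rightarrow> 'a set monoid" where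
  "lcs_quot G k = (G\<lparr>carrier := lcs G k\<rparr>) Mod lcs G (Suc k)"

definition lcs_rep :: "'a set \<Rightarrow> 'a" where
  "lcs_rep U = (SOME x. x \<in> U)"

text \<open>Elements: f with f k in Gamma_(k+1)/Gamma_(k+2), finitely many nonzero components.
  The bracket of degree i+1 and degree j+1 components lands in degree i+j+2 (index i+j+1).\<close>
definition LieG :: "('a, 'b) monoid_scheme \<Rightarrow> (nat \<Rightarrow> 'a set) liering" where
  "LieG G = \<lparr>lcarrier = {f. (\<forall>k. f k \<in> carrier (lcs_quot G k)) \<and>
                             finite {k. f k \<noteq> lcs G (Suc k)}},
     ladd = (\<lambda>f g k. f k <#>\<^bsub>G\<^esub> g k),
     lzero = (\<lambda>k. lcs G (Suc k)),
     lneg = (\<lambda>f k. inv\<^bsub>lcs_quot G k\<^esub> (f k)),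
     lbr = (\<lambda>f g k. finprod (lcs_quot G k)
              (\<lambda>(i, j). lcs G (Suc k) #>\<^bsub>G\<^esub> gcomm G (lcs_rep (f i)) (lcs_rep (g j)))
              {(i, j). i + j + 1 = k})\<rparr>"

datatype mtree = MLeaf nat | MNode mtree mtree

fun mleaves :: "mtree \<Rightarrow> nat set" where
  "mleaves (MLeaf i) = {i}"
| "mleaves (MNode a b) = mleaves a \<union> mleaves b"

definition mcarrier :: "nat \<Rightarrow> (mtree \<Rightarrow> int) set" where
  "mcarrier m = {p. finite {t. p t \<noteq> 0} \<and> (\<forall>t. p t \<noteq> 0 \<longrightarrow> mleaves t \<subseteq> {..<m})}"

fun mmul :: "(mtree \<Rightarrow> int) \<Rightarrow> (mtree \<Rightarrow> int) \<Rightarrow> mtree \<Rightarrow> int" where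
  "mmul p q (MLeaf i) = 0"
| "mmul p q (MNode a b) = p a * q b"

definition ygen :: "nat \<Rightarrow> mtree \<Rightarrow> int" where
  "ygen i = (\<lambda>t. if t = MLeaf i then 1 else 0)"

definition mjac :: "(mtree \<Rightarrow> int) \<Rightarrow> (mtree \<Rightarrow> int) \<Rightarrow> (mtree \<Rightarrow> int) \<Rightarrow> mtree \<Rightarrow> int" where
  "mjac p q r = (\<lambda>t. mmul p (mmul q r) t + mmul q (mmul r p) t + mmul r (mmul p q) t)"

fun rbr :: "nat list \<Rightarrow> mtree \<Rightarrow> int" where
  "rbr [] = (\<lambda>t. 0)"
| "rbr [i] = ygen i"
| "rbr (i # is) = mmul (ygen i) (rbr is)"

inductive_set mideal :: "nat \<Rightarrow> (mtree \<Rightarrow> int) set \<Rightarrow> (mtree \<Rightarrow> int) set" for m S where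
  gen: "s \<in> S \<Longrightarrow> s \<in> mideal m S"
| zero: "(\<lambda>t. 0) \<in> mideal m S"
| add: "x \<in> mideal m S \<Longrightarrow> y \<in> mideal m S \<Longrightarrow> (\<lambda>t. x t + y t) \<in> mideal m S"
| neg: "x \<in> mideal m S \<Longrightarrow> (\<lambda>t. - x t) \<in> mideal m S"
| lmul: "a \<in> mcarrier m \<Longrightarrow> x \<in> mideal m S \<Longrightarrow> mmul a x \<in> mideal m S"
| rmul: "a \<in> mcarrier m \<Longrightarrow> x \<in> mideal m S \<Longrightarrow> mmul x a \<in> mideal m S"

definition RL_rels :: "nat \<Rightarrow> (mtree \<Rightarrow> int) set" where
  "RL_rels m = {mmul p p | p. p \<in> mcarrier m}
     \<union> {mjac p q r | p q r. p \<in> mcarrier m \<and> q \<in> mcarrier m \<and> r \<in> mcarrier m}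
     \<union> {rbr is | is. 2 \<le> length is \<and> \<not> distinct is \<and> set is \<subseteq> {..<m}}"

definition RL_ideal :: "nat \<Rightarrow> (mtree \<Rightarrow> int) set" where
  "RL_ideal m = mideal m (RL_rels m)"

definition mcls :: "nat \<Rightarrow> (mtree \<Rightarrow> int) \<Rightarrow> (mtree \<Rightarrow> int) set" where
  "mcls m p = {(\<lambda>t. p t + z t) | z. z \<in> RL_ideal m}"

definition mrep :: "nat \<Rightarrow> (mtree \<Rightarrow> int) set \<Rightarrow> mtree \<Rightarrow> int" where
  "mrep m U = (SOME p. p \<in> U \<and> p \<in> mcarrier m)"

definition RL :: "nat \<Rightarrow> (mtree \<Rightarrow> int) set liering" where
  "RL m = \<lparr>lcarrier = {mcls m p | p. p \<in> mcarrier m},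
     ladd = (\<lambda>U Y. mcls m (\<lambda>t. mrep m U t + mrep m Y t)),
     lzero = RL_ideal m,
     lneg = (\<lambda>U. mcls m (\<lambda>t. - mrep m U t)),
     lbr = (\<lambda>U Y. mcls m (mmul (mrep m U) (mrep m Y)))\<rparr>"

definition RLgen :: "nat \<Rightarrow> nat \<Rightarrow> (mtree \<Rightarrow> int) set" where
  "RLgen m i = mcls m (ygen i)"

end

(*
  A reduced free group embeds, by x_i |-> 1 + y_i, into the units of the ring of integral
  polynomials in noncommuting y_i modulo all words with a repeated letter.  The embedding is
  injective because the normal closure of x_m is abelian and, as a module over the group of the
  remaining generators, a quotient of the Magnus ring; this also shows that the leading term of a
  group element is a Lie element, and that the presented reduced free Lie ring is the Lie subring
  generated by the y_i.

  A basis-conjugating automorphism x_j |-> g_j x_j g_j^-1 is determined by the g_j modulo the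
  normal closure of x_j.  Filtering by the orders of the g_j - 1 gives a central filtration whose
  graded ring consists of the tangential derivations y_j |-> [s_j, y_j].  These are generated in
  degree one, and the filtration stops, so it is the lower central series.

  Write m for the last of the letters 0, ..., m.  A tangential derivation splits into the part
  where all s_j (j < m) avoid y_m and s_m = 0, a copy of the Lie ring for one generator less, and
  the ideal where each s_j (j < m) is a sum of brackets containing y_m.  Lie elements without y_j
  all of whose words contain y_m form a copy of the Magnus ring on the other letters, as does the
  ideal generated by y_j in the reduced free Lie ring; under the antipode the action of s_m
  becomes the adjoint action.
*)
theory Submission
  imports Defs
begin

section \<open>Noncommuting polynomials modulo words with a repeated letter\<close>

section \<open>The reduced Magnus ring\<close>

text \<open>One cancellation drives the argument: a product of two elements whose words all contain
  \<open>y_i\<close> is zero. It removes every higher term from the image of an iterated group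
  commutator and makes each ideal generated by a letter abelian.

  Letters are arbitrary natural numbers and one type carries all ranks. Rank n - 1 then sits inside
  rank n by inclusion, and the decomposition becomes an internal splitting of one additive group, to
  which the Lie rings made of cosets are transported.

  The generation in degree one rests on right-normed brackets: a component s_i is a sum of such
  brackets without \<open>y_i\<close>, and a commutator with the automorphism conjugating
  \<open>x_i\<close> by \<open>x_p\<close> prefixes the letter p. That automorphism is itself
  obtained from a ring substitution, through the injectivity of the embedding.

  The antipode is forced: s_m acts on a bracket at its innermost letter \<open>y_m\<close>, hence
  from the right, while the reduced free Lie ring acts on its ideals from the left.\<close>

typedef rmag = "{f :: nat list \<Rightarrow> int. \<forall>w. \<not> distinct w \<longrightarrow> f w = 0}"
  morphisms coef Abs_rmag
  by (intro exI[of _ "\<lambda>_. 0"]) simp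

setup_lifting type_definition_rmag

lemma coef_not_distinct [simp]: "\<not> distinct w \<Longrightarrow> coef f w = 0"
  by transfer simp

lemma rmag_eqI: "(\<And>w. distinct w \<Longrightarrow> coef f w = coef g w) \<Longrightarrow> f = g"
  by (metis coef_inject coef_not_distinct ext)

text \<open>The Cauchy product over all splittings of a word, in a recursive form that shifts the
  left factor by one letter; associativity becomes a plain induction. The form as a sum is
  \<open>conv_eq_sum\<close>.\<close>

fun conv :: "(nat list \<Rightarrow> int) \<Rightarrow> (nat list \<Rightarrow> int) \<Rightarrow> nat list \<Rightarrow> int" where
  "conv f g [] = f [] * g []"
| "conv f g (x # w) = f [] * g (x # w) + conv (\<lambda>u. f (x # u)) g w"

lemma conv_cong:
  "(\<And>u v. u @ v = w \<Longrightarrow> f u = f' u \<and> g v = g' v) \<Longrightarrow> conv f g w = conv f' g' w"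
proof (induction w arbitrary: f f')
  case Nil
  then show ?case by simp
next
  case (Cons x w)
  have "f [] = f' [] \<and> g (x # w) = g' (x # w)"
    using Cons.prems[of "[]" "x # w"] by simp
  moreover have "conv (\<lambda>u. f (x # u)) g w = conv (\<lambda>u. f' (x # u)) g' w"
    by (rule Cons.IH) (use Cons.prems in \<open>metis append_Cons\<close>)
  ultimately show ?case by simp
qed

lemma conv_add_left: "conv (\<lambda>u. f u + f' u) g w = conv f g w + conv f' g w"
  by (induction w arbitrary: f f') (auto simp: algebra_simps)

lemma conv_add_right: "conv f (\<lambda>u. g u + g' u) w = conv f g w + conv f g' w"
  by (induction w arbitrary: f) (auto simp: algebra_simps)

lemma conv_smult_left: "conv (\<lambda>u. c * f u) g w = c * conv f g w"
  by (induction w arbitrary: f) (auto simp: algebra_simps)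

lemma conv_zero_left: "conv (\<lambda>u. 0) g w = 0"
  by (induction w) auto

lemma conv_assoc: "conv (conv f g) h w = conv f (conv g h) w"
proof (induction w arbitrary: f g)
  case Nil
  then show ?case by simp
next
  case (Cons x w)
  have "conv (\<lambda>u. conv f g (x # u)) h w
      = f [] * conv (\<lambda>u. g (x # u)) h w + conv (conv (\<lambda>u. f (x # u)) g) h w"
    by (simp add: conv_add_left conv_smult_left)
  then show ?case
    by (simp add: Cons.IH algebra_simps)
qed

lemma conv_one_left: "conv (\<lambda>w. if w = [] then 1 else 0) g w = g w"
  by (cases w) (auto simp: conv_zero_left)

lemma conv_one_right: "conv f (\<lambda>w. if w = [] then 1 else 0) w = f w"
  by (induction w arbitrary: f) auto

text \<open>Mirror image of the defining recursion, at the right end of the word; the product rule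
  for \<open>tail\<close> comes from it.\<close>

lemma conv_snoc:
  "conv f g (w @ [j]) = conv f (\<lambda>v. g (v @ [j])) w + f (w @ [j]) * g []"
  by (induction w arbitrary: f) (auto simp: algebra_simps)

instantiation rmag :: ring_1
begin

lift_definition zero_rmag :: rmag is "\<lambda>_. 0" by simp
lift_definition one_rmag :: rmag is "\<lambda>w. if w = [] then 1 else 0" by auto
lift_definition plus_rmag :: "rmag \<Rightarrow> rmag \<Rightarrow> rmag" is "\<lambda>f g w. f w + g w" by simp
lift_definition minus_rmag :: "rmag \<Rightarrow> rmag \<Rightarrow> rmag" is "\<lambda>f g w. f w - g w" by simp
lift_definition uminus_rmag :: "rmag \<Rightarrow> rmag" is "\<lambda>f w. - f w" by simp
lift_definition times_rmag :: "rmag \<Rightarrow> rmag \<Rightarrow> rmag"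
  is "\<lambda>f g w. if distinct w then conv f g w else 0" by simp

instance
proof
  fix a b c :: rmag
  show "a * b * c = a * (b * c)"
  proof (rule rmag_eqI, transfer)
    fix a b c :: "nat list \<Rightarrow> int" and w :: "nat list"
    assume w: "distinct w"
    \<comment> \<open>Both factors of a distinct word are distinct, so the truncation of the inner
      product changes no coefficient that is read.\<close>
    have "conv (\<lambda>w. if distinct w then conv a b w else 0) c w = conv (conv a b) c w"
      by (rule conv_cong) (use w in auto)
    also have "\<dots> = conv a (conv b c) w" by (rule conv_assoc)
    also have "\<dots> = conv a (\<lambda>w. if distinct w then conv b c w else 0) w"
      by (rule conv_cong) (use w in auto)
    finally show "(if distinct w then conv (\<lambda>w. if distinct w then conv a b w else 0) c w else 0)
      = (if distinct w then conv a (\<lambda>w. if distinct w then conv b c w else 0) w else 0)"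
      by simp
  qed
  show "1 * a = a" by transfer (auto simp: conv_one_left fun_eq_iff)
  show "a * 1 = a" by transfer (auto simp: conv_one_right fun_eq_iff)
  show "(a + b) * c = a * c + b * c" by transfer (auto simp: conv_add_left fun_eq_iff)
  show "a * (b + c) = a * b + a * c" by transfer (auto simp: conv_add_right fun_eq_iff)
  show "(0::rmag) \<noteq> 1" by transfer (metis zero_neq_one)
qed (transfer; auto simp: fun_eq_iff)+

end

lemma coef_0 [simp]: "coef 0 w = 0" by transfer simp
lemma coef_1: "coef 1 w = (if w = [] then 1 else 0)" by transfer simp
lemma coef_add [simp]: "coef (f + g) w = coef f w + coef g w" by transfer simp
lemma coef_diff [simp]: "coef (f - g) w = coef f w - coef g w" by transfer simp
lemma coef_minus [simp]: "coef (- f) w = - coef f w" by transfer simp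
lemma coef_mult: "coef (f * g) w = (if distinct w then conv (coef f) (coef g) w else 0)"
  by transfer simp
lemma coef_sum: "coef (sum f A) w = (\<Sum>a\<in>A. coef (f a) w)"
  by (induction A rule: infinite_finite_induct) auto

lemma coef_of_int_mult [simp]: "coef (of_int c * f) w = c * coef f w"
proof (induction c rule: int_induct[where k = 0])
  case base
  then show ?case by simp
qed (auto simp: algebra_simps)

lemma finite_splits: "finite {(u, v). u @ v = w}"
proof (rule finite_subset)
  show "{(u, v). u @ v = w} \<subseteq> (\<lambda>k. (take k w, drop k w)) ` {..length w}"
  proof clarify
    fix u v assume "w = u @ v"
    then show "(u, v) \<in> (\<lambda>k. (take k (u @ v), drop k (u @ v))) ` {..length (u @ v)}"
      by (intro image_eqI[of _ _ "length u"]) auto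
  qed
qed simp

lemma conv_eq_sum: "conv f g w = (\<Sum>(u, v) \<in> {(u, v). u @ v = w}. f u * g v)"
proof (induction w arbitrary: f)
  case Nil
  have "{(u, v). u @ v = ([] :: nat list)} = {([], [])}" by auto
  then show ?case by simp
next
  case (Cons x w)
  have *: "{(u, v). u @ v = x # w}
      = insert ([], x # w) ((\<lambda>(u, v). (x # u, v)) ` {(u, v). u @ v = w})"
    by (auto simp: append_eq_Cons_conv)
  have "inj_on (\<lambda>(u, v). (x # u, v)) {(u, v). u @ v = w}" by (auto simp: inj_on_def)
  moreover have "([], x # w) \<notin> (\<lambda>(u, v). (x # u, v)) ` {(u, v). u @ v = w}" by auto
  ultimately show ?case
    unfolding * using finite_splits[of w]
    by (simp add: sum.reindex Cons.IH case_prod_beta')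
qed

lemma coef_mult_nonzero:
  assumes "coef (f * g) w \<noteq> 0"
  obtains u v where "w = u @ v" "coef f u \<noteq> 0" "coef g v \<noteq> 0"
proof -
  have "conv (coef f) (coef g) w \<noteq> 0"
    using assms by (auto simp: coef_mult split: if_splits)
  then obtain p where "p \<in> {(u, v). u @ v = w}" "(case p of (u, v) \<Rightarrow> coef f u * coef g v) \<noteq> 0"
    unfolding conv_eq_sum by (metis (no_types, lifting) sum.neutral)
  then show ?thesis using that by auto
qed

lift_definition mon :: "nat list \<Rightarrow> rmag" is "\<lambda>w u. if u = w \<and> distinct w then 1 else 0"
  by auto

abbreviation mgen :: "nat \<Rightarrow> rmag" where "mgen i \<equiv> mon [i]"

lemma coef_mon: "coef (mon w) u = (if u = w \<and> distinct w then 1 else 0)"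
  by transfer simp

lemma mon_not_distinct [simp]: "\<not> distinct w \<Longrightarrow> mon w = 0"
  by (rule rmag_eqI) (simp add: coef_mon)

lemma mon_Nil [simp]: "mon [] = 1"
  by (rule rmag_eqI) (simp add: coef_mon coef_1)

lemma mon_mult: "mon u * mon v = mon (u @ v)"
proof (rule rmag_eqI)
  fix w :: "nat list" assume w: "distinct w"
  have "coef (mon u * mon v) w
      = (\<Sum>p \<in> {(u, v). u @ v = w}. if p = (u, v) then (if distinct u \<and> distinct v then 1 else 0) else 0)"
    unfolding coef_mult conv_eq_sum using w
    by (auto intro!: sum.cong simp: coef_mon split: prod.splits)
  also have "\<dots> = coef (mon (u @ v)) w"
    using w finite_splits[of w] by (auto simp: sum.delta coef_mon)
  finally show "coef (mon u * mon v) w = coef (mon (u @ v)) w" .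
qed

lemma mon_Cons: "mon (i # w) = mgen i * mon w"
  by (simp add: mon_mult)

subsection \<open>Linear extension from words\<close>

definition dwords :: "nat \<Rightarrow> nat list set" where
  "dwords n = {w. set w \<subseteq> {..<n} \<and> distinct w}"

lemma finite_dwords [simp]: "finite (dwords n)"
  unfolding dwords_def by (rule finite_subset_distinct) simp

lemma dwords_append: "u @ v \<in> dwords n \<longleftrightarrow> u \<in> dwords n \<and> v \<in> dwords n \<and> distinct (u @ v)"
  by (auto simp: dwords_def)

lemma of_int_additive:
  fixes h :: "'a::ring_1 \<Rightarrow> 'b::ring_1"
  assumes add: "\<And>x y. h (x + y) = h x + h y"
  shows "h (of_int c * x) = of_int c * h x"
proof -
  have 0: "h 0 = 0" using add[of 0 0] by simp
  have minus: "h (x - y) = h x - h y" for x y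
    using add[of "x - y" y] by simp
  show ?thesis
    by (induction c rule: int_induct[where k = 0]) (auto simp: 0 add minus algebra_simps)
qed

text \<open>Elements of \<open>rmag\<close> may have infinitely many coefficients, so linear
  extension runs over the finite set \<open>dwords n\<close> and ignores words with a letter from n
  on. Hence the recurring hypothesis of membership in \<open>rsub {..<n}\<close>.\<close>

definition lin :: "nat \<Rightarrow> (nat list \<Rightarrow> 'r::ring_1) \<Rightarrow> rmag \<Rightarrow> 'r" where
  "lin n F f = (\<Sum>w\<in>dwords n. of_int (coef f w) * F w)"

lemma lin_add [simp]: "lin n F (f + g) = lin n F f + lin n F g"
  by (simp add: lin_def algebra_simps sum.distrib)

lemma lin_0 [simp]: "lin n F 0 = 0"
  by (simp add: lin_def)

lemma lin_minus [simp]: "lin n F (- f) = - lin n F f"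
  by (simp add: lin_def sum_negf)

lemma lin_diff [simp]: "lin n F (f - g) = lin n F f - lin n F g"
  by (simp add: lin_def algebra_simps sum_subtractf)

lemma lin_add_fun: "lin n (\<lambda>w. F w + G w) f = lin n F f + lin n G f"
  by (simp add: lin_def algebra_simps sum.distrib)

lemma lin_diff_fun: "lin n (\<lambda>w. F w - G w) f = lin n F f - lin n G f"
  by (simp add: lin_def algebra_simps sum_subtractf)

lemma lin_cong:
  "(\<And>w. w \<in> dwords n \<Longrightarrow> coef f w \<noteq> 0 \<Longrightarrow> F w = G w) \<Longrightarrow> lin n F f = lin n G f"
  unfolding lin_def by (rule sum.cong[OF refl]) (metis mult_zero_left of_int_0)

lemma lin_eq_0:
  "(\<And>w. w \<in> dwords n \<Longrightarrow> coef f w \<noteq> 0 \<Longrightarrow> F w = 0) \<Longrightarrow> lin n F f = 0"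
  unfolding lin_def by (rule sum.neutral) (metis mult_zero_left mult_zero_right of_int_0)

lemma lin_mon: "w \<in> dwords n \<Longrightarrow> lin n F (mon w) = F w"
proof -
  assume w: "w \<in> dwords n"
  have "lin n F (mon w) = (\<Sum>u\<in>dwords n. if u = w then F u else 0)"
    unfolding lin_def using w by (intro sum.cong) (auto simp: coef_mon dwords_def)
  then show ?thesis using w by simp
qed

lemma lin_hom:
  fixes h :: "'a::ring_1 \<Rightarrow> 'b::ring_1"
  assumes add: "\<And>x y. h (x + y) = h x + h y"
  shows "h (lin n F f) = lin n (\<lambda>w. h (F w)) f"
proof -
  have 0: "h 0 = 0" using add[of 0 0] by simp
  have s: "finite A \<Longrightarrow> h (sum G A) = (\<Sum>w\<in>A. h (G w))" for A :: "nat list set" and G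
    by (induction A rule: finite_induct) (auto simp: 0 add)
  show ?thesis
    unfolding lin_def by (simp add: s of_int_additive[of h, OF add])
qed

lemma lin_mono:
  assumes "n \<le> n'" "\<And>w. coef f w \<noteq> 0 \<Longrightarrow> set w \<subseteq> {..<n}"
  shows "lin n' F f = lin n F f"
  unfolding lin_def
proof (rule sum.mono_neutral_right)
  show "dwords n \<subseteq> dwords n'" using assms(1) by (auto simp: dwords_def)
  show "\<forall>i\<in>dwords n' - dwords n. of_int (coef f i) * F i = 0"
  proof
    fix w assume "w \<in> dwords n' - dwords n"
    then have "coef f w = 0" using assms(2)[of w] unfolding dwords_def by blast
    then show "of_int (coef f w) * F w = 0" by simp
  qed
qed simp

text \<open>The truncated product drops concatenations with a repeated letter, while the double sum
  keeps them; the hypothesis on F reconciles the two.\<close>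

lemma lin_mult:
  assumes "\<And>w. \<not> distinct w \<Longrightarrow> F w = 0"
  shows "lin n F (f * g)
    = (\<Sum>u\<in>dwords n. \<Sum>v\<in>dwords n. of_int (coef f u) * of_int (coef g v) * F (u @ v))"
proof -
  let ?c = "\<lambda>(u, v). of_int (coef f u) * of_int (coef g v) * F (u @ v)"
  have "lin n F (f * g) = (\<Sum>w\<in>dwords n. \<Sum>p\<in>{(u, v). u @ v = w}. ?c p)"
    unfolding lin_def
  proof (rule sum.cong[OF refl])
    fix w assume "w \<in> dwords n"
    then have "coef (f * g) w = (\<Sum>(u, v)\<in>{(u, v). u @ v = w}. coef f u * coef g v)"
      by (simp add: coef_mult conv_eq_sum dwords_def)
    then show "of_int (coef (f * g) w) * F w = (\<Sum>p\<in>{(u, v). u @ v = w}. ?c p)"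
      by (auto simp: of_int_sum sum_distrib_right intro!: sum.cong split: prod.splits)
  qed
  also have "\<dots> = (\<Sum>(w, p)\<in>(SIGMA w:dwords n. {(u, v). u @ v = w}). ?c p)"
    by (rule sum.Sigma) (auto simp: finite_splits)
  \<comment> \<open>The pair (u, v) determines w = u @ v, so the outer index can be
    forgotten.\<close>
  also have "\<dots> = (\<Sum>p\<in>snd ` (SIGMA w:dwords n. {(u, v). u @ v = w}). ?c p)"
    by (subst sum.reindex) (auto simp: inj_on_def intro!: sum.cong)
  also have "\<dots> = (\<Sum>p\<in>dwords n \<times> dwords n. ?c p)"
  proof (rule sum.mono_neutral_left)
    show "snd ` (SIGMA w:dwords n. {(u, v). u @ v = w}) \<subseteq> dwords n \<times> dwords n"
      by (auto simp: dwords_append)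
    show "\<forall>p\<in>dwords n \<times> dwords n - snd ` (SIGMA w:dwords n. {(u, v). u @ v = w}). ?c p = 0"
    proof safe
      fix u v assume uv: "u \<in> dwords n" "v \<in> dwords n"
        and nin: "(u, v) \<notin> snd ` (SIGMA w:dwords n. {(u, v). u @ v = w})"
      have "u @ v \<notin> dwords n"
      proof
        assume "u @ v \<in> dwords n"
        then have "(u @ v, (u, v)) \<in> (SIGMA w:dwords n. {(u, v). u @ v = w})" by auto
        then show False using nin by (metis image_eqI snd_conv)
      qed
      then have "\<not> distinct (u @ v)" using uv by (simp add: dwords_append)
      then show "of_int (coef f u) * of_int (coef g v) * F (u @ v) = 0" using assms by simp
    qed
  qed simp
  also have "\<dots> = (\<Sum>u\<in>dwords n. \<Sum>v\<in>dwords n. of_int (coef f u) * of_int (coef g v) * F (u @ v))"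
    by (simp add: sum.cartesian_product)
  finally show ?thesis .
qed

lemma lin_mon_mult:
  assumes "\<And>w. \<not> distinct w \<Longrightarrow> F w = 0" "u \<in> dwords n"
  shows "lin n F (mon u * g) = lin n (\<lambda>v. F (u @ v)) g"
proof -
  have "lin n F (mon u * g) = (\<Sum>u'\<in>dwords n. \<Sum>v\<in>dwords n.
      of_int (coef (mon u) u') * of_int (coef g v) * F (u' @ v))"
    by (rule lin_mult[OF assms(1)])
  also have "\<dots> = (\<Sum>u'\<in>dwords n. if u' = u
      then (\<Sum>v\<in>dwords n. of_int (coef g v) * F (u @ v)) else 0)"
    by (intro sum.cong refl) (use assms(2) in \<open>auto simp: coef_mon dwords_def\<close>)
  finally have "lin n F (mon u * g) = \<dots>" .
  then show ?thesis using assms(2) by (simp add: lin_def)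
qed

lemma coef_lin_mon: "coef (lin n mon f) w = (if w \<in> dwords n then coef f w else 0)"
proof -
  have "coef (lin n mon f) w = (\<Sum>u\<in>dwords n. if u = w then coef f u else 0)"
    unfolding lin_def coef_sum by (intro sum.cong) (auto simp: coef_mon dwords_def)
  then show ?thesis by simp
qed

subsection \<open>Supports\<close>

text \<open>The type does not bound the letters; the ring on the first n letters is
  \<open>rsub {..<n}\<close>.\<close>

definition rsub :: "nat set \<Rightarrow> rmag set" where
  "rsub S = {f. \<forall>w. coef f w \<noteq> 0 \<longrightarrow> set w \<subseteq> S}"

definition ordge :: "nat \<Rightarrow> rmag set" where
  "ordge d = {f. \<forall>w. length w < d \<longrightarrow> coef f w = 0}"

definition cont :: "nat \<Rightarrow> rmag set" where
  "cont j = {f. \<forall>w. coef f w \<noteq> 0 \<longrightarrow> j \<in> set w}"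

lemma rsub_0 [simp]: "0 \<in> rsub S" and rsub_1 [simp]: "1 \<in> rsub S"
  by (auto simp: rsub_def coef_1)
lemma rsub_add: "f \<in> rsub S \<Longrightarrow> g \<in> rsub S \<Longrightarrow> f + g \<in> rsub S"
  by (auto simp: rsub_def) (metis add.right_neutral subsetD)
lemma rsub_minus: "f \<in> rsub S \<Longrightarrow> - f \<in> rsub S"
  by (auto simp: rsub_def)
lemma rsub_diff: "f \<in> rsub S \<Longrightarrow> g \<in> rsub S \<Longrightarrow> f - g \<in> rsub S"
  using rsub_add[of f S "- g"] rsub_minus by simp
lemma rsub_mult: "f \<in> rsub S \<Longrightarrow> g \<in> rsub S \<Longrightarrow> f * g \<in> rsub S"
  unfolding rsub_def by (clarsimp elim!: coef_mult_nonzero) blast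
lemma rsub_sum: "(\<And>a. a \<in> A \<Longrightarrow> f a \<in> rsub S) \<Longrightarrow> sum f A \<in> rsub S"
  by (induction A rule: infinite_finite_induct) (auto intro: rsub_add)
lemma rsub_of_int_mult: "f \<in> rsub S \<Longrightarrow> of_int c * f \<in> rsub S"
  by (auto simp: rsub_def)
lemma rsub_mono: "f \<in> rsub S \<Longrightarrow> S \<subseteq> S' \<Longrightarrow> f \<in> rsub S'"
  by (auto simp: rsub_def)
lemma rsub_mon: "set w \<subseteq> S \<Longrightarrow> mon w \<in> rsub S"
  by (auto simp: rsub_def coef_mon)

lemma rsub_mgen [intro]: "i \<in> S \<Longrightarrow> mgen i \<in> rsub S"
  by (simp add: rsub_mon)

lemma lin_mon_rsub: "f \<in> rsub {..<n} \<Longrightarrow> lin n mon f = f"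
  by (rule rmag_eqI) (auto simp: coef_lin_mon rsub_def dwords_def)

lemma ordge_0 [simp]: "0 \<in> ordge d"
  by (auto simp: ordge_def)
lemma ordge_zero [simp]: "f \<in> ordge 0"
  by (auto simp: ordge_def)
lemma ordge_add: "f \<in> ordge d \<Longrightarrow> g \<in> ordge d \<Longrightarrow> f + g \<in> ordge d"
  by (auto simp: ordge_def)
lemma ordge_minus: "f \<in> ordge d \<Longrightarrow> - f \<in> ordge d"
  by (auto simp: ordge_def)
lemma ordge_diff: "f \<in> ordge d \<Longrightarrow> g \<in> ordge d \<Longrightarrow> f - g \<in> ordge d"
  by (auto simp: ordge_def)
lemma ordge_sum: "(\<And>a. a \<in> A \<Longrightarrow> f a \<in> ordge d) \<Longrightarrow> sum f A \<in> ordge d"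
  by (induction A rule: infinite_finite_induct) (auto intro: ordge_add)
lemma ordge_mono: "f \<in> ordge d \<Longrightarrow> e \<le> d \<Longrightarrow> f \<in> ordge e"
  by (auto simp: ordge_def)
lemma ordge_mult:
  assumes "f \<in> ordge d" "g \<in> ordge e"
  shows "f * g \<in> ordge (d + e)"
  unfolding ordge_def
proof (clarify, rule ccontr)
  fix w :: "nat list" assume "length w < d + e" "coef (f * g) w \<noteq> 0"
  then obtain u v where "length u + length v < d + e" "coef f u \<noteq> 0" "coef g v \<noteq> 0"
    by (auto elim!: coef_mult_nonzero)
  moreover from this have "\<not> length u < d" "\<not> length v < e"
    using assms by (auto simp: ordge_def)
  ultimately show False by simp
qed
lemma ordge_of_int_mult: "f \<in> ordge d \<Longrightarrow> of_int c * f \<in> ordge d"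
  by (auto simp: ordge_def)
lemma ordge_mon: "mon w \<in> ordge (length w)"
  by (auto simp: ordge_def coef_mon)

lemma ordge_lin:
  assumes "f \<in> ordge d" "\<And>w. w \<in> dwords n \<Longrightarrow> F w \<in> ordge (length w + k)"
  shows "lin n F f \<in> ordge (d + k)"
  unfolding lin_def
proof (rule ordge_sum)
  fix w assume w: "w \<in> dwords n"
  show "of_int (coef f w) * F w \<in> ordge (d + k)"
  proof (cases "length w < d")
    case True
    then show ?thesis using assms(1) by (simp add: ordge_def)
  next
    case False
    then show ?thesis
      using ordge_mono[OF assms(2)[OF w], of "d + k"] by (intro ordge_of_int_mult) simp
  qed
qed

text \<open>A word without repetition in n letters has length at most n. All nilpotency in the
  development comes from this.\<close>

lemma ordge_vanish:
  assumes "f \<in> rsub {..<n}" "f \<in> ordge d" "n < d"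
  shows "f = 0"
proof (rule rmag_eqI)
  fix w :: "nat list" assume w: "distinct w"
  show "coef f w = coef 0 w"
  proof (rule ccontr)
    assume "coef f w \<noteq> coef 0 w"
    then have "set w \<subseteq> {..<n}" "\<not> length w < d" using assms by (auto simp: rsub_def ordge_def)
    then have "card (set w) \<le> n" by (metis card_lessThan card_mono finite_lessThan)
    then show False using \<open>\<not> length w < d\<close> assms(3) w by (simp add: distinct_card)
  qed
qed

lemma cont_0 [simp]: "0 \<in> cont j"
  by (auto simp: cont_def)
lemma cont_add: "f \<in> cont j \<Longrightarrow> g \<in> cont j \<Longrightarrow> f + g \<in> cont j"
  by (auto simp: cont_def) (metis add.right_neutral)
lemma cont_minus: "f \<in> cont j \<Longrightarrow> - f \<in> cont j"
  by (auto simp: cont_def)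
lemma cont_diff: "f \<in> cont j \<Longrightarrow> g \<in> cont j \<Longrightarrow> f - g \<in> cont j"
  using cont_add[of f j "- g"] cont_minus by simp
lemma cont_sum: "(\<And>a. a \<in> A \<Longrightarrow> f a \<in> cont j) \<Longrightarrow> sum f A \<in> cont j"
  by (induction A rule: infinite_finite_induct) (auto intro: cont_add)
lemma cont_mult_left: "f \<in> cont j \<Longrightarrow> g * f \<in> cont j"
  unfolding cont_def by (auto elim!: coef_mult_nonzero)
lemma cont_mult_right: "f \<in> cont j \<Longrightarrow> f * g \<in> cont j"
  unfolding cont_def by (auto elim!: coef_mult_nonzero)
lemma cont_of_int_mult: "f \<in> cont j \<Longrightarrow> of_int c * f \<in> cont j"
  by (auto simp: cont_def)
lemma cont_mon: "j \<in> set w \<Longrightarrow> mon w \<in> cont j"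
  by (auto simp: cont_def coef_mon)
lemma cont_mgen [simp]: "mgen j \<in> cont j"
  by (simp add: cont_mon)
text \<open>A word occurring in the product would contain j on both sides of the cut.\<close>

lemma cont_mult_eq_0:
  assumes "f \<in> cont j" "g \<in> cont j"
  shows "f * g = 0"
proof (rule rmag_eqI, rule ccontr)
  fix w :: "nat list" assume w: "distinct w" "coef (f * g) w \<noteq> coef 0 w"
  then have "coef (f * g) w \<noteq> 0" by simp
  then show False
    using w(1) assms by (elim coef_mult_nonzero) (auto simp: cont_def)
qed

lemma cont_lin:
  "(\<And>w. w \<in> dwords n \<Longrightarrow> coef f w \<noteq> 0 \<Longrightarrow> F w \<in> cont j) \<Longrightarrow> lin n F f \<in> cont j"
  unfolding lin_def
  by (rule cont_sum) (metis cont_0 cont_of_int_mult mult_zero_left of_int_0)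

lemma rsub_lin:
  "(\<And>w. w \<in> dwords n \<Longrightarrow> coef f w \<noteq> 0 \<Longrightarrow> F w \<in> rsub S) \<Longrightarrow> lin n F f \<in> rsub S"
  unfolding lin_def
  by (rule rsub_sum) (metis rsub_0 rsub_of_int_mult mult_zero_left of_int_0)

subsection \<open>Coefficient operators\<close>

text \<open>The substitution \<open>y_j = 0\<close>, hence a ring homomorphism.\<close>

lift_definition kill :: "nat \<Rightarrow> rmag \<Rightarrow> rmag" is "\<lambda>j f w. if j \<in> set w then 0 else f w"
  by simp
lift_definition part :: "nat \<Rightarrow> rmag \<Rightarrow> rmag" is "\<lambda>k f w. if length w = k then f w else 0"
  by simp
text \<open>Division by \<open>y_j\<close> on the right, a Fox derivative: words ending in j lose
  that letter, all others are dropped. As words have no repetition, the quotient never contains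
  j.\<close>

lift_definition tail :: "nat \<Rightarrow> rmag \<Rightarrow> rmag" is "\<lambda>j f w. f (w @ [j])"
  by simp

lemma coef_kill: "coef (kill j f) w = (if j \<in> set w then 0 else coef f w)" by transfer simp
lemma coef_part: "coef (part k f) w = (if length w = k then coef f w else 0)" by transfer simp
lemma coef_tail: "coef (tail j f) w = coef f (w @ [j])" by transfer simp

lemma kill_0 [simp]: "kill j 0 = 0" by (rule rmag_eqI) (simp add: coef_kill)
lemma kill_1 [simp]: "kill j 1 = 1" by (rule rmag_eqI) (simp add: coef_kill coef_1)
lemma kill_add [simp]: "kill j (f + g) = kill j f + kill j g"
  by (rule rmag_eqI) (simp add: coef_kill)
lemma kill_minus [simp]: "kill j (- f) = - kill j f" by (rule rmag_eqI) (simp add: coef_kill)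
lemma kill_diff [simp]: "kill j (f - g) = kill j f - kill j g"
  by (rule rmag_eqI) (simp add: coef_kill)
lemma kill_mult [simp]: "kill j (f * g) = kill j f * kill j g"
proof (rule rmag_eqI)
  fix w :: "nat list" assume w: "distinct w"
  show "coef (kill j (f * g)) w = coef (kill j f * kill j g) w"
  proof (cases "j \<in> set w")
    case True
    have "coef (kill j f * kill j g) w = 0"
      by (rule ccontr, erule coef_mult_nonzero) (use True in \<open>auto simp: coef_kill split: if_splits\<close>)
    then show ?thesis using True by (simp add: coef_kill)
  next
    case False
    have "conv (coef f) (coef g) w = conv (coef (kill j f)) (coef (kill j g)) w"
      by (rule conv_cong) (use False in \<open>auto simp: coef_kill\<close>)
    then show ?thesis using False w by (simp add: coef_kill coef_mult)
  qed
qed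
lemma kill_mon: "kill j (mon w) = (if j \<in> set w then 0 else mon w)"
  by (rule rmag_eqI) (auto simp: coef_kill coef_mon)
lemma kill_cont: "f \<in> cont j \<Longrightarrow> kill j f = 0"
  by (rule rmag_eqI) (auto simp: coef_kill cont_def)
lemma diff_kill_cont: "f - kill j f \<in> cont j"
  by (auto simp: cont_def coef_kill)
lemma kill_rsub: "f \<in> rsub S \<Longrightarrow> j \<notin> S \<Longrightarrow> kill j f = f"
  by (rule rmag_eqI) (auto simp: coef_kill rsub_def)
lemma kill_kill [simp]: "kill j (kill j f) = kill j f"
  by (rule rmag_eqI) (simp add: coef_kill)
lemma kill_ordge: "f \<in> ordge d \<Longrightarrow> kill j f \<in> ordge d"
  by (auto simp: ordge_def coef_kill)
lemma kill_part: "kill j (part k f) = part k (kill j f)"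
  by (rule rmag_eqI) (simp add: coef_kill coef_part)
lemma kill_cont_closed: "f \<in> cont i \<Longrightarrow> kill j f \<in> cont i"
  by (auto simp: cont_def coef_kill split: if_splits)

lemma part_0 [simp]: "part k 0 = 0" by (rule rmag_eqI) (simp add: coef_part)
lemma part_add [simp]: "part k (f + g) = part k f + part k g"
  by (rule rmag_eqI) (simp add: coef_part)
lemma part_minus [simp]: "part k (- f) = - part k f" by (rule rmag_eqI) (simp add: coef_part)
lemma part_diff [simp]: "part k (f - g) = part k f - part k g"
  by (rule rmag_eqI) (simp add: coef_part)
lemma part_sum: "part k (sum f A) = (\<Sum>a\<in>A. part k (f a))"
  by (induction A rule: infinite_finite_induct) auto
lemma part_ordge_0: "f \<in> ordge d \<Longrightarrow> k < d \<Longrightarrow> part k f = 0"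
  by (rule rmag_eqI) (auto simp: ordge_def coef_part)
lemma diff_part_ordge: "f \<in> ordge k \<Longrightarrow> f - part k f \<in> ordge (Suc k)"
  by (auto simp: ordge_def coef_part less_Suc_eq)
lemma part_rsub: "f \<in> rsub S \<Longrightarrow> part k f \<in> rsub S"
  by (auto simp: rsub_def coef_part split: if_splits)
lemma part_eq_0_ordge: "f \<in> ordge k \<Longrightarrow> part k f = 0 \<Longrightarrow> f \<in> ordge (Suc k)"
  using diff_part_ordge[of f k] by simp

lemma sum_parts:
  assumes "f \<in> rsub {..<n}" "n < N"
  shows "(\<Sum>k<N. part k f) = f"
proof (rule rmag_eqI)
  fix w :: "nat list" assume w: "distinct w"
  have "coef (\<Sum>k<N. part k f) w = (\<Sum>k<N. if k = length w then coef f w else 0)"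
    unfolding coef_sum by (rule sum.cong) (auto simp: coef_part)
  also have "\<dots> = (if length w < N then coef f w else 0)" by simp
  also have "\<dots> = coef f w"
  proof (cases "coef f w = 0")
    case False
    then have "set w \<subseteq> {..<n}" using assms by (auto simp: rsub_def)
    then have "card (set w) \<le> n" by (metis card_lessThan card_mono finite_lessThan)
    then show ?thesis using assms(2) w by (simp add: distinct_card)
  qed simp
  finally show "coef (\<Sum>k<N. part k f) w = coef f w" .
qed

lemma tail_0 [simp]: "tail j 0 = 0" by (rule rmag_eqI) (simp add: coef_tail)
lemma tail_1 [simp]: "tail j 1 = 0" by (rule rmag_eqI) (simp add: coef_tail coef_1)
lemma tail_add [simp]: "tail j (f + g) = tail j f + tail j g"
  by (rule rmag_eqI) (simp add: coef_tail)
lemma tail_minus [simp]: "tail j (- f) = - tail j f" by (rule rmag_eqI) (simp add: coef_tail)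
lemma tail_diff [simp]: "tail j (f - g) = tail j f - tail j g"
  by (rule rmag_eqI) (simp add: coef_tail)
lemma tail_sum: "tail j (sum f A) = (\<Sum>a\<in>A. tail j (f a))"
  by (induction A rule: infinite_finite_induct) auto
lemma tail_mon_single: "tail j (mgen i) = (if i = j then 1 else 0)"
  by (rule rmag_eqI) (auto simp: coef_tail coef_mon coef_1)
lemma kill_tail [simp]: "kill j (tail j f) = tail j f"
  by (rule rmag_eqI) (auto simp: coef_tail coef_kill)
lemma tail_ordge: "f \<in> ordge (Suc d) \<Longrightarrow> tail j f \<in> ordge d"
  by (auto simp: ordge_def coef_tail)
lemma part_tail: "part k (tail j f) = tail j (part (Suc k) f)"
  by (rule rmag_eqI) (simp add: coef_tail coef_part)
lemma tail_rsub:
  assumes "f \<in> rsub S"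
  shows "tail j f \<in> rsub (S - {j})"
  unfolding rsub_def mem_Collect_eq
proof (intro allI impI)
  fix w assume "coef (tail j f) w \<noteq> 0"
  then have w: "coef f (w @ [j]) \<noteq> 0" by (simp add: coef_tail)
  then have "distinct (w @ [j])" by (metis coef_not_distinct)
  moreover have "set (w @ [j]) \<subseteq> S" using assms w unfolding rsub_def by blast
  ultimately show "set w \<subseteq> S - {j}" by auto
qed
text \<open>Product rule of a Fox derivative. A word ending in j is cut either before its last
  letter, and then the left factor cannot contain j, or at its very end, and then the right factor
  contributes its constant term.\<close>

lemma tail_mult: "tail j (f * g) = kill j f * tail j g + of_int (coef g []) * tail j f"
proof (rule rmag_eqI)
  fix w :: "nat list" assume w: "distinct w"
  have "tail j (f * g) = kill j (tail j (f * g))" by simp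
  also have "coef \<dots> w = (if j \<in> set w then 0 else coef (f * tail j g) w + coef g [] * coef f (w @ [j]))"
    using w by (auto simp: coef_kill coef_tail coef_mult conv_snoc intro!: conv_cong)
  also have "\<dots> = coef (kill j (f * tail j g)) w + coef g [] * coef (kill j (tail j f)) w"
    by (simp del: kill_mult kill_tail add: coef_kill coef_tail)
  finally show "coef (tail j (f * g)) w = coef (kill j f * tail j g + of_int (coef g []) * tail j f) w"
    by simp
qed

lemma tail_mult_0: "coef g [] = 0 \<Longrightarrow> tail j (f * g) = kill j f * tail j g"
  by (simp add: tail_mult)

lemma tail_mult_mgen: "tail j (f * mgen i) = (if i = j then kill j f else 0)"
  by (simp add: tail_mult coef_mon tail_mon_single)

lemma part_mult_mgen: "part (Suc k) (f * mgen i) = part k f * mgen i"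
proof (rule rmag_eqI)
  fix w :: "nat list" assume w: "distinct w"
  show "coef (part (Suc k) (f * mgen i)) w = coef (part k f * mgen i) w"
  proof (cases w rule: rev_cases)
    case Nil
    then show ?thesis by (simp add: coef_part coef_mult coef_mon)
  next
    case (snoc u j)
    have *: "coef (h * mgen i) w = (if i = j then coef (kill j h) u else 0)" for h
      unfolding snoc coef_tail[symmetric] tail_mult_mgen by simp
    show ?thesis unfolding coef_part * using snoc by (simp add: coef_part coef_kill)
  qed
qed

lemma tail_decomp:
  assumes "f \<in> rsub {..<n}" "coef f [] = 0"
  shows "f = (\<Sum>j<n. tail j f * mgen j)"
proof (rule rmag_eqI)
  fix w :: "nat list" assume w: "distinct w"
  show "coef f w = coef (\<Sum>j<n. tail j f * mgen j) w"
  proof (cases w rule: rev_cases)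
    case Nil
    then show ?thesis using assms by (simp add: coef_sum coef_mult coef_mon)
  next
    case (snoc u j)
    have "coef (tail i f * mgen i) w = (if i = j then coef f w else 0)" for i
      using snoc w unfolding snoc coef_tail[symmetric, of "tail i f * mgen i"] tail_mult_mgen
      by (simp add: coef_kill coef_tail)
    then have "coef (\<Sum>j<n. tail j f * mgen j) w = (\<Sum>i<n. if i = j then coef f w else 0)"
      by (simp add: coef_sum)
    also have "\<dots> = (if j < n then coef f w else 0)" by simp
    also have "\<dots> = coef f w"
      using assms(1) snoc by (auto simp: rsub_def)
    finally show ?thesis by simp
  qed
qed

section \<open>The Lie subring generated by the letters, and right-normed spanning sets\<close>

section \<open>Lie elements\<close>

definition hmg :: "nat \<Rightarrow> rmag set" where
  "hmg d = {f. \<forall>w. coef f w \<noteq> 0 \<longrightarrow> length w = d}"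

lemma hmg_0 [simp]: "0 \<in> hmg d"
  by (simp add: hmg_def)
lemma hmg_diff: "f \<in> hmg d \<Longrightarrow> g \<in> hmg d \<Longrightarrow> f - g \<in> hmg d"
  by (auto simp: hmg_def) (metis diff_0_right)
lemma hmg_mult: "f \<in> hmg d \<Longrightarrow> g \<in> hmg e \<Longrightarrow> f * g \<in> hmg (d + e)"
  unfolding hmg_def by (clarsimp elim!: coef_mult_nonzero)
lemma hmg_mon: "mon w \<in> hmg (length w)"
  by (auto simp: hmg_def coef_mon)
lemma part_hmg: "f \<in> hmg d \<Longrightarrow> part k f = (if k = d then f else 0)"
  by (rule rmag_eqI) (auto simp: hmg_def coef_part)

definition comm :: "rmag \<Rightarrow> rmag \<Rightarrow> rmag" where
  "comm a b = a * b - b * a"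

lemma comm_0 [simp]: "comm 0 a = 0" "comm a 0 = 0"
  by (simp_all add: comm_def)
lemma comm_add: "comm (a + a') b = comm a b + comm a' b" "comm a (b + b') = comm a b + comm a b'"
  by (simp_all add: comm_def algebra_simps)
lemma comm_minus: "comm (- a) b = - comm a b" "comm a (- b) = - comm a b"
  by (simp_all add: comm_def)
lemma comm_diff: "comm (a - a') b = comm a b - comm a' b" "comm a (b - b') = comm a b - comm a b'"
  by (simp_all add: comm_def algebra_simps)
lemma comm_swap: "comm a b = - comm b a"
  by (simp add: comm_def)
lemma comm_comm: "comm (comm a b) c = comm a (comm b c) - comm b (comm a c)"
  by (simp add: comm_def algebra_simps)
lemma comm_rsub: "f \<in> rsub S \<Longrightarrow> g \<in> rsub S \<Longrightarrow> comm f g \<in> rsub S"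
  unfolding comm_def by (intro rsub_diff rsub_mult)
lemma comm_cont: "f \<in> cont j \<Longrightarrow> comm f g \<in> cont j" "g \<in> cont j \<Longrightarrow> comm f g \<in> cont j"
  unfolding comm_def by (auto intro: cont_diff cont_mult_left cont_mult_right)
lemma comm_cont_cont: "f \<in> cont j \<Longrightarrow> g \<in> cont j \<Longrightarrow> comm f g = 0"
  by (simp add: comm_def cont_mult_eq_0)
lemma comm_hmg: "f \<in> hmg d \<Longrightarrow> g \<in> hmg e \<Longrightarrow> comm f g \<in> hmg (d + e)"
  unfolding comm_def by (metis add.commute hmg_diff hmg_mult)
lemma comm_ordge: "f \<in> ordge d \<Longrightarrow> g \<in> ordge e \<Longrightarrow> comm f g \<in> ordge (d + e)"
  unfolding comm_def by (metis add.commute ordge_diff ordge_mult)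
lemma kill_comm [simp]: "kill j (comm f g) = comm (kill j f) (kill j g)"
  by (simp add: comm_def)

fun rn_br :: "nat list \<Rightarrow> rmag" where
  "rn_br [] = 0"
| "rn_br [i] = mgen i"
| "rn_br (i # j # w) = comm (mgen i) (rn_br (j # w))"

lemma rn_br_Cons: "w \<noteq> [] \<Longrightarrow> rn_br (i # w) = comm (mgen i) (rn_br w)"
  by (cases w) auto

lemma rn_br_cont: "i \<in> set w \<Longrightarrow> rn_br w \<in> cont i"
  by (induction w rule: rn_br.induct) (auto intro: comm_cont cont_mgen)

text \<open>If the outer letter recurs, both arguments of the commutator contain it, and both
  products vanish.\<close>

lemma rn_br_not_distinct: "\<not> distinct w \<Longrightarrow> rn_br w = 0"
proof (induction w rule: rn_br.induct)
  case (3 i j w)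
  then show ?case
    using comm_cont_cont[OF cont_mon[of i "[i]"] rn_br_cont[of i "j # w"]]
    by (cases "i \<in> set (j # w)") auto
qed auto

lemma rn_br_rsub: "set w \<subseteq> S \<Longrightarrow> rn_br w \<in> rsub S"
  by (induction w rule: rn_br.induct) (auto intro: comm_rsub)

lemma rn_br_hmg: "rn_br w \<in> hmg (length w)"
proof (induction w rule: rn_br.induct)
  case (2 i)
  show ?case using hmg_mon[of "[i]"] by simp
next
  case (3 i j w)
  show ?case using comm_hmg[OF hmg_mon[of "[i]"] 3] by simp
qed auto

lemma part_rn_br: "part k (rn_br w) = (if k = length w then rn_br w else 0)"
  by (rule part_hmg[OF rn_br_hmg])

lemma kill_rn_br: "kill j (rn_br w) = (if j \<in> set w then 0 else rn_br w)"
  using kill_rsub[OF rn_br_rsub[OF subset_refl]] by (auto intro: kill_cont rn_br_cont)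

inductive_set Lie :: "nat \<Rightarrow> rmag set" for n where
  gen: "i < n \<Longrightarrow> mgen i \<in> Lie n"
| zero: "0 \<in> Lie n"
| add: "x \<in> Lie n \<Longrightarrow> y \<in> Lie n \<Longrightarrow> x + y \<in> Lie n"
| minus: "x \<in> Lie n \<Longrightarrow> - x \<in> Lie n"
| comm: "x \<in> Lie n \<Longrightarrow> y \<in> Lie n \<Longrightarrow> comm x y \<in> Lie n"

lemma Lie_diff: "x \<in> Lie n \<Longrightarrow> y \<in> Lie n \<Longrightarrow> x - y \<in> Lie n"
  using Lie.add[OF _ Lie.minus] by fastforce

lemma Lie_rsub: "x \<in> Lie n \<Longrightarrow> x \<in> rsub {..<n}"
  by (induction rule: Lie.induct) (auto intro: rsub_mon rsub_add rsub_minus comm_rsub)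

lemma coef_comm_Nil: "coef (comm x y) [] = 0"
  by (simp add: comm_def coef_mult)

lemma Lie_coef_Nil: "x \<in> Lie n \<Longrightarrow> coef x [] = 0"
  by (induction rule: Lie.induct) (auto simp: coef_mon coef_comm_Nil)

lemma Lie_mono: "x \<in> Lie n \<Longrightarrow> n \<le> n' \<Longrightarrow> x \<in> Lie n'"
  by (induction rule: Lie.induct) (auto intro: Lie.intros)

lemma Lie_kill: "x \<in> Lie n \<Longrightarrow> kill j x \<in> Lie n"
  by (induction rule: Lie.induct) (auto simp: kill_mon intro: Lie.intros)

lemma Lie_kill_Suc: "x \<in> Lie (Suc n) \<Longrightarrow> kill n x \<in> Lie n"
  by (induction rule: Lie.induct) (auto simp: kill_mon intro: Lie.intros)

lemma rn_br_Lie: "set w \<subseteq> {..<n} \<Longrightarrow> rn_br w \<in> Lie n"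
  by (induction w rule: rn_br.induct) (auto intro: Lie.intros)

lemma lin_closed:
  assumes "0 \<in> Y" "\<And>x y. x \<in> Y \<Longrightarrow> y \<in> Y \<Longrightarrow> x + y \<in> Y" "\<And>x. x \<in> Y \<Longrightarrow> - x \<in> Y"
    and F: "\<And>w. w \<in> dwords n \<Longrightarrow> coef f w \<noteq> 0 \<Longrightarrow> F w \<in> (Y :: rmag set)"
  shows "lin n F f \<in> Y"
proof -
  have diff: "x - y \<in> Y" if "x \<in> Y" "y \<in> Y" for x y
    using assms(2)[OF that(1) assms(3)[OF that(2)]] by simp
  have int: "of_int c * x \<in> Y" if "x \<in> Y" for c x
    by (induction c rule: int_induct[where k = 0]) (use that assms(1,2) diff in \<open>auto simp: algebra_simps\<close>)
  have sum: "finite A \<Longrightarrow> (\<And>a. a \<in> A \<Longrightarrow> G a \<in> Y) \<Longrightarrow> sum G A \<in> Y" for G :: "nat list \<Rightarrow> rmag" and A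
    by (induction A rule: finite_induct) (auto intro: assms)
  show ?thesis
    unfolding lin_def
    by (rule sum) (use F int assms(1) in \<open>auto, metis mult_zero_left of_int_0\<close>)
qed

subsection \<open>The ideal of Lie elements containing a given letter\<close>

text \<open>The polynomial a acting on \<open>y_m\<close>, where each letter acts by its adjoint
  action. Right division by \<open>y_m\<close> inverts this up to \<open>kill m\<close>, see
  \<open>tail_T\<close>.\<close>

definition T :: "nat \<Rightarrow> nat \<Rightarrow> rmag \<Rightarrow> rmag" where
  "T n m a = lin n (\<lambda>w. rn_br (w @ [m])) a"

lemma T_0 [simp]: "T n m 0 = 0" and T_add [simp]: "T n m (a + b) = T n m a + T n m b"
  and T_minus [simp]: "T n m (- a) = - T n m a" and T_diff [simp]: "T n m (a - b) = T n m a - T n m b"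
  by (simp_all add: T_def)

lemma T_mon: "w \<in> dwords n \<Longrightarrow> T n m (mon w) = rn_br (w @ [m])"
  by (simp add: T_def lin_mon)

lemma T_1: "T n m 1 = mgen m"
  using T_mon[of "[]" n m] by (simp add: dwords_def)

lemma T_comm_gen: "i < n \<Longrightarrow> comm (mgen i) (T n m a) = T n m (mgen i * a)"
proof -
  assume i: "i < n"
  have "comm (mgen i) (T n m a) = lin n (\<lambda>w. comm (mgen i) (rn_br (w @ [m]))) a"
    unfolding T_def by (rule lin_hom) (simp add: comm_add)
  also have "\<dots> = lin n (\<lambda>w. rn_br (([i] @ w) @ [m])) a"
    by (simp add: rn_br_Cons)
  also have "\<dots> = T n m (mgen i * a)"
    unfolding T_def
    by (rule lin_mon_mult[symmetric]) (use i in \<open>auto simp: rn_br_not_distinct dwords_def\<close>)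
  finally show ?thesis .
qed

text \<open>The adjoint action of a Lie element is its action as an associative polynomial: by the
  Jacobi identity a commutator acts as the commutator of the two actions.\<close>

lemma T_comm: "x \<in> Lie n \<Longrightarrow> comm x (T n m a) = T n m (x * a)"
proof (induction arbitrary: a rule: Lie.induct)
  case (comm x y)
  then show ?case
    by (simp only: comm_comm) (simp add: comm_def[of x y] algebra_simps)
qed (auto simp: T_comm_gen comm_add comm_minus algebra_simps)

lemma T_cont: "T n m a \<in> cont m"
  unfolding T_def by (rule cont_lin) (simp add: rn_br_cont)

lemma T_Lie: "m < n \<Longrightarrow> T n m a \<in> Lie n"
  unfolding T_def
  by (rule lin_closed) (auto intro: Lie.intros intro!: rn_br_Lie simp: dwords_def)

lemma T_rsub: "a \<in> rsub S \<Longrightarrow> T n m a \<in> rsub (insert m S)"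
  unfolding T_def by (rule rsub_lin, rule rn_br_rsub) (auto simp: rsub_def)

text \<open>Only the word w followed by m ends in m. In the bracket of \<open>y_i\<close> with an
  element z containing \<open>y_m\<close>, the product of z and \<open>y_i\<close> ends in i, and
  for i = m it repeats m.\<close>

lemma tail_rn_br: "tail m (rn_br (w @ [m])) = kill m (mon w)"
proof (induction w)
  case Nil
  then show ?case by (simp add: tail_mon_single)
next
  case (Cons i w)
  have c: "rn_br (w @ [m]) \<in> cont m" by (simp add: rn_br_cont)
  then have "coef (rn_br (w @ [m])) [] = 0" by (auto simp: cont_def)
  then show ?case
    by (simp add: rn_br_Cons comm_def tail_mult_0 tail_mult_mgen kill_cont[OF c] Cons.IH
        mon_Cons[of i w])
qed

lemma tail_T: "a \<in> rsub {..<n} \<Longrightarrow> tail m (T n m a) = kill m a"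
proof -
  assume a: "a \<in> rsub {..<n}"
  have "tail m (T n m a) = lin n (\<lambda>w. kill m (mon w)) a"
    unfolding T_def by (subst lin_hom[of "tail m"]) (auto simp: tail_rn_br)
  also have "\<dots> = kill m (lin n mon a)"
    by (rule lin_hom[symmetric]) simp
  finally show ?thesis using a by (simp add: lin_mon_rsub)
qed

lemma kill_T: "j \<noteq> m \<Longrightarrow> kill j (T n m a) = T n m (kill j a)"
proof -
  assume j: "j \<noteq> m"
  have "kill j (T n m a) = lin n (\<lambda>w. kill j (rn_br (w @ [m]))) a"
    unfolding T_def by (rule lin_hom) simp
  also have "\<dots> = T n m (kill j a)"
    unfolding T_def lin_def by (rule sum.cong) (use j in \<open>auto simp: kill_rn_br coef_kill\<close>)
  finally show ?thesis .
qed

lemma part_T: "part (Suc k) (T n m a) = T n m (part k a)"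
proof -
  have "part (Suc k) (T n m a) = lin n (\<lambda>w. part (Suc k) (rn_br (w @ [m]))) a"
    unfolding T_def by (rule lin_hom) simp
  also have "\<dots> = T n m (part k a)"
    unfolding T_def lin_def by (rule sum.cong) (auto simp: part_rn_br coef_part)
  finally show ?thesis .
qed

lemma T_mono: "n \<le> n' \<Longrightarrow> a \<in> rsub {..<n} \<Longrightarrow> T n' m a = T n m a"
  unfolding T_def by (rule lin_mono) (auto simp: rsub_def)

text \<open>Only the summand of a Lie element involving \<open>y\<^sub>m\<close> is seen by the words ending in \<open>m\<close>,
  and it is recovered from them.\<close>

lemma Lie_decomp:
  assumes "m < n" "x \<in> Lie n"
  shows "x = kill m x + T n m (tail m x)"
  using assms(2)
proof (induction rule: Lie.induct)
  case (gen i)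
  then show ?case using T_1 by (simp add: kill_mon tail_mon_single)
next
  case zero
  then show ?case by simp
next
  case (add x y)
  have "x + y = (kill m x + T n m (tail m x)) + (kill m y + T n m (tail m y))"
    by (rule arg_cong2[where f = "(+)", OF add.IH])
  also have "\<dots> = kill m (x + y) + T n m (tail m (x + y))" by simp
  finally show ?case .
next
  case (minus x)
  have "- x = - (kill m x + T n m (tail m x))"
    by (rule arg_cong[where f = uminus, OF minus.IH])
  also have "\<dots> = kill m (- x) + T n m (tail m (- x))" by simp
  finally show ?case .
next
  case (comm x y)
  let ?kx = "kill m x" and ?ky = "kill m y" and ?tx = "tail m x" and ?ty = "tail m y"
  have "comm x y = comm (?kx + T n m ?tx) (?ky + T n m ?ty)"
    by (rule arg_cong2[where f = comm, OF comm.IH])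
  also have "\<dots> = comm ?kx ?ky + comm ?kx (T n m ?ty) - comm ?ky (T n m ?tx)"
    by (simp add: comm_add comm_cont_cont[OF T_cont T_cont] comm_swap[of "T n m ?tx"])
  also have "\<dots> = kill m (comm x y) + T n m (?kx * ?ty - ?ky * ?tx)"
    using comm.hyps by (simp add: T_comm Lie_kill)
  also have "?kx * ?ty - ?ky * ?tx = tail m (comm x y)"
    using comm.hyps by (simp add: comm_def tail_mult_0 Lie_coef_Nil)
  finally show ?case .
qed

lemma Lie_cont_decomp:
  assumes "m < n" "x \<in> Lie n" "x \<in> cont m"
  shows "x = T n m (tail m x)"
  using Lie_decomp[OF assms(1,2)] kill_cont[OF assms(3)] by simp

text \<open>Induction over the letters: by \<open>Lie_decomp\<close> the part involving the last
  letter is a sum of brackets ending in it. Phrased with a set Y closed under addition so as to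
  serve as an induction principle.\<close>

lemma Lie_span:
  assumes "0 \<in> Y" "\<And>x y. x \<in> Y \<Longrightarrow> y \<in> Y \<Longrightarrow> x + y \<in> Y" "\<And>x. x \<in> Y \<Longrightarrow> - x \<in> Y"
    and "\<And>w. w \<in> dwords n \<Longrightarrow> w \<noteq> [] \<Longrightarrow> rn_br w \<in> Y" and "x \<in> Lie n"
  shows "x \<in> Y"
  using assms(4,5)
proof (induction n arbitrary: x)
  case 0
  have "x = 0" using 0(2) by (induction rule: Lie.induct) auto
  then show ?case using assms(1) by simp
next
  case (Suc n)
  have "tail n x \<in> rsub {..<n}"
    using tail_rsub[OF Lie_rsub[OF Suc.prems(2)], of n] by (rule rsub_mono) auto
  then have t: "coef (tail n x) w = 0 \<or> set w \<subseteq> {..<n}" for w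
    by (auto simp: rsub_def)
  have "T (Suc n) n (tail n x) \<in> Y"
    unfolding T_def
  proof (rule lin_closed)
    fix w assume w: "w \<in> dwords (Suc n)" "coef (tail n x) w \<noteq> 0"
    \<comment> \<open>Words of \<open>tail n x\<close> do not contain n, so appending n creates no
      repetition.\<close>
    then have "w @ [n] \<in> dwords (Suc n)" using t[of w] by (auto simp: dwords_def)
    then show "rn_br (w @ [n]) \<in> Y" using Suc.prems(1) by blast
  qed (use assms in auto)
  moreover have "kill n x \<in> Y"
  proof (rule Suc.IH)
    show "rn_br w \<in> Y" if "w \<in> dwords n" "w \<noteq> []" for w
      using Suc.prems(1)[of w] that by (auto simp: dwords_def lessThan_Suc)
  qed (rule Lie_kill_Suc[OF Suc.prems(2)])
  ultimately show ?case
    using Lie_decomp[of n "Suc n" x] Suc.prems(2) assms(2) by fastforce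
qed

subsection \<open>The antipode\<close>

text \<open>The antipode of the tensor algebra. It is an antiautomorphism that equals -1 on Lie
  elements, and so exchanges actions from the right with actions from the left.\<close>

lift_definition antip :: "rmag \<Rightarrow> rmag" is "\<lambda>f w. (-1) ^ length w * f (rev w)"
  by simp

lemma coef_antip: "coef (antip f) w = (-1) ^ length w * coef f (rev w)"
  by transfer simp

lemma antip_add [simp]: "antip (f + g) = antip f + antip g"
  by (rule rmag_eqI) (simp add: coef_antip algebra_simps)
lemma antip_minus [simp]: "antip (- f) = - antip f"
  by (rule rmag_eqI) (simp add: coef_antip)
lemma antip_diff [simp]: "antip (f - g) = antip f - antip g"
  by (rule rmag_eqI) (simp add: coef_antip algebra_simps)
lemma antip_0 [simp]: "antip 0 = 0"
  by (rule rmag_eqI) (simp add: coef_antip)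
lemma antip_antip [simp]: "antip (antip f) = f"
  by (rule rmag_eqI) (simp add: coef_antip flip: mult.assoc power_add)
lemma antip_mgen: "antip (mgen i) = - mgen i"
  by (rule rmag_eqI) (auto simp: coef_antip coef_mon rev_swap)
lemma antip_rsub: "f \<in> rsub S \<Longrightarrow> antip f \<in> rsub S"
  unfolding rsub_def by (auto simp: coef_antip) (metis set_rev subsetD)
lemma kill_antip: "kill j (antip f) = antip (kill j f)"
  by (rule rmag_eqI) (simp add: coef_antip coef_kill)

lemma antip_mult: "antip (f * g) = antip g * antip f"
proof (rule rmag_eqI)
  fix w :: "nat list" assume w: "distinct w"
  have "(\<Sum>(u, v)\<in>{(u, v). u @ v = rev w}. coef f u * coef g v)
      = (\<Sum>(u, v)\<in>{(u, v). u @ v = w}. coef g (rev u) * coef f (rev v))"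
    by (rule sum.reindex_bij_witness[where i = "\<lambda>(u, v). (rev v, rev u)" and j = "\<lambda>(u, v). (rev v, rev u)"])
      (auto simp: rev_append[symmetric] simp del: rev_append)
  then have "coef (antip (f * g)) w
      = (\<Sum>(u, v)\<in>{(u, v). u @ v = w}. (-1) ^ length w * (coef g (rev u) * coef f (rev v)))"
    using w by (simp add: coef_antip coef_mult conv_eq_sum sum_distrib_left case_prod_beta')
  also have "\<dots> = (\<Sum>(u, v)\<in>{(u, v). u @ v = w}. coef (antip g) u * coef (antip f) v)"
    by (rule sum.cong) (auto simp: coef_antip power_add)
  finally show "coef (antip (f * g)) w = coef (antip g * antip f) w"
    using w by (simp add: coef_mult conv_eq_sum)
qed

lemma antip_Lie: "x \<in> Lie n \<Longrightarrow> antip x = - x"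
  by (induction rule: Lie.induct) (auto simp: antip_mgen comm_def antip_mult)

section \<open>Substitutions, tangential derivations and their bracket\<close>

section \<open>Endomorphisms and derivations of the reduced Magnus ring\<close>

lemma prod_list_not_distinct:
  fixes z :: "nat \<Rightarrow> 'r::ring_1"
  assumes "\<And>i u. z i * u * z i = 0" "\<not> distinct w"
  shows "prod_list (map z w) = 0"
proof -
  obtain xs ys zs y where w: "w = xs @ [y] @ ys @ [y] @ zs"
    using not_distinct_decomp[OF assms(2)] by blast
  have "prod_list (map z w)
      = prod_list (map z xs) * (z y * prod_list (map z ys) * z y) * prod_list (map z zs)"
    unfolding w by (simp add: mult.assoc)
  then show ?thesis by (simp add: assms(1))
qed

definition ext :: "nat \<Rightarrow> (nat \<Rightarrow> rmag) \<Rightarrow> rmag \<Rightarrow> rmag" where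
  "ext n z f = lin n (\<lambda>w. prod_list (map z w)) f"

lemma ext_add [simp]: "ext n z (f + g) = ext n z f + ext n z g"
  and ext_diff [simp]: "ext n z (f - g) = ext n z f - ext n z g"
  and ext_0 [simp]: "ext n z 0 = 0" and ext_minus [simp]: "ext n z (- f) = - ext n z f"
  by (simp_all add: ext_def)

lemma ext_1 [simp]: "ext n z 1 = 1"
  unfolding ext_def mon_Nil[symmetric] by (subst lin_mon) (auto simp: dwords_def)

lemma ext_mgen: "i < n \<Longrightarrow> ext n z (mgen i) = z i"
  unfolding ext_def by (subst lin_mon) (auto simp: dwords_def)

text \<open>The hypothesis sends every word with a repeated letter to zero, which is what
  \<open>lin_mult\<close> asks for.\<close>

lemma ext_mult:
  assumes "\<And>i u. z i * u * z i = 0"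
  shows "ext n z (f * g) = ext n z f * ext n z g"
proof -
  have "ext n z (f * g) = (\<Sum>u\<in>dwords n. \<Sum>v\<in>dwords n. of_int (coef f u) * of_int (coef g v)
      * prod_list (map z (u @ v)))"
    unfolding ext_def by (rule lin_mult) (rule prod_list_not_distinct[OF assms])
  also have "\<dots> = (\<Sum>u\<in>dwords n. \<Sum>v\<in>dwords n. (of_int (coef f u) * prod_list (map z u))
      * (of_int (coef g v) * prod_list (map z v)))"
  proof (intro sum.cong refl)
    fix u v
    have "of_int (coef g v) * prod_list (map z u) = prod_list (map z u) * of_int (coef g v)"
      by (rule mult_of_int_commute)
    then show "of_int (coef f u) * of_int (coef g v) * prod_list (map z (u @ v))
      = (of_int (coef f u) * prod_list (map z u)) * (of_int (coef g v) * prod_list (map z v))"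
      by (metis (no_types, lifting) map_append mult.assoc prod_list.append)
  qed
  finally show ?thesis
    unfolding ext_def lin_def by (simp add: sum_product)
qed

fun dw :: "(nat \<Rightarrow> rmag) \<Rightarrow> nat list \<Rightarrow> rmag" where
  "dw z [] = 0"
| "dw z (i # w) = z i * mon w + mgen i * dw z w"

lemma dw_append: "dw z (u @ v) = dw z u * mon v + mon u * dw z v"
proof (induction u)
  case (Cons i u)
  have "dw z ((i # u) @ v) = z i * mon (u @ v) + mgen i * dw z (u @ v)" by simp
  also have "\<dots> = (z i * mon u + mgen i * dw z u) * mon v + mgen i * mon u * dw z v"
    unfolding Cons mon_mult[symmetric] by (simp add: algebra_simps)
  finally show ?case by (simp add: mon_Cons[of i u])
qed simp

lemma dw_cont: "(\<And>i. z i \<in> cont i) \<Longrightarrow> i \<in> set w \<Longrightarrow> dw z w \<in> cont i"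
proof (induction w)
  case (Cons a w)
  then show ?case
    by (cases "i = a") (auto intro!: cont_add intro: cont_mult_left cont_mult_right cont_mon cont_mgen)
qed simp

text \<open>If i occurs twice, every term of the Leibniz expansion still has two factors containing
  i, because \<open>z i\<close> contains it. So the Leibniz rule is compatible with the
  truncation.\<close>

lemma dw_not_distinct:
  assumes "\<And>i. z i \<in> cont i"
  shows "\<not> distinct w \<Longrightarrow> dw z w = 0"
proof (induction w)
  case (Cons i w)
  then show ?case
    by (cases "i \<in> set w") (auto simp: cont_mult_eq_0[of _ i] assms cont_mon dw_cont)
qed simp

lemma dw_add: "dw (\<lambda>i. z i + z' i) w = dw z w + dw z' w"
  by (induction w) (auto simp: algebra_simps)

text \<open>A tangential derivation \<open>y\<^sub>j \<mapsto> [s\<^sub>j, y\<^sub>j]\<close> is encoded by the single element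
  \<open>\<Sum>\<^sub>j s\<^sub>j y\<^sub>j\<close>, from which \<open>s\<^sub>j\<close> is read off by \<^term>\<open>tail j\<close>.\<close>

definition delta :: "nat \<Rightarrow> rmag \<Rightarrow> rmag \<Rightarrow> rmag" where
  "delta n d f = lin n (dw (\<lambda>i. comm (tail i d) (mgen i))) f"

lemma delta_add [simp]: "delta n d (f + g) = delta n d f + delta n d g"
  and delta_diff [simp]: "delta n d (f - g) = delta n d f - delta n d g"
  and delta_0 [simp]: "delta n d 0 = 0" and delta_minus [simp]: "delta n d (- f) = - delta n d f"
  by (simp_all add: delta_def)

lemma delta_add_left: "delta n (d + d') f = delta n d f + delta n d' f"
  unfolding delta_def tail_add comm_add dw_add lin_add_fun ..

lemma delta_mgen: "i < n \<Longrightarrow> delta n d (mgen i) = comm (tail i d) (mgen i)"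
  unfolding delta_def by (subst lin_mon) (auto simp: dwords_def)

lemma delta_mon: "w \<in> dwords n \<Longrightarrow> delta n d (mon w) = dw (\<lambda>i. comm (tail i d) (mgen i)) w"
  unfolding delta_def by (rule lin_mon)

text \<open>The expansion replaces the undifferentiated factor by its part on the first n letters;
  the support hypotheses say that this is the factor itself.\<close>

lemma delta_mult:
  assumes "f \<in> rsub {..<n}" "g \<in> rsub {..<n}"
  shows "delta n d (f * g) = delta n d f * g + f * delta n d g"
proof -
  let ?F = "dw (\<lambda>i. comm (tail i d) (mgen i))"
  let ?c = "\<lambda>f u. of_int (coef f u) :: rmag"
  have "delta n d (f * g) = (\<Sum>u\<in>dwords n. \<Sum>v\<in>dwords n. ?c f u * ?c g v * ?F (u @ v))"
    unfolding delta_def by (rule lin_mult, rule dw_not_distinct) (simp add: comm_cont)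
  also have "\<dots> = (\<Sum>u\<in>dwords n. \<Sum>v\<in>dwords n.
      (?c f u * ?F u) * (?c g v * mon v) + (?c f u * mon u) * (?c g v * ?F v))"
  proof (intro sum.cong refl)
    fix u v
    have "?c g v * h = h * ?c g v" for h by (rule mult_of_int_commute)
    then show "?c f u * ?c g v * ?F (u @ v)
      = (?c f u * ?F u) * (?c g v * mon v) + (?c f u * mon u) * (?c g v * ?F v)"
      unfolding dw_append distrib_left by (metis (no_types, lifting) mult.assoc)
  qed
  also have "\<dots> = delta n d f * lin n mon g + lin n mon f * delta n d g"
    unfolding delta_def lin_def by (simp add: sum_product sum.distrib)
  finally show ?thesis using assms by (simp add: lin_mon_rsub)
qed

lemma delta_comm:
  assumes "f \<in> rsub {..<n}" "g \<in> rsub {..<n}"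
  shows "delta n d (comm f g) = comm (delta n d f) g + comm f (delta n d g)"
  using assms by (simp add: comm_def delta_mult algebra_simps)

lemma dw_rsub:
  "(\<And>i. i \<in> set w \<Longrightarrow> z i \<in> rsub S) \<Longrightarrow> set w \<subseteq> S \<Longrightarrow> dw z w \<in> rsub S"
  by (induction w) (auto intro!: rsub_add rsub_mult rsub_mon)

lemma delta_rsub:
  "d \<in> rsub {..<n} \<Longrightarrow> delta n d f \<in> rsub {..<n}"
  unfolding delta_def
  by (intro rsub_lin dw_rsub comm_rsub)
    (auto simp: dwords_def intro: rsub_mono[OF tail_rsub] intro!: rsub_mon)

lemma dw_ordge:
  assumes "\<And>i. z i \<in> ordge (Suc k)"
  shows "dw z w \<in> ordge (length w + k)"
proof (induction w)
  case (Cons i w)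
  have "z i * mon w \<in> ordge (Suc k + length w)"
    by (rule ordge_mult[OF assms ordge_mon])
  moreover have "mgen i * dw z w \<in> ordge (length [i] + (length w + k))"
    by (rule ordge_mult[OF ordge_mon Cons.IH])
  ultimately show ?case by (auto intro!: ordge_add simp: add_ac)
qed simp

lemma delta_ordge:
  assumes "\<And>i. tail i d \<in> ordge k" "f \<in> ordge e"
  shows "delta n d f \<in> ordge (e + k)"
  unfolding delta_def
proof (rule ordge_lin[OF assms(2)])
  fix w
  show "dw (\<lambda>i. comm (tail i d) (mgen i)) w \<in> ordge (length w + k)"
    by (rule dw_ordge) (use comm_ordge[OF assms(1) ordge_mon[of "[_]"]] in simp)
qed

lemma delta_Lie:
  assumes "\<And>i. i < n \<Longrightarrow> tail i d \<in> Lie n" "f \<in> Lie n"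
  shows "delta n d f \<in> Lie n"
  using assms(2)
  by (induction rule: Lie.induct)
    (auto simp: delta_mgen delta_comm Lie_rsub assms(1) intro: Lie.intros)

lemma delta_mono:
  assumes "m \<le> n" "f \<in> rsub {..<m}"
  shows "delta n d f = delta m d f"
  unfolding delta_def by (rule lin_mono) (use assms in \<open>auto simp: rsub_def\<close>)

lemma additive_eq_on_rsub:
  fixes h h' :: "rmag \<Rightarrow> rmag"
  assumes "\<And>x y. h (x + y) = h x + h y" "\<And>x y. h' (x + y) = h' x + h' y"
    and "\<And>w. w \<in> dwords n \<Longrightarrow> h (mon w) = h' (mon w)" and f: "f \<in> rsub {..<n}"
  shows "h f = h' f"
proof -
  have "h (lin n mon f) = h' (lin n mon f)"
    unfolding lin_hom[of h, OF assms(1)] lin_hom[of h', OF assms(2)]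
    by (rule lin_cong) (rule assms(3))
  then show ?thesis using f by (simp add: lin_mon_rsub)
qed

subsection \<open>The Lie ring of tangential derivations\<close>

text \<open>Only the class of s_j modulo words with \<open>y_j\<close> matters for the derivation,
  and \<open>tail j\<close> picks the representative without \<open>y_j\<close>. The encoding shifts
  degrees: components of degree k are encoded by words of length k + 1.\<close>

definition TD :: "nat \<Rightarrow> rmag set" where
  "TD n = {d \<in> rsub {..<n}. coef d [] = 0 \<and> (\<forall>j<n. tail j d \<in> Lie n)}"

text \<open>The commutator of the two derivations is evaluated at each letter and encoded again:
  from the bracket of s with \<open>y_j\<close>, \<open>tail j\<close> recovers s up to words
  containing j.\<close>

definition brD :: "nat \<Rightarrow> rmag \<Rightarrow> rmag \<Rightarrow> rmag" where
  "brD n d e = (\<Sum>j<n. tail j (delta n d (delta n e (mgen j)) - delta n e (delta n d (mgen j))) * mgen j)"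

lemma TD_0 [simp]: "0 \<in> TD n"
  by (auto simp: TD_def intro: Lie.zero)
lemma TD_add: "d \<in> TD n \<Longrightarrow> e \<in> TD n \<Longrightarrow> d + e \<in> TD n"
  by (auto simp: TD_def intro: Lie.add rsub_add)
lemma TD_minus: "d \<in> TD n \<Longrightarrow> - d \<in> TD n"
  by (auto simp: TD_def intro: Lie.minus rsub_minus)
lemma TD_diff: "d \<in> TD n \<Longrightarrow> e \<in> TD n \<Longrightarrow> d - e \<in> TD n"
  using TD_add[OF _ TD_minus] by fastforce

lemma TD_rsub: "d \<in> TD n \<Longrightarrow> d \<in> rsub {..<n}"
  and TD_tail: "d \<in> TD n \<Longrightarrow> j < n \<Longrightarrow> tail j d \<in> Lie n"
  and TD_Nil: "d \<in> TD n \<Longrightarrow> coef d [] = 0"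
  by (auto simp: TD_def)

lemma tail_rsub_ge: "d \<in> rsub {..<n} \<Longrightarrow> n \<le> j \<Longrightarrow> tail j d = 0"
  by (rule rmag_eqI) (fastforce simp: coef_tail rsub_def)

lemma TD_eqI:
  assumes "d \<in> TD n" "e \<in> TD n" "\<And>j. j < n \<Longrightarrow> tail j d = tail j e"
  shows "d = e"
proof -
  have "d = (\<Sum>j<n. tail j d * mgen j)"
    using assms(1) by (intro tail_decomp) (auto simp: TD_def)
  also have "\<dots> = (\<Sum>j<n. tail j e * mgen j)"
    using assms(3) by simp
  also have "\<dots> = e"
    using assms(2) by (intro tail_decomp[symmetric]) (auto simp: TD_def)
  finally show ?thesis .
qed

lemma tail_sum_mgen: "j < n \<Longrightarrow> tail j (\<Sum>i<n. s i * mgen i) = kill j (s j)"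
  by (simp add: tail_sum tail_mult_mgen sum.delta)

lemma TD_sumI:
  assumes "\<And>j. j < n \<Longrightarrow> s j \<in> Lie n"
  shows "(\<Sum>j<n. s j * mgen j) \<in> TD n"
  unfolding TD_def
proof (intro CollectI conjI allI impI)
  show "(\<Sum>j<n. s j * mgen j) \<in> rsub {..<n}"
    by (intro rsub_sum rsub_mult) (use assms Lie_rsub in \<open>auto intro: rsub_mon\<close>)
  show "coef (\<Sum>j<n. s j * mgen j) [] = 0"
    by (simp add: coef_sum coef_mult coef_mon)
  show "tail j (\<Sum>j<n. s j * mgen j) \<in> Lie n" if "j < n" for j
    using that assms by (simp add: tail_sum_mgen Lie_kill)
qed

lemma tail_comm_mgen: "coef u [] = 0 \<Longrightarrow> tail j (comm u (mgen j)) = kill j u"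
  by (simp add: comm_def tail_mult_mgen tail_mult_0 kill_mon)

text \<open>The part of u that contains \<open>y_j\<close> multiplies with \<open>y_j\<close> to
  zero on either side.\<close>

lemma comm_kill_mgen: "comm (kill j u) (mgen j) = comm u (mgen j)"
proof -
  have "comm (u - kill j u) (mgen j) = 0"
    by (rule comm_cont_cont[of _ j]) (auto intro: diff_kill_cont cont_mon)
  then show ?thesis by (simp add: comm_diff)
qed

text \<open>The Leibniz rule on the bracket of a component with \<open>y_j\<close> leaves, besides
  the differentiated components, two double brackets; the Jacobi identity merges these into the
  bracket of the components, in reversed order.\<close>

lemma delta_commutator:
  assumes "d \<in> TD n" "e \<in> TD n" "j < n"
  shows "delta n d (delta n e (mgen j)) - delta n e (delta n d (mgen j))
    = comm (delta n d (tail j e) - delta n e (tail j d) + comm (tail j e) (tail j d)) (mgen j)"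
  using assms
  by (simp add: delta_mgen delta_comm TD_tail Lie_rsub rsub_mon comm_add comm_diff comm_comm)

lemma tail_brD:
  assumes "d \<in> TD n" "e \<in> TD n" "j < n"
  shows "tail j (brD n d e)
    = kill j (delta n d (tail j e) - delta n e (tail j d) + comm (tail j e) (tail j d))"
proof -
  have "delta n d (tail j e) - delta n e (tail j d) + comm (tail j e) (tail j d) \<in> Lie n"
    using assms by (intro Lie.add Lie_diff Lie.comm delta_Lie TD_tail)
  then show ?thesis
    using assms unfolding brD_def
    by (subst tail_sum_mgen) (simp_all only: delta_commutator kill_tail tail_comm_mgen Lie_coef_Nil kill_kill)
qed

lemma brD_TD:
  assumes "d \<in> TD n" "e \<in> TD n"
  shows "brD n d e \<in> TD n"
proof -
  have "brD n d e = (\<Sum>j<n. kill j (delta n d (tail j e) - delta n e (tail j d)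
      + comm (tail j e) (tail j d)) * mgen j)"
    unfolding brD_def
  proof (rule sum.cong[OF refl])
    fix j assume "j \<in> {..<n}"
    moreover from this have "delta n d (tail j e) - delta n e (tail j d) + comm (tail j e) (tail j d) \<in> Lie n"
      using assms by (intro Lie.add Lie_diff Lie.comm delta_Lie TD_tail) auto
    ultimately show "tail j (delta n d (delta n e (mgen j)) - delta n e (delta n d (mgen j))) * mgen j
      = kill j (delta n d (tail j e) - delta n e (tail j d) + comm (tail j e) (tail j d)) * mgen j"
      using assms by (simp only: delta_commutator lessThan_iff tail_comm_mgen Lie_coef_Nil)
  qed
  also have "\<dots> \<in> TD n"
    using assms by (intro TD_sumI Lie_kill Lie.add Lie_diff Lie.comm delta_Lie TD_tail)
  finally show ?thesis .
qed

text \<open>A commutator of derivations is a derivation, so agreement on the letters propagates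
  along words.\<close>

lemma delta_brD:
  assumes "d \<in> TD n" "e \<in> TD n" "f \<in> rsub {..<n}"
  shows "delta n (brD n d e) f = delta n d (delta n e f) - delta n e (delta n d f)"
proof -
  have rs: "delta n d g \<in> rsub {..<n}" "delta n e g \<in> rsub {..<n}" for g
    using assms by (auto intro: delta_rsub TD_rsub)
  have gen: "delta n (brD n d e) (mgen j) = delta n d (delta n e (mgen j)) - delta n e (delta n d (mgen j))"
    if "j < n" for j
    using assms that
    by (simp add: delta_commutator delta_mgen[of j n "brD n d e"] tail_brD comm_kill_mgen
        del: kill_add kill_diff kill_comm)
  have mon: "delta n (brD n d e) (mon w) = delta n d (delta n e (mon w)) - delta n e (delta n d (mon w))"
    if "set w \<subseteq> {..<n}" for w
    using that
  proof (induction w)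
    case Nil
    have "delta n d' (mon []) = 0" for d'
      using delta_mon[of "[]" n d'] by (simp add: dwords_def)
    then show ?case by (metis delta_0 diff_self)
  next
    case (Cons i w)
    then have r: "mgen i \<in> rsub {..<n}" "mon w \<in> rsub {..<n}" "i < n" by (auto intro: rsub_mon)
    show ?case
      unfolding mon_Cons[of i w]
      using Cons by (simp add: delta_mult r rs gen ring_distribs)
  qed
  show ?thesis
    by (rule additive_eq_on_rsub[of "delta n (brD n d e)" "\<lambda>f. delta n d (delta n e f) - delta n e (delta n d f)",
          OF _ _ _ assms(3)])
      (auto simp: mon dwords_def)
qed

lemma brD_add_left: "brD n (d + d') e = brD n d e + brD n d' e"
  by (simp add: brD_def delta_add_left sum.distrib[symmetric] algebra_simps)

lemma brD_add_right: "brD n e (d + d') = brD n e d + brD n e d'"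
  by (simp add: brD_def delta_add_left sum.distrib[symmetric] algebra_simps)

lemma brD_swap: "brD n d e = - brD n e d"
  unfolding brD_def sum_negf[symmetric] by (rule sum.cong) (auto simp: algebra_simps)

lemma brD_jacobi:
  assumes "d \<in> TD n" "e \<in> TD n" "f \<in> TD n"
  shows "brD n d (brD n e f) = brD n (brD n d e) f + brD n e (brD n d f)"
  unfolding brD_def[of n d "brD n e f"] brD_def[of n "brD n d e" f] brD_def[of n e "brD n d f"]
    sum.distrib[symmetric]
proof (rule sum.cong[OF refl])
  fix j assume "j \<in> {..<n}"
  then have r: "mgen j \<in> rsub {..<n}" by (auto intro: rsub_mon)
  have rs: "delta n d g \<in> rsub {..<n}" "delta n e g \<in> rsub {..<n}" "delta n f g \<in> rsub {..<n}" for g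
    using assms by (auto intro: delta_rsub TD_rsub)
  show "tail j (delta n d (delta n (brD n e f) (mgen j)) - delta n (brD n e f) (delta n d (mgen j))) * mgen j
    = tail j (delta n (brD n d e) (delta n f (mgen j)) - delta n f (delta n (brD n d e) (mgen j))) * mgen j
    + tail j (delta n e (delta n (brD n d f) (mgen j)) - delta n (brD n d f) (delta n e (mgen j))) * mgen j"
    using assms r rs by (simp add: delta_brD algebra_simps)
qed

text \<open>Derivations of smaller rank annihilate the additional letters. This lets rank m be
  treated inside rank m + 1 with the same bracket.\<close>

lemma brD_mono:
  assumes "d \<in> TD m" "e \<in> TD m" "m \<le> n"
  shows "brD n d e = brD m d e"
proof -
  have z: "delta n d (mgen j) = 0" "delta n e (mgen j) = 0" if "j < n" "j \<ge> m" for j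
    using that assms by (simp_all add: delta_mgen tail_rsub_ge[OF TD_rsub])
  have "brD n d e = (\<Sum>j<m. tail j (delta n d (delta n e (mgen j)) - delta n e (delta n d (mgen j))) * mgen j)"
    unfolding brD_def by (rule sum.mono_neutral_right) (use assms(3) z in auto)
  also have "\<dots> = brD m d e"
    unfolding brD_def
  proof (rule sum.cong[OF refl])
    fix j assume "j \<in> {..<m}"
    then have r: "mgen j \<in> rsub {..<m}" by (auto intro: rsub_mon)
    have rs: "delta m d g \<in> rsub {..<m}" "delta m e g \<in> rsub {..<m}" for g
      using assms by (auto intro: delta_rsub TD_rsub)
    show "tail j (delta n d (delta n e (mgen j)) - delta n e (delta n d (mgen j))) * mgen j
      = tail j (delta m d (delta m e (mgen j)) - delta m e (delta m d (mgen j))) * mgen j"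
      by (simp add: delta_mono[OF assms(3)] r rs)
  qed
  finally show ?thesis .
qed

section \<open>Faithfulness of the Magnus map and leading terms of group elements\<close>

section \<open>Reduced free groups and their Magnus embedding\<close>

lemma (in group) centralizer_subgroup:
  assumes "c \<in> carrier G"
  shows "subgroup {a \<in> carrier G. a \<otimes> c = c \<otimes> a} G"
proof (rule subgroupI)
  fix a b assume "a \<in> {a \<in> carrier G. a \<otimes> c = c \<otimes> a}" "b \<in> {a \<in> carrier G. a \<otimes> c = c \<otimes> a}"
  then have *: "a \<in> carrier G" "b \<in> carrier G" "a \<otimes> c = c \<otimes> a" "b \<otimes> c = c \<otimes> b" by auto
  then have "a \<otimes> b \<otimes> c = c \<otimes> (a \<otimes> b)" using assms by (metis m_assoc)
  then show "a \<otimes> b \<in> {a \<in> carrier G. a \<otimes> c = c \<otimes> a}" using * by simp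
next
  fix a assume "a \<in> {a \<in> carrier G. a \<otimes> c = c \<otimes> a}"
  then have *: "a \<in> carrier G" "a \<otimes> c = c \<otimes> a" by auto
  have "inv a \<otimes> (a \<otimes> c) \<otimes> inv a = inv a \<otimes> (c \<otimes> a) \<otimes> inv a" using * by simp
  then show "inv a \<in> {a \<in> carrier G. a \<otimes> c = c \<otimes> a}"
    using * assms by (simp add: m_assoc inv_solve_left inv_solve_right)
qed (use assms in auto)

lemma (in group) generate_commute:
  assumes S: "S \<subseteq> carrier G" and comm: "\<And>s t. s \<in> S \<Longrightarrow> t \<in> S \<Longrightarrow> s \<otimes> t = t \<otimes> s"
    and a: "a \<in> generate G S" and b: "b \<in> generate G S"
  shows "a \<otimes> b = b \<otimes> a"
proof -
  have 1: "a \<otimes> t = t \<otimes> a" if "t \<in> S" for t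
  proof -
    have "generate G S \<subseteq> {a \<in> carrier G. a \<otimes> t = t \<otimes> a}"
      using that S comm by (intro generate_subgroup_incl centralizer_subgroup) auto
    then show ?thesis using a by auto
  qed
  have aG: "a \<in> carrier G" using generate_in_carrier[OF S a] .
  have "generate G S \<subseteq> {b \<in> carrier G. b \<otimes> a = a \<otimes> b}"
    using S 1 aG by (intro generate_subgroup_incl centralizer_subgroup) auto
  then show ?thesis using b by auto
qed

lemma coef_mgen_mult:
  "coef (mgen i * a) (j # w) = (if i = j \<and> distinct (j # w) then coef a w else 0)"
proof (cases "distinct (j # w)")
  case True
  have "coef (mgen i * a) (j # w) = conv (\<lambda>u. coef (mgen i) (j # u)) (coef a) w"
    using True by (simp add: coef_mult coef_mon)
  also have "(\<lambda>u. coef (mgen i) (j # u)) = (if i = j then (\<lambda>w. if w = [] then 1 else 0) else (\<lambda>_. 0))"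
    by (auto simp: coef_mon fun_eq_iff)
  finally show ?thesis using True by (simp add: conv_one_left conv_zero_left)
next
  case False
  then show ?thesis using coef_not_distinct[of "j # w"] by auto
qed

lemma coef_mgen_mult_Nil: "coef (mgen i * a) [] = 0"
  by (simp add: coef_mult coef_mon)

text \<open>Generators that commute with their own conjugates, together with a multiplicative map
  taking the Magnus values. Injectivity of \<open>\<mu>\<close> is derived from these alone, so that
  automorphisms can be studied without cosets of words.\<close>

locale reduced_free = group Q for Q (structure) +
  fixes n :: nat and xg :: "nat \<Rightarrow> 'a" and \<mu> :: "'a \<Rightarrow> rmag"
  assumes X_closed: "i < n \<Longrightarrow> xg i \<in> carrier Q"
    and gen: "generate Q (xg ` {..<n}) = carrier Q"
    and X_conj: "i < n \<Longrightarrow> g \<in> carrier Q \<Longrightarrow>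
      xg i \<otimes> (g \<otimes> xg i \<otimes> inv g) = (g \<otimes> xg i \<otimes> inv g) \<otimes> xg i"
    and mu_one: "\<mu> \<one> = 1"
    and mu_mult: "g \<in> carrier Q \<Longrightarrow> h \<in> carrier Q \<Longrightarrow> \<mu> (g \<otimes> h) = \<mu> g * \<mu> h"
    and mu_X: "i < n \<Longrightarrow> \<mu> (xg i) = 1 + mgen i"
begin

lemma mu_inv: "g \<in> carrier Q \<Longrightarrow> \<mu> g * \<mu> (inv g) = 1" "g \<in> carrier Q \<Longrightarrow> \<mu> (inv g) * \<mu> g = 1"
  using mu_mult[of g "inv g"] mu_mult[of "inv g" g] mu_one by simp_all

lemma mu_inv_eqI: "g \<in> carrier Q \<Longrightarrow> \<mu> g * a = 1 \<Longrightarrow> \<mu> (inv g) = a"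
  by (metis mu_inv(2) mult.assoc mult_1_left mult_1_right)

lemma mgen_sq: "mgen i * mgen i = 0"
  by (simp add: mon_mult)

lemma mu_inv_X: "i < n \<Longrightarrow> \<mu> (inv (xg i)) = 1 - mgen i"
  by (rule mu_inv_eqI) (auto simp: X_closed mu_X algebra_simps mgen_sq)

definition N :: "nat \<Rightarrow> 'a set" where
  "N i = generate Q ((\<lambda>g. g \<otimes> xg i \<otimes> inv g) ` carrier Q)"

lemma conjs_closed: "i < n \<Longrightarrow> (\<lambda>g. g \<otimes> xg i \<otimes> inv g) ` carrier Q \<subseteq> carrier Q"
  using X_closed by auto

lemma N_subgroup: "i < n \<Longrightarrow> subgroup (N i) Q"
  unfolding N_def by (rule generate_is_subgroup[OF conjs_closed])

lemma N_closed: "i < n \<Longrightarrow> c \<in> N i \<Longrightarrow> c \<in> carrier Q"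
  by (rule subgroup.mem_carrier[OF N_subgroup])

lemma N_normal: "i < n \<Longrightarrow> N i \<lhd> Q"
  unfolding N_def
proof (rule normal_generateI[OF conjs_closed])
  fix h g assume i: "i < n" and h: "h \<in> (\<lambda>g. g \<otimes> xg i \<otimes> inv g) ` carrier Q" and g: "g \<in> carrier Q"
  then obtain k where k: "k \<in> carrier Q" "h = k \<otimes> xg i \<otimes> inv k" by auto
  have "g \<otimes> h \<otimes> inv g = (g \<otimes> k) \<otimes> xg i \<otimes> inv (g \<otimes> k)"
    using g k X_closed[OF i] by (simp add: m_assoc inv_mult_group)
  then show "g \<otimes> h \<otimes> inv g \<in> (\<lambda>g. g \<otimes> xg i \<otimes> inv g) ` carrier Q"
    using g k by blast
qed

lemma N_conj: "i < n \<Longrightarrow> g \<in> carrier Q \<Longrightarrow> c \<in> N i \<Longrightarrow> g \<otimes> c \<otimes> inv g \<in> N i"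
  by (rule normal.inv_op_closed2[OF N_normal])

lemma N_conj': "i < n \<Longrightarrow> g \<in> carrier Q \<Longrightarrow> c \<in> N i \<Longrightarrow> inv g \<otimes> c \<otimes> g \<in> N i"
  by (rule normal.inv_op_closed1[OF N_normal])

lemma N_X: "i < n \<Longrightarrow> xg i \<in> N i"
  unfolding N_def by (rule generate.incl, rule image_eqI[of _ _ \<one>]) (auto simp: X_closed)

text \<open>Conjugating by the inverse of g reduces two conjugates of \<open>x_i\<close> to
  \<open>x_i\<close> itself and one conjugate, which is the case of \<open>X_conj\<close>.\<close>

lemma N_commute:
  assumes i: "i < n" and "a \<in> N i" "b \<in> N i"
  shows "a \<otimes> b = b \<otimes> a"
proof (rule generate_commute[OF conjs_closed[OF i]])
  fix s t assume "s \<in> (\<lambda>g. g \<otimes> xg i \<otimes> inv g) ` carrier Q" "t \<in> (\<lambda>g. g \<otimes> xg i \<otimes> inv g) ` carrier Q"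
  then obtain g h where gh: "g \<in> carrier Q" "h \<in> carrier Q"
    and s: "s = g \<otimes> xg i \<otimes> inv g" and t: "t = h \<otimes> xg i \<otimes> inv h" by auto
  let ?k = "inv g \<otimes> h"
  have k: "?k \<in> carrier Q" using gh by simp
  have "s \<otimes> t = g \<otimes> (xg i \<otimes> (?k \<otimes> xg i \<otimes> inv ?k)) \<otimes> inv g"
    unfolding s t using gh X_closed[OF i] by (simp add: m_assoc inv_mult_group)
  also have "\<dots> = g \<otimes> ((?k \<otimes> xg i \<otimes> inv ?k) \<otimes> xg i) \<otimes> inv g"
    using X_conj[OF i k] by simp
  also have "\<dots> = t \<otimes> s"
  proof -
    have "g \<otimes> (inv g \<otimes> z) = z" if "z \<in> carrier Q" for z
      using that gh by (metis inv_closed m_assoc r_inv l_one)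
    then show ?thesis
      unfolding s t using gh X_closed[OF i] by (simp add: m_assoc inv_mult_group)
  qed
  finally show "s \<otimes> t = t \<otimes> s" .
qed (use assms in \<open>auto simp: N_def\<close>)

lemma N_comm_group: "i < n \<Longrightarrow> comm_group (Q\<lparr>carrier := N i\<rparr>)"
  by (rule group.group_comm_groupI)
    (auto simp: subgroup.subgroup_is_group[OF N_subgroup] is_group N_commute)

lemma gcomm_closed: "g \<in> carrier Q \<Longrightarrow> h \<in> carrier Q \<Longrightarrow> gcomm Q g h \<in> carrier Q"
  by (simp add: gcomm_def)

lemma gcomm_N:
  assumes i: "i < n" and g: "g \<in> carrier Q" and c: "c \<in> N i"
  shows "gcomm Q g c \<in> N i" "gcomm Q c g \<in> N i"
proof -
  note sub = N_subgroup[OF i]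
  have cQ: "c \<in> carrier Q" using N_closed[OF i c] .
  have ic: "inv c \<in> N i" using sub c by (rule subgroup.m_inv_closed)
  show "gcomm Q g c \<in> N i"
    unfolding gcomm_def by (rule subgroup.m_closed[OF sub N_conj[OF i g c] ic])
  have "c \<otimes> (g \<otimes> inv c \<otimes> inv g) \<in> N i"
    by (rule subgroup.m_closed[OF sub c N_conj[OF i g ic]])
  then show "gcomm Q c g \<in> N i"
    using g cQ by (simp add: gcomm_def m_assoc)
qed

primrec rn_gcomm :: "nat \<Rightarrow> nat list \<Rightarrow> 'a" where
  "rn_gcomm m [] = xg m"
| "rn_gcomm m (i # w) = gcomm Q (xg i) (rn_gcomm m w)"

lemma rn_gcomm_closed: "m < n \<Longrightarrow> set w \<subseteq> {..<n} \<Longrightarrow> rn_gcomm m w \<in> carrier Q"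
  by (induction w) (auto simp: X_closed gcomm_closed)

lemma rn_gcomm_N:
  "m < n \<Longrightarrow> set w \<subseteq> {..<n} \<Longrightarrow> i = m \<or> i \<in> set w \<Longrightarrow> rn_gcomm m w \<in> N i"
  by (induction w) (auto simp: N_X X_closed rn_gcomm_closed intro: gcomm_N)

lemma gcomm_eq_one: "g \<in> carrier Q \<Longrightarrow> h \<in> carrier Q \<Longrightarrow> g \<otimes> h = h \<otimes> g \<Longrightarrow> gcomm Q g h = \<one>"
  by (simp add: gcomm_def m_assoc)

text \<open>If i recurs, both \<open>xg i\<close> and the inner commutator lie in the abelian group
  \<open>N i\<close>.\<close>

lemma rn_gcomm_eq_one:
  assumes m: "m < n"
  shows "set w \<subseteq> {..<n} \<Longrightarrow> \<not> distinct (w @ [m]) \<Longrightarrow> rn_gcomm m w = \<one>"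
proof (induction w)
  case (Cons i w)
  show ?case
  proof (cases "i = m \<or> i \<in> set w")
    case True
    have i: "i < n" using Cons.prems by simp
    have c: "rn_gcomm m w \<in> N i" using rn_gcomm_N[OF m] Cons.prems True by simp
    show ?thesis
      using gcomm_eq_one N_commute[OF i N_X[OF i] c] X_closed[OF i] N_closed[OF i c] by simp
  next
    case False
    then have "rn_gcomm m w = \<one>" using Cons by auto
    then show ?thesis using Cons.prems by (simp add: gcomm_eq_one X_closed)
  qed
qed simp

text \<open>Exact, not merely to leading order. With y the letter and z the inner bracket, the
  products yy, zz, yzy and zyz vanish, and \<open>(1 + y)(1 + z)(1 - y)(1 - z)\<close> collapses to
  \<open>1 + yz - zy\<close>.\<close>

lemma mu_rn_gcomm: "m < n \<Longrightarrow> set w \<subseteq> {..<n} \<Longrightarrow> \<mu> (rn_gcomm m w) = 1 + rn_br (w @ [m])"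
proof (induction w)
  case Nil
  then show ?case by (simp add: mu_X)
next
  case (Cons i w)
  let ?z = "rn_br (w @ [m])" and ?y = "mgen i" and ?c = "rn_gcomm m w"
  have c: "?c \<in> carrier Q" and i: "i < n" using Cons.prems by (auto intro: rn_gcomm_closed)
  have muc: "\<mu> ?c = 1 + ?z" using Cons by simp
  have z: "?z \<in> cont m" by (rule rn_br_cont) simp
  have sq: "?z * ?z = 0" "?z * (?y * ?z) = 0"
    using z by (auto intro: cont_mult_eq_0 cont_mult_left)
  have yy: "?y * ?y = 0" "?y * (?z * ?y) = 0"
    by (auto intro!: cont_mult_eq_0[of _ i] cont_mult_left simp: mgen_sq)
  have ass: "?z * (?z * a) = 0" "?z * (?y * (?z * a)) = 0" "?y * (?y * a) = 0" "?y * (?z * (?y * a)) = 0" for a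
    by (metis sq yy mult.assoc mult_zero_left)+
  have "\<mu> (inv ?c) = 1 - ?z"
    by (rule mu_inv_eqI[OF c]) (simp add: muc algebra_simps sq)
  then have "\<mu> (rn_gcomm m (i # w)) = (1 + ?y) * (1 + ?z) * (1 - ?y) * (1 - ?z)"
    using c i by (simp add: gcomm_def mu_mult X_closed mu_X mu_inv_X muc)
  also have "\<dots> = 1 + comm ?y ?z"
    by (simp add: comm_def algebra_simps sq yy ass)
  finally show ?case by (simp add: rn_br_Cons)
qed

lemma mu_int_pow:
  assumes "c \<in> carrier Q" "\<mu> c = 1 + z" "z * z = 0"
  shows "\<mu> (c [^] (k::int)) = 1 + of_int k * z"
proof (induction k rule: int_induct[where k = 0])
  case base
  then show ?case by (simp add: mu_one)
next
  case (step1 i)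
  have "of_int i * z * z = 0" using assms(3) by (simp add: mult.assoc)
  moreover have "c [^] (i + 1) = c [^] i \<otimes> c" using assms by (simp add: int_pow_mult)
  ultimately show ?case using step1 assms by (simp add: mu_mult algebra_simps)
next
  case (step2 i)
  have "of_int i * z * z = 0" using assms(3) by (simp add: mult.assoc)
  moreover have "c [^] (i - 1) = c [^] i \<otimes> inv c"
    using assms int_pow_mult[of c i "-1"] int_pow_neg[of c 1] by simp
  moreover have "\<mu> (inv c) = 1 - z"
    by (rule mu_inv_eqI) (use assms in \<open>simp_all add: algebra_simps\<close>)
  ultimately show ?case using step2 assms by (simp only: mu_mult int_pow_closed inv_closed) (simp add: algebra_simps)
qed

text \<open>The polynomial a on the first m letters acting on \<open>x_m\<close>, written
  multiplicatively: the group counterpart of \<open>T m m a\<close>. The carrier is cut down to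
  \<open>N m\<close> because \<open>finprod\<close> lives in commutative groups.\<close>

definition Psi :: "nat \<Rightarrow> rmag \<Rightarrow> 'a" where
  "Psi m a = finprod (Q\<lparr>carrier := N m\<rparr>) (\<lambda>w. rn_gcomm m w [^] coef a w) (dwords m)"

lemma rn_gcomm_pow_N: "m < n \<Longrightarrow> set w \<subseteq> {..<n} \<Longrightarrow> i = m \<or> i \<in> set w \<Longrightarrow> rn_gcomm m w [^] (k::int) \<in> N i"
  using rn_gcomm_N N_subgroup[of i] subgroup_int_pow_closed[of "N i" "rn_gcomm m w" k] by (metis subsetD lessThan_iff)

lemma dwords_sub: "m \<le> n \<Longrightarrow> w \<in> dwords m \<Longrightarrow> set w \<subseteq> {..<n}"
  by (auto simp: dwords_def)

lemma Psi_N: "m < n \<Longrightarrow> Psi m a \<in> N m"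
proof -
  assume m: "m < n"
  interpret A: comm_group "Q\<lparr>carrier := N m\<rparr>" by (rule N_comm_group[OF m])
  have "Psi m a \<in> carrier (Q\<lparr>carrier := N m\<rparr>)"
    unfolding Psi_def by (rule A.finprod_closed) (use m in \<open>auto intro!: rn_gcomm_pow_N dest: dwords_sub[rotated]\<close>)
  then show ?thesis by simp
qed

lemma Psi_closed: "m < n \<Longrightarrow> Psi m a \<in> carrier Q"
  using Psi_N N_closed by blast

lemma Psi_add: "m < n \<Longrightarrow> Psi m (a + b) = Psi m a \<otimes> Psi m b"
proof -
  assume m: "m < n"
  interpret A: comm_group "Q\<lparr>carrier := N m\<rparr>" by (rule N_comm_group[OF m])
  have cl: "(\<lambda>w. rn_gcomm m w [^] coef a w) \<in> dwords m \<rightarrow> carrier (Q\<lparr>carrier := N m\<rparr>)" for a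
    using m by (auto intro!: rn_gcomm_pow_N dest: dwords_sub[rotated])
  have "Psi m a \<otimes> Psi m b
      = finprod (Q\<lparr>carrier := N m\<rparr>) (\<lambda>w. rn_gcomm m w [^] coef a w \<otimes> rn_gcomm m w [^] coef b w) (dwords m)"
    using A.finprod_multf[OF cl cl] unfolding Psi_def by simp
  also have "\<dots> = Psi m (a + b)"
    unfolding Psi_def
  proof (rule A.finprod_cong')
    fix w assume w: "w \<in> dwords m"
    then have "rn_gcomm m w \<in> carrier Q" using m by (intro rn_gcomm_closed) (auto simp: dwords_def)
    then show "rn_gcomm m w [^] coef a w \<otimes> rn_gcomm m w [^] coef b w = rn_gcomm m w [^] coef (a + b) w"
      by (simp add: int_pow_mult)
  next
    show "(\<lambda>w. rn_gcomm m w [^] coef (a + b) w) \<in> dwords m \<rightarrow> carrier (Q\<lparr>carrier := N m\<rparr>)"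
      by (rule cl)
  qed simp
  finally show ?thesis by simp
qed

lemma Psi_0: "m < n \<Longrightarrow> Psi m 0 = \<one>"
  using Psi_add[of m 0 0] Psi_closed[of m 0] by (metis add_0 l_one r_cancel one_closed)

lemma Psi_minus: "m < n \<Longrightarrow> Psi m (- a) = inv (Psi m a)"
  using Psi_add[of m a "- a"] Psi_0 Psi_closed
  by (metis add.right_inverse inv_equality inv_inv l_inv r_cancel inv_closed inv_unique')

lemma Psi_1: "m < n \<Longrightarrow> Psi m 1 = xg m"
proof -
  assume m: "m < n"
  interpret A: comm_group "Q\<lparr>carrier := N m\<rparr>" by (rule N_comm_group[OF m])
  have "Psi m 1 = finprod (Q\<lparr>carrier := N m\<rparr>) (\<lambda>w. rn_gcomm m w [^] coef 1 w) {[]}"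
    unfolding Psi_def
    by (rule A.finprod_mono_neutral_cong_right)
      (use m in \<open>auto simp: coef_1 dwords_def finite_subset_distinct intro!: rn_gcomm_pow_N\<close>)
  also have "\<dots> = xg m"
    using m N_X[OF m] X_closed[OF m] by (simp add: coef_1)
  finally show ?thesis .
qed

text \<open>Each factor is 1 plus a term containing \<open>y_m\<close>; such terms annihilate each
  other, so the product turns into a sum.\<close>

lemma mu_Psi: "m < n \<Longrightarrow> \<mu> (Psi m a) = 1 + T m m a"
proof -
  assume m: "m < n"
  interpret A: comm_group "Q\<lparr>carrier := N m\<rparr>" by (rule N_comm_group[OF m])
  let ?f = "\<lambda>w. rn_gcomm m w [^] coef a w" and ?g = "\<lambda>w. of_int (coef a w) * rn_br (w @ [m])"
  have gc: "?g w \<in> cont m" for w by (intro cont_of_int_mult rn_br_cont) simp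
  have "finite S \<Longrightarrow> S \<subseteq> dwords m \<Longrightarrow> \<mu> (finprod (Q\<lparr>carrier := N m\<rparr>) ?f S) = 1 + sum ?g S" for S
  proof (induction S rule: finite_induct)
    case empty
    then show ?case by (simp add: mu_one)
  next
    case (insert w S)
    then have w: "set w \<subseteq> {..<n}" using m by (auto simp: dwords_def)
    have "?f u \<in> N m" if "u \<in> dwords m" for u
      using m that dwords_sub[of m u] by (intro rn_gcomm_pow_N) auto
    then have cl: "?f \<in> S \<rightarrow> carrier (Q\<lparr>carrier := N m\<rparr>)" "?f w \<in> carrier (Q\<lparr>carrier := N m\<rparr>)"
      using insert.prems by auto
    have P: "finprod (Q\<lparr>carrier := N m\<rparr>) ?f S \<in> carrier Q"
      using A.finprod_closed[OF cl(1)] N_closed[OF m] by simp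
    have "rn_br (w @ [m]) * rn_br (w @ [m]) = 0"
      by (rule cont_mult_eq_0[of _ m]) (auto intro: rn_br_cont)
    then have mw: "\<mu> (?f w) = 1 + ?g w"
      using m w by (intro mu_int_pow) (auto simp: rn_gcomm_closed mu_rn_gcomm)
    have "\<mu> (finprod (Q\<lparr>carrier := N m\<rparr>) ?f (insert w S)) = (1 + ?g w) * (1 + sum ?g S)"
      using insert cl P m w by (simp add: mu_mult rn_gcomm_closed mw)
    also have "\<dots> = 1 + ?g w + sum ?g S"
      using cont_mult_eq_0[OF gc cont_sum[of S ?g], of w] gc by (simp add: algebra_simps)
    finally show ?case using insert by (simp add: add_ac)
  qed
  from this[of "dwords m"] show ?thesis
    by (simp add: Psi_def T_def lin_def)
qed

lemma conj_mult:
  "g \<in> carrier Q \<Longrightarrow> a \<in> carrier Q \<Longrightarrow> b \<in> carrier Q \<Longrightarrow>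
    g \<otimes> (a \<otimes> b) \<otimes> inv g = (g \<otimes> a \<otimes> inv g) \<otimes> (g \<otimes> b \<otimes> inv g)"
  by (simp add: m_assoc) (metis inv_closed l_inv l_one m_assoc m_closed)

lemma conj_int_pow:
  assumes "g \<in> carrier Q" "a \<in> carrier Q"
  shows "g \<otimes> a [^] (k::int) \<otimes> inv g = (g \<otimes> a \<otimes> inv g) [^] k"
proof -
  have "(\<lambda>a. g \<otimes> a \<otimes> inv g) \<in> hom Q Q"
    using assms(1) by (auto simp: hom_def conj_mult)
  then show ?thesis
    using hom_int_pow[of "\<lambda>a. g \<otimes> a \<otimes> inv g" Q Q a k] assms is_group by simp
qed

text \<open>Reindexing by w to i # w. Words that already contain i give trivial commutators, and
  words not starting with i have coefficient zero on the right.\<close>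

lemma Psi_mgen_mult:
  assumes i: "i < m" and m: "m < n"
  shows "finprod (Q\<lparr>carrier := N m\<rparr>) (\<lambda>w. rn_gcomm m (i # w) [^] coef a w) (dwords m) = Psi m (mgen i * a)"
proof -
  interpret A: comm_group "Q\<lparr>carrier := N m\<rparr>" by (rule N_comm_group[OF m])
  let ?A = "{w \<in> dwords m. i \<notin> set w}"
  let ?h = "\<lambda>w. rn_gcomm m (i # w) [^] coef a w" and ?g = "\<lambda>w. rn_gcomm m w [^] coef (mgen i * a) w"
  have hc: "?h w \<in> N m" if "w \<in> dwords m" for w
    using that i m by (intro rn_gcomm_pow_N) (auto simp: dwords_def)
  have gc: "?g w \<in> N m" if "w \<in> dwords m" for w
    using that i m by (intro rn_gcomm_pow_N) (auto simp: dwords_def)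
  have im: "Cons i ` ?A \<subseteq> dwords m" using i by (auto simp: dwords_def)
  have "finprod (Q\<lparr>carrier := N m\<rparr>) ?h (dwords m) = finprod (Q\<lparr>carrier := N m\<rparr>) ?h ?A"
  proof (rule A.finprod_mono_neutral_cong_right)
    fix w assume w: "w \<in> dwords m - ?A"
    then have "rn_gcomm m (i # w) = \<one>" using i m by (intro rn_gcomm_eq_one) (auto simp: dwords_def)
    then show "?h w = \<one>\<^bsub>Q\<lparr>carrier := N m\<rparr>\<^esub>" by (simp only:) simp
  qed (use hc in auto)
  also have "\<dots> = finprod (Q\<lparr>carrier := N m\<rparr>) (\<lambda>w. ?g (i # w)) ?A"
  proof (rule A.finprod_cong')
    show "?h w = ?g (i # w)" if "w \<in> ?A" for w
      using that by (auto simp: coef_mgen_mult dwords_def)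
    show "(\<lambda>w. ?g (i # w)) \<in> ?A \<rightarrow> carrier (Q\<lparr>carrier := N m\<rparr>)"
    proof
      fix w assume "w \<in> ?A"
      then have "i # w \<in> dwords m" using im by blast
      from gc[OF this] show "?g (i # w) \<in> carrier (Q\<lparr>carrier := N m\<rparr>)"
        by (simp del: rn_gcomm.simps)
    qed
  qed simp
  also have "\<dots> = finprod (Q\<lparr>carrier := N m\<rparr>) ?g (Cons i ` ?A)"
    by (rule A.finprod_reindex[symmetric]) (use gc im in \<open>auto simp: inj_on_def\<close>)
  also have "\<dots> = finprod (Q\<lparr>carrier := N m\<rparr>) ?g (dwords m)"
  proof (rule A.finprod_mono_neutral_cong_left)
    fix w assume w: "w \<in> dwords m - Cons i ` ?A"
    have "coef (mgen i * a) w = 0"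
    proof (cases w)
      case Nil
      then show ?thesis by (simp add: coef_mgen_mult_Nil)
    next
      case (Cons j u)
      then show ?thesis using w by (auto simp: coef_mgen_mult dwords_def)
    qed
    then show "?g w = \<one>\<^bsub>Q\<lparr>carrier := N m\<rparr>\<^esub>" by simp
  qed (use gc im in auto)
  finally show ?thesis by (simp add: Psi_def)
qed

text \<open>\<^term>\<open>Psi m\<close> turns the closure of \<open>x\<^sub>m\<close> into a module over the Magnus ring
  on which \<open>x\<^sub>i\<close> acts as multiplication by \<open>1 + y\<^sub>i\<close>; this is what makes \<^term>\<open>\<mu>\<close> injective.\<close>

lemma conj_X_Psi:
  assumes i: "i < m" and m: "m < n"
  shows "xg i \<otimes> Psi m a \<otimes> inv (xg i) = Psi m ((1 + mgen i) * a)"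
proof -
  interpret A: comm_group "Q\<lparr>carrier := N m\<rparr>" by (rule N_comm_group[OF m])
  let ?f = "\<lambda>w. rn_gcomm m w [^] coef a w" and ?h = "\<lambda>w. rn_gcomm m (i # w) [^] coef a w"
  have x: "xg i \<in> carrier Q" using i m X_closed by simp
  have cl: "?f w \<in> N m" "?h w \<in> N m" if "w \<in> dwords m" for w
    using that i m dwords_sub[of m w] by (auto simp del: rn_gcomm.simps intro!: rn_gcomm_pow_N)
  have "finite S \<Longrightarrow> S \<subseteq> dwords m \<Longrightarrow> xg i \<otimes> finprod (Q\<lparr>carrier := N m\<rparr>) ?f S \<otimes> inv (xg i)
      = finprod (Q\<lparr>carrier := N m\<rparr>) (\<lambda>w. xg i \<otimes> ?f w \<otimes> inv (xg i)) S" for S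
  proof (induction S rule: finite_induct)
    case empty
    then show ?case using x by simp
  next
    case (insert w S)
    have P: "finprod (Q\<lparr>carrier := N m\<rparr>) ?f S \<in> N m"
      using A.finprod_closed[of ?f S] insert.prems cl by auto
    have f: "?f \<in> S \<rightarrow> carrier (Q\<lparr>carrier := N m\<rparr>)" "?f w \<in> carrier (Q\<lparr>carrier := N m\<rparr>)"
      "(\<lambda>w. xg i \<otimes> ?f w \<otimes> inv (xg i)) \<in> S \<rightarrow> carrier (Q\<lparr>carrier := N m\<rparr>)"
      "xg i \<otimes> ?f w \<otimes> inv (xg i) \<in> carrier (Q\<lparr>carrier := N m\<rparr>)"
      using insert.prems cl N_conj[OF m x] by auto
    show ?case
      using insert P f x N_closed[OF m P] N_closed[OF m, of "?f w"] by (simp add: conj_mult)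
  qed
  from this[of "dwords m"]
  have "xg i \<otimes> Psi m a \<otimes> inv (xg i)
      = finprod (Q\<lparr>carrier := N m\<rparr>) (\<lambda>w. xg i \<otimes> ?f w \<otimes> inv (xg i)) (dwords m)"
    by (simp add: Psi_def)
  also have "\<dots> = finprod (Q\<lparr>carrier := N m\<rparr>) (\<lambda>w. ?h w \<otimes> ?f w) (dwords m)"
  proof (rule A.finprod_cong')
    fix w assume w: "w \<in> dwords m"
    then have ws: "set w \<subseteq> {..<n}" "set (i # w) \<subseteq> {..<n}" using i m by (auto simp: dwords_def)
    have c: "rn_gcomm m w \<in> carrier Q" "rn_gcomm m (i # w) \<in> carrier Q"
      by (rule rn_gcomm_closed[OF m ws(1)], rule rn_gcomm_closed[OF m ws(2)])
    \<comment> \<open>The conjugate of c by x is the commutator of x and c times c; the two factors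
      become the summands of \<open>1 + mgen i\<close>.\<close>
    have e: "xg i \<otimes> rn_gcomm m w \<otimes> inv (xg i) = rn_gcomm m (i # w) \<otimes> rn_gcomm m w"
      using c x by (simp add: gcomm_def m_assoc)
    have "rn_gcomm m (i # w) \<otimes> rn_gcomm m w = rn_gcomm m w \<otimes> rn_gcomm m (i # w)"
      by (rule N_commute[OF m]) (rule rn_gcomm_N[OF m], use ws in auto)+
    then have "(rn_gcomm m (i # w) \<otimes> rn_gcomm m w) [^] k = rn_gcomm m (i # w) [^] k \<otimes> rn_gcomm m w [^] k" for k :: int
      using c by (intro int_pow_mult_distrib) auto
    then show "xg i \<otimes> ?f w \<otimes> inv (xg i) = ?h w \<otimes> ?f w"
      using conj_int_pow[OF x c(1)] e by simp
  qed (use cl subgroup.m_closed[OF N_subgroup[OF m]] in auto)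
  also have "\<dots> = Psi m (mgen i * a) \<otimes> Psi m a"
    using A.finprod_multf[of ?h "dwords m" ?f] cl Psi_mgen_mult[OF i m, of a]
    by (auto simp: Psi_def)
  also have "\<dots> = Psi m ((1 + mgen i) * a)"
    using m by (simp add: Psi_add[symmetric] algebra_simps)
  finally show ?thesis .
qed

abbreviation Qs :: "nat \<Rightarrow> 'a set" where
  "Qs m \<equiv> generate Q (xg ` {..<m})"

lemma Xs_closed: "m \<le> n \<Longrightarrow> xg ` {..<m} \<subseteq> carrier Q"
  using X_closed by auto

lemma Qs_closed: "m \<le> n \<Longrightarrow> h \<in> Qs m \<Longrightarrow> h \<in> carrier Q"
  using generate_in_carrier[OF Xs_closed] .

lemma conj_Psi:
  assumes m: "m < n" and h: "h \<in> Qs m"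
  shows "h \<otimes> Psi m a \<otimes> inv h = Psi m (\<mu> h * a)"
  using h
proof (induction arbitrary: a rule: generate.induct)
  case one
  then show ?case using Psi_closed[OF m] by (simp add: mu_one)
next
  case (incl h)
  then show ?case using conj_X_Psi m mu_X by auto
next
  case (inv h)
  then obtain i where i: "h = xg i" "i < m" by auto
  let ?b = "(1 - mgen i) * a"
  have x: "xg i \<in> carrier Q" using i m X_closed by simp
  \<comment> \<open>As \<open>1 - y_i\<close> inverts \<open>1 + y_i\<close>, the inverse generator
    acts by the known action read backwards.\<close>
  have "(1 + mgen i) * ?b = a"
    by (simp add: algebra_simps) (simp add: mgen_sq mult.assoc[symmetric])
  then have "Psi m a = xg i \<otimes> Psi m ?b \<otimes> inv (xg i)"
    using conj_X_Psi[OF i(2) m, of ?b] by simp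
  then have "inv (xg i) \<otimes> Psi m a \<otimes> xg i = Psi m ?b"
    using x Psi_closed[OF m, of ?b] by (simp add: m_assoc) (metis inv_closed l_inv l_one m_assoc)
  then show ?case using i m x by (simp add: mu_inv_X)
next
  case (eng h1 h2)
  then have c: "h1 \<in> carrier Q" "h2 \<in> carrier Q" using m Qs_closed[of m] by auto
  have "(h1 \<otimes> h2) \<otimes> Psi m a \<otimes> inv (h1 \<otimes> h2) = h1 \<otimes> (h2 \<otimes> Psi m a \<otimes> inv h2) \<otimes> inv h1"
    using c Psi_closed[OF m, of a] by (simp add: m_assoc inv_mult_group)
  then show ?case using eng.IH c by (simp add: mu_mult mult.assoc)
qed

lemma mu_rsub:
  assumes "S \<subseteq> {..<n}" "h \<in> generate Q (xg ` S)"
  shows "\<mu> h \<in> rsub S"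
  using assms(2)
proof (induction rule: generate.induct)
  case (eng h1 h2)
  have "xg ` S \<subseteq> carrier Q" using assms(1) X_closed by auto
  then show ?case
    using eng by (simp add: mu_mult generate_in_carrier rsub_mult)
qed (use assms(1) in \<open>auto simp: mu_one mu_X mu_inv_X subset_iff intro!: rsub_add rsub_diff\<close>)

lemma Qs_subgroup: "m \<le> n \<Longrightarrow> subgroup (Qs m) Q"
  by (rule generate_is_subgroup[OF Xs_closed])

text \<open>Such products contain the generators and their inverses and are closed under
  multiplication: moving \<open>Psi m a1\<close> past h2 only multiplies a1 by
  \<open>\<mu> (inv h2)\<close>.\<close>

lemma Qs_Suc_decomp:
  assumes m: "m < n" and g: "g \<in> Qs (Suc m)"
  obtains h a where "h \<in> Qs m" "a \<in> rsub {..<m}" "g = h \<otimes> Psi m a"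
proof -
  have sub: "subgroup (Qs m) Q" using m by (intro Qs_subgroup) simp
  have one: "\<one> \<in> Qs m" by (rule generate.one)
  have "\<exists>h a. h \<in> Qs m \<and> a \<in> rsub {..<m} \<and> g = h \<otimes> Psi m a"
    using g
  proof (induction rule: generate.induct)
    case one
    show ?case
      by (rule exI[of _ \<one>], rule exI[of _ 0]) (use generate.one m in \<open>auto simp: Psi_0\<close>)
  next
    case (incl h)
    then obtain i where i: "h = xg i" "i < Suc m" by auto
    show ?case
    proof (cases "i = m")
      case True
      show ?thesis
        by (rule exI[of _ \<one>], rule exI[of _ 1]) (use generate.one m True i X_closed in \<open>auto simp: Psi_1\<close>)
    next
      case False
      show ?thesis
        by (rule exI[of _ "xg i"], rule exI[of _ 0])
          (use m False i X_closed in \<open>auto simp: Psi_0 intro: generate.incl\<close>)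
    qed
  next
    case (inv h)
    then obtain i where i: "h = xg i" "i < Suc m" by auto
    show ?case
    proof (cases "i = m")
      case True
      show ?thesis
        by (rule exI[of _ \<one>], rule exI[of _ "- 1"])
          (use generate.one m True i X_closed in \<open>auto simp: Psi_1 Psi_minus intro: rsub_minus\<close>)
    next
      case False
      show ?thesis
        by (rule exI[of _ "inv (xg i)"], rule exI[of _ 0])
          (use m False i X_closed in \<open>auto simp: Psi_0 intro: generate.inv\<close>)
    qed
  next
    case (eng g1 g2)
    then obtain h1 a1 h2 a2 where h: "h1 \<in> Qs m" "a1 \<in> rsub {..<m}" "g1 = h1 \<otimes> Psi m a1"
      "h2 \<in> Qs m" "a2 \<in> rsub {..<m}" "g2 = h2 \<otimes> Psi m a2" by blast
    have c: "h1 \<in> carrier Q" "h2 \<in> carrier Q" using h m Qs_closed[of m] by auto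
    have ih: "inv h2 \<in> Qs m" using subgroup.m_inv_closed[OF sub] h by simp
    have r: "\<mu> (inv h2) \<in> rsub {..<m}" by (rule mu_rsub) (use m ih in auto)
    have "g1 \<otimes> g2 = (h1 \<otimes> h2) \<otimes> (inv h2 \<otimes> Psi m a1 \<otimes> inv (inv h2)) \<otimes> Psi m a2"
    proof -
      have "h2 \<otimes> (inv h2 \<otimes> z) = z" if "z \<in> carrier Q" for z
        using that c by (metis inv_closed m_assoc r_inv l_one)
      then show ?thesis
        using c h Psi_closed[OF m] by (simp add: m_assoc)
    qed
    also have "\<dots> = (h1 \<otimes> h2) \<otimes> Psi m (\<mu> (inv h2) * a1 + a2)"
      using conj_Psi[OF m ih] c Psi_closed[OF m] by (simp add: Psi_add[OF m] m_assoc)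
    finally show ?case
      using subgroup.m_closed[OF sub h(1,4)] h r by (metis rsub_add rsub_mult)
  qed
  then show ?thesis using that by blast
qed

lemma Qs_induct_step:
  assumes m: "m < n" and g: "g \<in> Qs (Suc m)"
  obtains h a where "h \<in> Qs m" "a \<in> rsub {..<m}" "g = h \<otimes> Psi m a"
    "\<mu> g = \<mu> h * (1 + T m m a)" "kill m (\<mu> g) = \<mu> h" "\<mu> h \<in> rsub {..<m}"
proof -
  obtain h a where ha: "h \<in> Qs m" "a \<in> rsub {..<m}" "g = h \<otimes> Psi m a"
    using Qs_Suc_decomp[OF m g] .
  have r: "\<mu> h \<in> rsub {..<m}" by (rule mu_rsub) (use m ha in auto)
  have mg: "\<mu> g = \<mu> h * (1 + T m m a)"
    using ha m Qs_closed[of m h] by (simp add: mu_mult Psi_closed mu_Psi)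
  have "kill m (\<mu> g) = \<mu> h"
    unfolding mg by (simp add: kill_cont[OF T_cont] kill_rsub[OF r])
  then show ?thesis using ha r mg that by blast
qed

text \<open>In the factorisation of g, \<open>kill m\<close> detects h, and \<open>tail m\<close>
  detects the coefficient a; both are trivial once \<open>\<mu> g = 1\<close>.\<close>

lemma mu_inj_Qs: "m \<le> n \<Longrightarrow> g \<in> Qs m \<Longrightarrow> \<mu> g = 1 \<Longrightarrow> g = \<one>"
proof (induction m arbitrary: g)
  case 0
  then show ?case by (simp add: generate_empty)
next
  case (Suc m)
  then have m: "m < n" by simp
  obtain h a where h: "h \<in> Qs m" "a \<in> rsub {..<m}" "g = h \<otimes> Psi m a"
    "\<mu> g = \<mu> h * (1 + T m m a)" "kill m (\<mu> g) = \<mu> h"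
    using Qs_induct_step[OF m Suc.prems(2)] by metis
  have mh: "\<mu> h = 1" using h(5) Suc.prems(3) by simp
  then have "h = \<one>" using Suc.IH h(1) m by simp
  have "T m m a = 0" using h(4) mh Suc.prems(3) by simp
  then have "kill m a = 0" using tail_T[OF h(2), of m] by simp
  then have "a = 0" using kill_rsub[OF h(2), of m] by simp
  then show ?case using h(3) \<open>h = \<one>\<close> m by (simp add: Psi_0)
qed

lemma mu_inj:
  assumes "g \<in> carrier Q" "h \<in> carrier Q" "\<mu> g = \<mu> h"
  shows "g = h"
proof -
  have "\<mu> (g \<otimes> inv h) = 1" using assms by (simp add: mu_mult mu_inv)
  then have "g \<otimes> inv h = \<one>" using mu_inj_Qs[of n "g \<otimes> inv h"] assms gen by simp
  then show ?thesis using assms by (metis inv_equality inv_inv inv_closed)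
qed

text \<open>Up to the product of \<open>\<mu> h - 1\<close> and the T-term, of order at least 2d,
  the element \<open>\<mu> g\<close> is the sum of \<open>\<mu> h\<close> and that term. So leading
  parts add: one is Lie by induction, the other because a homogeneous piece of a T-term is again a
  T-term.\<close>

lemma lead_Lie_Qs:
  "m \<le> n \<Longrightarrow> g \<in> Qs m \<Longrightarrow> 1 \<le> d \<Longrightarrow> \<mu> g - 1 \<in> ordge d \<Longrightarrow> part d (\<mu> g) \<in> Lie m"
proof (induction m arbitrary: g)
  case 0
  then have "g = \<one>" by (simp add: generate_empty)
  then have "part d (\<mu> g) = 0" using 0 by (intro rmag_eqI) (auto simp: coef_part mu_one coef_1)
  then show ?case by (simp add: Lie.zero)
next
  case (Suc m)
  then have m: "m < n" by simp
  obtain h a where h: "h \<in> Qs m" "a \<in> rsub {..<m}" "g = h \<otimes> Psi m a"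
    "\<mu> g = \<mu> h * (1 + T m m a)" "kill m (\<mu> g) = \<mu> h"
    using Qs_induct_step[OF m Suc.prems(2)] by metis
  let ?t = "T m m a"
  have hd: "\<mu> h - 1 \<in> ordge d"
    using kill_ordge[OF Suc.prems(4), of m] h(5) by simp
  have ht: "\<mu> h * ?t \<in> ordge d"
    using ordge_diff[OF Suc.prems(4) hd] h(4) by (simp add: algebra_simps)
  have hQ: "h \<in> carrier Q" using h(1) m Qs_closed[of m h] by simp
  \<comment> \<open>Multiplication by a unit does not lower the order, so the bound passes to
    \<open>?t\<close> itself.\<close>
  have "\<mu> (inv h) * (\<mu> h * ?t) \<in> ordge (0 + d)"
    by (rule ordge_mult[OF ordge_zero ht])
  then have td: "?t \<in> ordge d" using mu_inv(2)[OF hQ] by (simp add: mult.assoc[symmetric])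
  have "(\<mu> h - 1) * ?t \<in> ordge (Suc d)"
    by (rule ordge_mono[OF ordge_mult[OF hd td]]) (use Suc.prems in simp)
  then have "part d ((\<mu> h - 1) * ?t) = 0" by (rule part_ordge_0) simp
  moreover have "\<mu> g = \<mu> h + ?t + (\<mu> h - 1) * ?t" using h(4) by (simp add: algebra_simps)
  ultimately have pg: "part d (\<mu> g) = part d (\<mu> h) + part d ?t" by simp
  obtain e where d: "d = Suc e" using Suc.prems(3) by (cases d) auto
  have "part d ?t = T (Suc m) m (part e a)"
    unfolding d part_T by (rule T_mono[symmetric]) (auto intro: part_rsub h)
  then have "part d ?t \<in> Lie (Suc m)" by (simp add: T_Lie)
  moreover have "part d (\<mu> h) \<in> Lie (Suc m)"
    using Suc.IH[OF _ h(1) Suc.prems(3) hd] m by (auto intro: Lie_mono)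
  ultimately show ?case unfolding pg by (rule Lie.add[rotated])
qed

lemma lead_Lie: "g \<in> carrier Q \<Longrightarrow> 1 \<le> d \<Longrightarrow> \<mu> g - 1 \<in> ordge d \<Longrightarrow> part d (\<mu> g) \<in> Lie n"
  using lead_Lie_Qs[of n g d] gen by simp

text \<open>Every g factors as h c with h free of \<open>x_j\<close> and c in the normal subgroup
  \<open>N j\<close>; being abelian, \<open>N j\<close> lets c drop out of the conjugate of
  \<open>x_j\<close>.\<close>

lemma conj_X_avoid:
  assumes j: "j < n" and g: "g \<in> carrier Q"
  obtains h where "h \<in> generate Q (xg ` ({..<n} - {j}))" "h \<in> carrier Q"
    "g \<otimes> xg j \<otimes> inv g = h \<otimes> xg j \<otimes> inv h"
proof -
  let ?H = "generate Q (xg ` ({..<n} - {j}))"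
  have sub: "subgroup ?H Q" by (rule generate_is_subgroup) (auto simp: X_closed)
  note HQ = subgroup.mem_carrier[OF sub]
  have "\<exists>h c. h \<in> ?H \<and> c \<in> N j \<and> g = h \<otimes> c"
    using g unfolding gen[symmetric]
  proof (induction rule: generate.induct)
    case one
    show ?case using generate.one[of Q "xg ` ({..<n} - {j})"] subgroup.one_closed[OF N_subgroup[OF j]]
      by (metis l_one one_closed)
  next
    case (incl h)
    then obtain i where i: "h = xg i" "i < n" by auto
    show ?case
    proof (cases "i = j")
      case True
      then show ?thesis using i N_X[OF j] generate.one[of Q "xg ` ({..<n} - {j})"] X_closed[OF j]
        by (metis l_one)
    next
      case False
      then have "xg i \<in> ?H" using i by (intro generate.incl) auto
      then show ?thesis using i subgroup.one_closed[OF N_subgroup[OF j]] X_closed by (metis r_one)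
    qed
  next
    case (inv h)
    then obtain i where i: "h = xg i" "i < n" by auto
    show ?case
    proof (cases "i = j")
      case True
      then show ?thesis
        using i subgroup.m_inv_closed[OF N_subgroup[OF j] N_X[OF j]]
          generate.one[of Q "xg ` ({..<n} - {j})"] X_closed[OF j]
        by (metis l_one inv_closed)
    next
      case False
      then have "inv (xg i) \<in> ?H" using i by (intro generate.inv) auto
      then show ?thesis using i subgroup.one_closed[OF N_subgroup[OF j]] X_closed
        by (metis r_one inv_closed)
    qed
  next
    case (eng g1 g2)
    then obtain h1 c1 h2 c2 where h: "h1 \<in> ?H" "c1 \<in> N j" "g1 = h1 \<otimes> c1"
      "h2 \<in> ?H" "c2 \<in> N j" "g2 = h2 \<otimes> c2" by blast
    have c: "h1 \<in> carrier Q" "h2 \<in> carrier Q" "c1 \<in> carrier Q" "c2 \<in> carrier Q"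
      using h HQ N_closed[OF j] by auto
    have "h2 \<otimes> (inv h2 \<otimes> z) = z" if "z \<in> carrier Q" for z
      using that c by (metis inv_closed m_assoc r_inv l_one)
    then have "g1 \<otimes> g2 = (h1 \<otimes> h2) \<otimes> ((inv h2 \<otimes> c1 \<otimes> h2) \<otimes> c2)"
      using c h by (simp add: m_assoc)
    moreover have "(inv h2 \<otimes> c1 \<otimes> h2) \<otimes> c2 \<in> N j"
      using subgroup.m_closed[OF N_subgroup[OF j] N_conj'[OF j c(2) h(2)] h(5)] .
    ultimately show ?case using subgroup.m_closed[OF sub h(1,4)] by blast
  qed
  then obtain h c where hc: "h \<in> ?H" "c \<in> N j" "g = h \<otimes> c" by blast
  have cl: "h \<in> carrier Q" "c \<in> carrier Q" "xg j \<in> carrier Q"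
    using hc HQ N_closed[OF j] X_closed[OF j] by auto
  have "c \<otimes> xg j \<otimes> inv c = xg j"
    using N_commute[OF j hc(2) N_X[OF j]] cl by (simp add: m_assoc)
  then have "g \<otimes> xg j \<otimes> inv g = h \<otimes> xg j \<otimes> inv h"
    using cl hc(3) by (simp add: inv_mult_group) (metis inv_closed m_assoc m_closed)
  then show ?thesis using that hc(1) cl(1) by blast
qed

end

section \<open>Realising the graded Lie ring of a nilpotent group inside the Magnus ring\<close>

section \<open>Lower central series and associated Lie rings\<close>

context group
begin

lemma gcomm_in_carrier: "x \<in> carrier G \<Longrightarrow> y \<in> carrier G \<Longrightarrow> gcomm G x y \<in> carrier G"
  by (simp add: gcomm_def)

lemma conj_gcomm:
  assumes "g \<in> carrier G" "x \<in> carrier G" "y \<in> carrier G"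
  shows "g \<otimes> gcomm G x y \<otimes> inv g = gcomm G (g \<otimes> x \<otimes> inv g) (g \<otimes> y \<otimes> inv g)"
proof -
  have "inv g \<otimes> (g \<otimes> z) = z" if "z \<in> carrier G" for z
    using that assms by (metis inv_closed m_assoc l_inv l_one)
  then show ?thesis
    using assms by (simp add: gcomm_def m_assoc inv_mult_group)
qed

lemma lcs_closed_normal: "lcs G k \<subseteq> carrier G \<and> lcs G k \<lhd> G"
proof (induction k)
  case 0
  have "carrier G \<lhd> G"
    by (auto simp: normal_inv_iff subgroup_self)
  then show ?case by simp
next
  case (Suc k)
  let ?S = "{gcomm G x y |x y. x \<in> carrier G \<and> y \<in> lcs G k}"
  have S: "?S \<subseteq> carrier G" using Suc by (auto intro: gcomm_in_carrier)
  have "generate G ?S \<lhd> G"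
  proof (rule normal_generateI[OF S])
    fix h g assume "h \<in> ?S" and g: "g \<in> carrier G"
    then obtain x y where h: "h = gcomm G x y" "x \<in> carrier G" "y \<in> lcs G k" by auto
    have "g \<otimes> y \<otimes> inv g \<in> lcs G k"
      using Suc g h normal.inv_op_closed2 by metis
    moreover have "g \<otimes> x \<otimes> inv g \<in> carrier G" using g h by simp
    moreover have "g \<otimes> h \<otimes> inv g = gcomm G (g \<otimes> x \<otimes> inv g) (g \<otimes> y \<otimes> inv g)"
      unfolding h(1) by (rule conj_gcomm) (use g h Suc in auto)
    ultimately show "g \<otimes> h \<otimes> inv g \<in> ?S" by blast
  qed
  then show ?case using generate_incl[OF S] by simp
qed

lemma lcs_normal: "lcs G k \<lhd> G"
  using lcs_closed_normal by blast

lemma lcs_closed: "x \<in> lcs G k \<Longrightarrow> x \<in> carrier G"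
  using lcs_closed_normal by blast

lemma lcs_subgroup: "subgroup (lcs G k) G"
  using lcs_normal normal_imp_subgroup by blast

lemma lcs_Suc: "lcs G (Suc k) \<subseteq> lcs G k"
  unfolding lcs.simps(2)
proof (rule generate_subgroup_incl[OF _ lcs_subgroup], clarify)
  fix x y assume x: "x \<in> carrier G" and y: "y \<in> lcs G k"
  have "x \<otimes> y \<otimes> inv x \<in> lcs G k"
    by (rule normal.inv_op_closed2[OF lcs_normal x y])
  then show "gcomm G x y \<in> lcs G k"
    unfolding gcomm_def
    by (rule subgroup.m_closed[OF lcs_subgroup _ subgroup.m_inv_closed[OF lcs_subgroup y]])
qed

lemma lcs_gcomm: "x \<in> carrier G \<Longrightarrow> y \<in> lcs G k \<Longrightarrow> gcomm G x y \<in> lcs G (Suc k)"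
  by (auto intro: generate.incl)

lemma lcs_quot_carrier:
  "carrier (lcs_quot G k) = {lcs G (Suc k) #> x | x. x \<in> lcs G k}"
  by (auto simp: lcs_quot_def FactGroup_def RCOSETS_def r_coset_def simp del: lcs.simps(2))

lemma lcs_quot_group: "group (lcs_quot G k)"
proof -
  have "group (G\<lparr>carrier := lcs G k\<rparr>)"
    using lcs_subgroup is_group by (rule subgroup.subgroup_is_group)
  moreover have "lcs G (Suc k) \<lhd> G\<lparr>carrier := lcs G k\<rparr>"
    by (rule normal_restrict_supergroup[OF lcs_subgroup lcs_normal lcs_Suc])
  ultimately show ?thesis
    unfolding lcs_quot_def by (metis normal.factorgroup_is_group)
qed

lemma lcs_quot_mult: "U \<otimes>\<^bsub>lcs_quot G k\<^esub> V = U <#> V"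
  by (simp add: lcs_quot_def FactGroup_def set_mult_def)

lemma lcs_quot_one: "\<one>\<^bsub>lcs_quot G k\<^esub> = lcs G (Suc k)"
  by (simp add: lcs_quot_def FactGroup_def)

end

text \<open>A realisation of L on a subset of an additive group with a bracket. Closure of the
  carrier is included because \<open>liering\<close> is a bare record of operations.\<close>

definition lie_rep ::
    "'a liering \<Rightarrow> ('a \<Rightarrow> 'v::ab_group_add) \<Rightarrow> ('v \<Rightarrow> 'v \<Rightarrow> 'v) \<Rightarrow> 'v set \<Rightarrow> bool" where
  "lie_rep L \<beta> br I \<longleftrightarrow> bij_betw \<beta> (lcarrier L) I \<and>
     (\<forall>x\<in>lcarrier L. lneg L x \<in> lcarrier L \<and> \<beta> (lneg L x) = - \<beta> x) \<and>
     (\<forall>x\<in>lcarrier L. \<forall>y\<in>lcarrier L.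
        ladd L x y \<in> lcarrier L \<and> \<beta> (ladd L x y) = \<beta> x + \<beta> y \<and>
        lbr L x y \<in> lcarrier L \<and> \<beta> (lbr L x y) = br (\<beta> x) (\<beta> y))"

text \<open>The maps \<open>q k\<close> identify the quotients of the lower central series with the
  homogeneous parts of D. Index k means degree k + 1 in the series, which is encoded by words of
  length k + 2. M bounds the nilpotency class.\<close>

locale lie_graded = group G for G (structure) +
  fixes q :: "nat \<Rightarrow> 'a \<Rightarrow> rmag" and br :: "rmag \<Rightarrow> rmag \<Rightarrow> rmag" and D :: "rmag set" and M :: nat
  assumes q_mult: "x \<in> lcs G k \<Longrightarrow> y \<in> lcs G k \<Longrightarrow> q k (x \<otimes> y) = q k x + q k y"
    and q_ker: "x \<in> lcs G k \<Longrightarrow> q k x = 0 \<longleftrightarrow> x \<in> lcs G (Suc k)"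
    and gcomm_lcs: "x \<in> lcs G i \<Longrightarrow> y \<in> lcs G j \<Longrightarrow> gcomm G x y \<in> lcs G (i + j + 1)"
    and q_gcomm: "x \<in> lcs G i \<Longrightarrow> y \<in> lcs G j \<Longrightarrow> q (i + j + 1) (gcomm G x y) = br (q i x) (q j y)"
    and q_part: "x \<in> lcs G k \<Longrightarrow> part l (q k x) = (if l = k + 2 then q k x else 0)"
    and lcs_M: "M \<le> k \<Longrightarrow> lcs G k = {\<one>}"
    and br_add: "br (a + b) c = br a c + br b c" "br a (b + c) = br a b + br a c"
    and D_add: "a \<in> D \<Longrightarrow> b \<in> D \<Longrightarrow> a + b \<in> D"
    and D_0: "0 \<in> D"
    and q_D: "x \<in> lcs G k \<Longrightarrow> q k x \<in> D"
    and D_q: "d \<in> D \<Longrightarrow> \<exists>x\<in>lcs G k. q k x = part (k + 2) d"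
    and D_sum: "d \<in> D \<Longrightarrow> d = (\<Sum>k<M. part (k + 2) d)"
begin

lemma q_one: "q k \<one> = 0"
  using q_mult[of \<one> k \<one>] subgroup.one_closed[OF lcs_subgroup] by simp

lemma q_inv: "x \<in> lcs G k \<Longrightarrow> q k (inv x) = - q k x"
  using q_mult[of "inv x" k x] q_one[of k] subgroup.m_inv_closed[OF lcs_subgroup, of x k] lcs_closed[of x k]
  by (simp add: eq_neg_iff_add_eq_0)

definition qbar :: "nat \<Rightarrow> 'a set \<Rightarrow> rmag" where
  "qbar k U = q k (lcs_rep U)"

text \<open>Representatives of a coset differ by an element of the next term of the series, on which
  \<open>q k\<close> vanishes. So the arbitrary choice in \<open>lcs_rep\<close> is
  harmless.\<close>

lemma coset_rep:
  assumes "x \<in> lcs G k"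
  shows "lcs_rep (lcs G (Suc k) #> x) \<in> lcs G k" "qbar k (lcs G (Suc k) #> x) = q k x"
proof -
  let ?U = "lcs G (Suc k) #> x"
  have "x \<in> ?U" using assms lcs_closed
    by (auto simp: r_coset_def intro!: bexI[of _ \<one>] subgroup.one_closed[OF lcs_subgroup, simplified] simp del: lcs.simps)
  then have "lcs_rep ?U \<in> ?U" unfolding lcs_rep_def by (rule someI)
  then obtain h where h: "h \<in> lcs G (Suc k)" "lcs_rep ?U = h \<otimes> x"
    by (auto simp: r_coset_def simp del: lcs.simps)
  then have hk: "h \<in> lcs G k" using lcs_Suc by blast
  show "lcs_rep ?U \<in> lcs G k"
    unfolding h(2) by (rule subgroup.m_closed[OF lcs_subgroup hk assms])
  show "qbar k ?U = q k x"
    unfolding qbar_def h(2) using q_mult[OF hk assms] q_ker[OF hk] h(1) by simp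
qed

lemma rep_lcs: "U \<in> carrier (lcs_quot G k) \<Longrightarrow> lcs_rep U \<in> lcs G k"
  unfolding lcs_quot_carrier using coset_rep(1) by blast

lemma coset_lcs_quot: "x \<in> lcs G k \<Longrightarrow> lcs G (Suc k) #> x \<in> carrier (lcs_quot G k)"
  unfolding lcs_quot_carrier by blast

lemma qbar_inj:
  assumes "U \<in> carrier (lcs_quot G k)" "V \<in> carrier (lcs_quot G k)" "qbar k U = qbar k V"
  shows "U = V"
proof -
  obtain x y where x: "x \<in> lcs G k" "U = lcs G (Suc k) #> x" and y: "y \<in> lcs G k" "V = lcs G (Suc k) #> y"
    using assms(1,2) unfolding lcs_quot_carrier by blast
  have iy: "inv y \<in> lcs G k" using subgroup.m_inv_closed[OF lcs_subgroup y(1)] .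
  have "q k (x \<otimes> inv y) = 0"
    using q_mult[OF x(1) iy] q_inv[OF y(1)] assms(3) coset_rep(2) x y by simp
  then have "x \<otimes> inv y \<in> lcs G (Suc k)"
    using q_ker[OF subgroup.m_closed[OF lcs_subgroup x(1) iy]] by blast
  moreover have "x = (x \<otimes> inv y) \<otimes> y"
    using x y lcs_closed by (simp add: m_assoc)
  ultimately have "x \<in> lcs G (Suc k) #> y" unfolding r_coset_def by blast
  then show ?thesis
    unfolding x(2) y(2) using repr_independence[OF _ lcs_closed[OF y(1)] lcs_subgroup] by blast
qed

lemma qbar_mult:
  assumes "U \<in> carrier (lcs_quot G k)" "V \<in> carrier (lcs_quot G k)"
  shows "qbar k (U <#> V) = qbar k U + qbar k V"
proof -
  obtain x y where x: "x \<in> lcs G k" "U = lcs G (Suc k) #> x" and y: "y \<in> lcs G k" "V = lcs G (Suc k) #> y"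
    using assms(1,2) unfolding lcs_quot_carrier by blast
  have "U <#> V = lcs G (Suc k) #> (x \<otimes> y)"
    unfolding x(2) y(2)
    by (rule normal.rcos_sum[OF lcs_normal lcs_closed[OF x(1)] lcs_closed[OF y(1)]])
  then show ?thesis
    using x y coset_rep(2) q_mult subgroup.m_closed[OF lcs_subgroup x(1) y(1)] by simp
qed

text \<open>Read off from the injection \<open>qbar k\<close> into an additive group; the finite
  products in the bracket of \<open>LieG\<close> require it.\<close>

lemma lcs_quot_comm_group: "comm_group (lcs_quot G k)"
proof (rule group.group_comm_groupI[OF lcs_quot_group])
  fix U V assume UV: "U \<in> carrier (lcs_quot G k)" "V \<in> carrier (lcs_quot G k)"
  interpret K: group "lcs_quot G k" by (rule lcs_quot_group)
  show "U \<otimes>\<^bsub>lcs_quot G k\<^esub> V = V \<otimes>\<^bsub>lcs_quot G k\<^esub> U"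
    using UV K.m_closed[OF UV] K.m_closed[OF UV(2,1)]
    by (intro qbar_inj[of _ k]) (simp_all add: lcs_quot_mult qbar_mult add.commute)
qed

lemma qbar_one: "qbar k (lcs G (Suc k)) = 0"
proof -
  have "lcs G (Suc k) = lcs G (Suc k) #> \<one>"
    using lcs_closed[of _ "Suc k"] by (subst coset_mult_one) blast+
  then show ?thesis using coset_rep(2)[OF subgroup.one_closed[OF lcs_subgroup]] q_one by metis
qed

lemma qbar_inv:
  assumes "U \<in> carrier (lcs_quot G k)"
  shows "qbar k (inv\<^bsub>lcs_quot G k\<^esub> U) = - qbar k U"
proof -
  interpret K: group "lcs_quot G k" by (rule lcs_quot_group)
  have "qbar k (inv\<^bsub>lcs_quot G k\<^esub> U <#> U) = 0"
    using K.l_inv[OF assms] by (simp add: lcs_quot_mult lcs_quot_one qbar_one del: lcs.simps)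
  then show ?thesis using qbar_mult[OF K.inv_closed[OF assms] assms] by (simp add: eq_neg_iff_add_eq_0)
qed

lemma qbar_finprod:
  assumes "finite A" "\<And>a. a \<in> A \<Longrightarrow> h a \<in> carrier (lcs_quot G k)"
  shows "finprod (lcs_quot G k) h A \<in> carrier (lcs_quot G k)"
    "qbar k (finprod (lcs_quot G k) h A) = (\<Sum>a\<in>A. qbar k (h a))"
proof -
  interpret K: comm_group "lcs_quot G k" by (rule lcs_quot_comm_group)
  have "finprod (lcs_quot G k) h A \<in> carrier (lcs_quot G k) \<and>
    qbar k (finprod (lcs_quot G k) h A) = (\<Sum>a\<in>A. qbar k (h a))"
    using assms
  proof (induction A rule: finite_induct)
    case empty
    then show ?case using K.one_closed by (simp add: lcs_quot_one qbar_one del: lcs.simps)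
  next
    case (insert x F)
    then have "h \<in> F \<rightarrow> carrier (lcs_quot G k)" "h x \<in> carrier (lcs_quot G k)" by auto
    then show ?case using insert by (simp add: lcs_quot_mult[symmetric] K.finprod_insert)
      (simp add: lcs_quot_mult qbar_mult)
  qed
  then show "finprod (lcs_quot G k) h A \<in> carrier (lcs_quot G k)"
    "qbar k (finprod (lcs_quot G k) h A) = (\<Sum>a\<in>A. qbar k (h a))" by auto
qed

lemma part_qbar:
  assumes "U \<in> carrier (lcs_quot G k)"
  shows "part l (qbar k U) = (if l = k + 2 then qbar k U else 0)"
  unfolding qbar_def by (rule q_part[OF rep_lcs[OF assms]])

lemma qbar_M: "U \<in> carrier (lcs_quot G k) \<Longrightarrow> M \<le> k \<Longrightarrow> qbar k U = 0"
  unfolding qbar_def using rep_lcs[of U k] lcs_M[of k] q_one by auto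

definition lie_map :: "(nat \<Rightarrow> 'a set) \<Rightarrow> rmag" where
  "lie_map f = (\<Sum>k<M. qbar k (f k))"

lemma part_lie_map:
  assumes "\<And>k. f k \<in> carrier (lcs_quot G k)"
  shows "part (k + 2) (lie_map f) = qbar k (f k)"
proof -
  have "part (k + 2) (lie_map f) = (\<Sum>l<M. if l = k then qbar k (f k) else 0)"
    unfolding lie_map_def part_sum by (rule sum.cong) (use assms in \<open>auto simp: part_qbar\<close>)
  also have "\<dots> = (if k < M then qbar k (f k) else 0)" by simp
  finally show ?thesis using qbar_M[OF assms] by auto
qed

lemma br_0: "br 0 c = 0" "br a 0 = 0"
  using br_add(1)[of 0 0 c] br_add(2)[of a 0 0] by simp_all

lemma br_sum_left: "br (sum h A) c = (\<Sum>a\<in>A. br (h a) c)"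
  by (induction A rule: infinite_finite_induct) (auto simp: br_0 br_add)

lemma br_sum_right: "br c (sum h A) = (\<Sum>a\<in>A. br c (h a))"
  by (induction A rule: infinite_finite_induct) (auto simp: br_0 br_add)

text \<open>From index M on all quotients are trivial, so the finiteness condition in
  \<open>LieG\<close> holds automatically.\<close>

lemma fin_cosets:
  assumes "\<And>k. f k \<in> carrier (lcs_quot G k)"
  shows "f \<in> lcarrier (LieG G)"
proof -
  have "f k = lcs G (Suc k)" if "M \<le> k" for k
    by (rule qbar_inj[OF assms]) (use qbar_M[OF assms that] qbar_one group.is_monoid[OF lcs_quot_group]
        monoid.one_closed lcs_quot_one in \<open>metis\<close>)+
  then have "{k. f k \<noteq> lcs G (Suc k)} \<subseteq> {..<M}" by (auto simp del: lcs.simps simp flip: not_le)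
  then have "finite {k. f k \<noteq> lcs G (Suc k)}" by (rule finite_subset) simp
  then show ?thesis using assms by (simp add: LieG_def del: lcs.simps)
qed

lemma LieG_carrier: "f \<in> lcarrier (LieG G) \<longleftrightarrow> (\<forall>k. f k \<in> carrier (lcs_quot G k))"
  using fin_cosets by (auto simp: LieG_def)

lemma lie_map_D:
  assumes f: "\<And>k. f k \<in> carrier (lcs_quot G k)"
  shows "lie_map f \<in> D"
proof -
  have "finite A \<Longrightarrow> (\<Sum>k\<in>A. qbar k (f k)) \<in> D" for A
  proof (induction A rule: finite_induct)
    case (insert k A)
    have "qbar k (f k) \<in> D" unfolding qbar_def by (rule q_D[OF rep_lcs[OF f]])
    then show ?case using insert by (simp add: D_add)
  qed (simp add: D_0)
  then show ?thesis by (simp add: lie_map_def)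
qed

lemma LieG_bij: "bij_betw lie_map (lcarrier (LieG G)) D"
  unfolding bij_betw_def
proof (intro conjI equalityI subsetI)
  show "inj_on lie_map (lcarrier (LieG G))"
  proof (rule inj_onI, rule ext)
    fix f g k assume "f \<in> lcarrier (LieG G)" "g \<in> lcarrier (LieG G)" and e: "lie_map f = lie_map g"
    then have fg: "\<And>k. f k \<in> carrier (lcs_quot G k)" "\<And>k. g k \<in> carrier (lcs_quot G k)"
      by (auto simp: LieG_carrier)
    show "f k = g k"
      by (rule qbar_inj[OF fg]) (use part_lie_map[of f k] part_lie_map[of g k] fg e in simp)
  qed
next
  fix d assume "d \<in> lie_map ` lcarrier (LieG G)"
  then show "d \<in> D" using lie_map_D by (auto simp: LieG_carrier)
next
  fix d assume d: "d \<in> D"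
  define x where "x k = (SOME x. x \<in> lcs G k \<and> q k x = part (k + 2) d)" for k
  have x: "x k \<in> lcs G k" "q k (x k) = part (k + 2) d" for k
    unfolding x_def by (rule someI2_ex; use D_q[OF d, of k] in blast)+
  let ?f = "\<lambda>k. lcs G (Suc k) #> x k"
  have "?f \<in> lcarrier (LieG G)" using x coset_lcs_quot unfolding LieG_carrier by blast
  moreover have "lie_map ?f = d"
    unfolding lie_map_def using D_sum[OF d] coset_rep(2)[OF x(1)] x(2) by (simp del: lcs.simps)
  ultimately show "d \<in> lie_map ` lcarrier (LieG G)" by (intro image_eqI) (auto simp del: lcs.simps)
qed

lemma LieG_lbr_qbar:
  assumes f: "\<And>k. f k \<in> carrier (lcs_quot G k)" and g: "\<And>k. g k \<in> carrier (lcs_quot G k)"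
  shows "lbr (LieG G) f g k \<in> carrier (lcs_quot G k)"
    "qbar k (lbr (LieG G) f g k) = (\<Sum>(i, j)\<in>{(i, j). i + j + 1 = k}. br (qbar i (f i)) (qbar j (g j)))"
proof -
  let ?A = "{(i, j). i + j + 1 = k}"
  let ?h = "\<lambda>(i, j). lcs G (Suc k) #> gcomm G (lcs_rep (f i)) (lcs_rep (g j))"
  have "?A \<subseteq> {..k} \<times> {..k}" by auto
  then have fin: "finite ?A" by (rule finite_subset) simp
  have *: "gcomm G (lcs_rep (f i)) (lcs_rep (g j)) \<in> lcs G k" if "i + j + 1 = k" for i j
    using gcomm_lcs[OF rep_lcs[OF f] rep_lcs[OF g]] that by blast
  have h: "?h a \<in> carrier (lcs_quot G k)" if "a \<in> ?A" for a
    using that * by (auto simp del: lcs.simps intro!: coset_lcs_quot)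
  have e: "lbr (LieG G) f g k = finprod (lcs_quot G k) ?h ?A" by (simp add: LieG_def del: lcs.simps)
  show "lbr (LieG G) f g k \<in> carrier (lcs_quot G k)"
    unfolding e by (rule qbar_finprod(1)[OF fin h])
  have "qbar k (lbr (LieG G) f g k) = (\<Sum>a\<in>?A. qbar k (?h a))"
    unfolding e by (rule qbar_finprod(2)[OF fin h])
  also have "\<dots> = (\<Sum>(i, j)\<in>?A. br (qbar i (f i)) (qbar j (g j)))"
  proof (rule sum.cong[OF refl])
    fix a assume "a \<in> ?A"
    then obtain i j where a: "a = (i, j)" and k: "i + j + 1 = k" by auto
    have "qbar k (lcs G (Suc k) #> gcomm G (lcs_rep (f i)) (lcs_rep (g j)))
        = q k (gcomm G (lcs_rep (f i)) (lcs_rep (g j)))"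
      by (rule coset_rep(2)[OF *[OF k]])
    then show "qbar k (?h a) = (case a of (i, j) \<Rightarrow> br (qbar i (f i)) (qbar j (g j)))"
      unfolding a prod.case qbar_def[of i] qbar_def[of j] using q_gcomm[OF rep_lcs[OF f] rep_lcs[OF g], of i j] k by simp
  qed
  finally show "qbar k (lbr (LieG G) f g k) = (\<Sum>(i, j)\<in>?A. br (qbar i (f i)) (qbar j (g j)))" .
qed

lemma br_qbar_M:
  assumes f: "\<And>k. f k \<in> carrier (lcs_quot G k)" and g: "\<And>k. g k \<in> carrier (lcs_quot G k)"
    and "M \<le> i + j + 1"
  shows "br (qbar i (f i)) (qbar j (g j)) = 0"
proof -
  have "gcomm G (lcs_rep (f i)) (lcs_rep (g j)) = \<one>"
    using gcomm_lcs[OF rep_lcs[OF f] rep_lcs[OF g], of i j] lcs_M[OF assms(3)] by blast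
  then show ?thesis
    unfolding qbar_def using q_gcomm[OF rep_lcs[OF f] rep_lcs[OF g], of i j] q_one by simp
qed

theorem LieG_rep: "lie_rep (LieG G) lie_map br D"
  unfolding lie_rep_def
proof (intro conjI ballI LieG_bij)
  fix f assume "f \<in> lcarrier (LieG G)"
  then have f: "\<And>k. f k \<in> carrier (lcs_quot G k)" by (auto simp: LieG_carrier)
  have e: "lneg (LieG G) f k = inv\<^bsub>lcs_quot G k\<^esub> (f k)" for k by (simp add: LieG_def)
  show "lneg (LieG G) f \<in> lcarrier (LieG G)"
    unfolding LieG_carrier e using group.inv_closed[OF lcs_quot_group f] by blast
  show "lie_map (lneg (LieG G) f) = - lie_map f"
    unfolding lie_map_def e by (simp add: qbar_inv[OF f] sum_negf)
  fix g assume "g \<in> lcarrier (LieG G)"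
  then have g: "\<And>k. g k \<in> carrier (lcs_quot G k)" by (auto simp: LieG_carrier)
  have e: "ladd (LieG G) f g k = f k <#> g k" for k by (simp add: LieG_def)
  show "ladd (LieG G) f g \<in> lcarrier (LieG G)"
    unfolding LieG_carrier e
    using monoid.m_closed[OF group.is_monoid[OF lcs_quot_group] f g] by (simp add: lcs_quot_mult)
  show "lie_map (ladd (LieG G) f g) = lie_map f + lie_map g"
    unfolding lie_map_def e by (simp add: qbar_mult[OF f g] sum.distrib)
  show "lbr (LieG G) f g \<in> lcarrier (LieG G)"
    unfolding LieG_carrier using LieG_lbr_qbar(1)[OF f g] by blast
  let ?b = "\<lambda>(i, j). br (qbar i (f i)) (qbar j (g j))"
  have "lie_map (lbr (LieG G) f g) = (\<Sum>k<M. \<Sum>p\<in>{(i, j). i + j + 1 = k}. ?b p)"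
    unfolding lie_map_def LieG_lbr_qbar(2)[OF f g] ..
  also have "\<dots> = (\<Sum>(k, p)\<in>(SIGMA k:{..<M}. {(i, j). i + j + 1 = k}). ?b p)"
  proof (rule sum.Sigma)
    show "\<forall>k\<in>{..<M}. finite {(i, j). i + j + 1 = k}"
    proof
      fix k :: nat
      have "{(i, j). i + j + 1 = k} \<subseteq> {..k} \<times> {..k}" by auto
      then show "finite {(i, j). i + j + 1 = k}" by (rule finite_subset) simp
    qed
  qed simp
  also have "\<dots> = (\<Sum>p\<in>{(i, j). i + j + 1 < M}. ?b p)"
    by (rule sum.reindex_bij_witness[where i = "\<lambda>(i, j). (i + j + 1, (i, j))" and j = snd]) auto
  \<comment> \<open>Pairs outside the triangle have bracket zero by \<open>br_qbar_M\<close>; over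
    the full square, bilinearity separates the two sums.\<close>
  also have "\<dots> = (\<Sum>p\<in>{..<M} \<times> {..<M}. ?b p)"
  proof (rule sum.mono_neutral_left)
    show "\<forall>p\<in>{..<M} \<times> {..<M} - {(i, j). i + j + 1 < M}. ?b p = 0"
    proof
      fix p assume p: "p \<in> {..<M} \<times> {..<M} - {(i, j). i + j + 1 < M}"
      obtain i j where ij: "p = (i, j)" by (cases p)
      then have "M \<le> i + j + 1" using p by auto
      from br_qbar_M[OF f g this] show "?b p = 0" using ij by simp
    qed
  qed auto
  also have "\<dots> = br (lie_map f) (lie_map g)"
    by (simp only: lie_map_def br_sum_left) (simp add: br_sum_right sum.cartesian_product)
  finally show "lie_map (lbr (LieG G) f g) = br (lie_map f) (lie_map g)" .
qed

end

section \<open>The lower central series of the group of conjugating automorphisms\<close>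

section \<open>Conjugating automorphisms\<close>

text \<open>A substitution by \<open>y_i + c_i\<close> plus higher terms is, on words, the identity
  plus a derivation plus an error of one order more. Products of two corrections have order 2k + 1
  above the length of the remaining word, and \<open>1 \<le> k\<close> puts them at or beyond the
  required k + 2.\<close>

lemma prod_list_lead:
  assumes k: "1 \<le> k"
    and z: "\<And>i. i \<in> set w \<Longrightarrow> z i - mgen i - c i \<in> ordge (k + 2)"
    and c: "\<And>i. c i \<in> ordge (k + 1)"
  shows "prod_list (map z w) - mon w - dw c w \<in> ordge (length w + k + 1)"
  using z
proof (induction w)
  case (Cons i w)
  let ?P = "prod_list (map z w)" and ?D = "dw c w"
  let ?R = "?P - mon w - ?D" and ?S = "z i - mgen i - c i"
  have R: "?R \<in> ordge (length w + k + 1)"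
    by (rule Cons.IH, rule Cons.prems) simp
  have R0: "?S \<in> ordge (k + 2)" using Cons.prems by simp
  have D: "?D \<in> ordge (length w + k)" by (rule dw_ordge) (use c in simp)
  have P: "?P \<in> ordge (length w)"
    using ordge_add[OF ordge_add[OF ordge_mono[OF R, of "length w"] ordge_mono[OF D, of "length w"]] ordge_mon[of w]]
    by (simp add: algebra_simps)
  have "prod_list (map z (i # w)) - mon (i # w) - dw c (i # w)
      = mgen i * ?R + c i * (?D + ?R) + ?S * ?P"
    by (simp add: mon_Cons[of i w] algebra_simps)
  moreover have "mgen i * ?R \<in> ordge (length [i] + (length w + k + 1))"
    by (rule ordge_mult[OF ordge_mon R])
  moreover have "c i * (?D + ?R) \<in> ordge ((k + 1) + (length w + k))"
    by (rule ordge_mult[OF c ordge_add[OF D ordge_mono[OF R]]]) simp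
  moreover have "?S * ?P \<in> ordge ((k + 2) + length w)"
    by (rule ordge_mult[OF R0 P])
  ultimately show ?case
    using k by (auto intro!: ordge_add elim: ordge_mono)
qed simp

lemma ext_lead:
  assumes k: "1 \<le> k"
    and z: "\<And>i. i < n \<Longrightarrow> z i - mgen i - comm (tail i d) (mgen i) \<in> ordge (k + 2)"
    and d: "\<And>i. tail i d \<in> ordge k"
    and f: "f \<in> rsub {..<n}" "f \<in> ordge e"
  shows "ext n z f - f - delta n d f \<in> ordge (e + k + 1)"
proof -
  let ?c = "\<lambda>i. comm (tail i d) (mgen i)"
  have "ext n z f - f - delta n d f = ext n z f - lin n mon f - delta n d f"
    by (simp add: lin_mon_rsub f)
  also have "\<dots> = lin n (\<lambda>w. prod_list (map z w) - mon w - dw ?c w) f"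
    by (simp add: ext_def delta_def lin_diff_fun)
  also have "\<dots> \<in> ordge (e + (k + 1))"
  proof (rule ordge_lin[OF f(2)])
    fix w assume "w \<in> dwords n"
    then have "prod_list (map z w) - mon w - dw ?c w \<in> ordge (length w + k + 1)"
      using comm_ordge[OF d ordge_mon[of "[_]"]] z
      by (intro prod_list_lead[OF k]) (auto simp: dwords_def)
    then show "prod_list (map z w) - mon w - dw ?c w \<in> ordge (length w + (k + 1))"
      by (simp add: add.assoc)
  qed
  finally show ?thesis by (simp add: add.assoc)
qed

lemma ext_lead_weak:
  assumes "1 \<le> k"
    and "\<And>i. i < n \<Longrightarrow> z i - mgen i - comm (tail i d) (mgen i) \<in> ordge (k + 2)"
    and "\<And>i. tail i d \<in> ordge k"
    and "f \<in> rsub {..<n}" "f \<in> ordge e"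
  shows "ext n z f - f \<in> ordge (e + k)"
proof -
  have "ext n z f - f - delta n d f \<in> ordge (e + k)"
    by (rule ordge_mono[OF ext_lead[OF assms]]) auto
  from ordge_add[OF this delta_ordge[OF assms(3,5), of n]] show ?thesis by simp
qed

lemma ext_rsub: "(\<And>i. i < n \<Longrightarrow> z i \<in> rsub S) \<Longrightarrow> ext n z f \<in> rsub S"
proof -
  assume z: "\<And>i. i < n \<Longrightarrow> z i \<in> rsub S"
  have "set w \<subseteq> {..<n} \<Longrightarrow> prod_list (map z w) \<in> rsub S" for w
    by (induction w) (auto intro: rsub_mult z)
  then show ?thesis unfolding ext_def by (intro rsub_lin) (auto simp: dwords_def)
qed

lemma hmg_add: "f \<in> hmg d \<Longrightarrow> g \<in> hmg d \<Longrightarrow> f + g \<in> hmg d"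
  by (auto simp: hmg_def) (metis add.right_neutral)
lemma hmg_of_int_mult: "f \<in> hmg d \<Longrightarrow> of_int c * f \<in> hmg d"
  by (auto simp: hmg_def)
lemma hmg_sum: "(\<And>a. a \<in> A \<Longrightarrow> f a \<in> hmg d) \<Longrightarrow> sum f A \<in> hmg d"
  by (induction A rule: infinite_finite_induct) (auto intro: hmg_add)
lemma hmg_mgen: "mgen i \<in> hmg 1"
  using hmg_mon[of "[i]"] by simp
lemma hmg_part: "part k f \<in> hmg k"
  by (auto simp: hmg_def coef_part)
lemma hmg_tail: "f \<in> hmg (Suc k) \<Longrightarrow> tail j f \<in> hmg k"
  by (auto simp: hmg_def coef_tail)
lemma hmg_ordge: "f \<in> hmg k \<Longrightarrow> f \<in> ordge k"
  by (auto simp: hmg_def ordge_def)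

lemma dw_hmg: "(\<And>i. c i \<in> hmg (Suc k)) \<Longrightarrow> dw c w \<in> hmg (length w + k)"
proof (induction w)
  case (Cons i w)
  have "c i * mon w \<in> hmg (Suc k + length w)" by (rule hmg_mult[OF Cons.prems hmg_mon])
  moreover have "mgen i * dw c w \<in> hmg (1 + (length w + k))"
    by (rule hmg_mult[OF hmg_mgen Cons.IH[OF Cons.prems]])
  ultimately show ?case by (auto intro!: hmg_add simp: add_ac)
qed simp

lemma delta_hmg:
  assumes "\<And>i. tail i d \<in> hmg k" "f \<in> hmg e"
  shows "delta n d f \<in> hmg (e + k)"
  unfolding delta_def lin_def
proof (rule hmg_sum)
  fix w
  have "dw (\<lambda>i. comm (tail i d) (mgen i)) w \<in> hmg (length w + k)"
    by (rule dw_hmg) (use comm_hmg[OF assms(1) hmg_mgen] in simp)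
  then show "of_int (coef f w) * dw (\<lambda>i. comm (tail i d) (mgen i)) w \<in> hmg (e + k)"
    using assms(2) by (cases "coef f w = 0") (auto simp: hmg_def[of e] intro!: hmg_of_int_mult)
qed

lemma delta_single:
  assumes "f \<in> rsub (- {i})"
  shows "delta n (s * mgen i) f = 0"
  unfolding delta_def
proof (rule lin_eq_0)
  fix w assume "coef f w \<noteq> 0"
  then have "i \<notin> set w" using assms by (auto simp: rsub_def)
  then show "dw (\<lambda>j. comm (tail j (s * mgen i)) (mgen j)) w = 0"
    by (induction w) (auto simp: tail_mult_mgen)
qed

lemma single_TD:
  assumes "s \<in> Lie n" "i < n"
  shows "s * mgen i \<in> TD n"
proof -
  have "s * mgen i = (\<Sum>j<n. (if j = i then s else 0) * mgen j)"
    using assms(2) by (simp add: if_distrib[of "\<lambda>x. x * _"] cong: if_cong)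
  also have "\<dots> \<in> TD n" by (rule TD_sumI) (use assms in \<open>auto intro: Lie.zero\<close>)
  finally show ?thesis .
qed

text \<open>Each derivation moves only \<open>y_i\<close> and annihilates the coefficient of the
  other, so only the bracket of the coefficients survives, in reversed order.\<close>

lemma brD_single:
  assumes i: "i < n" and s: "s \<in> Lie n" "s \<in> rsub (- {i})" and t: "t \<in> Lie n" "t \<in> rsub (- {i})"
  shows "brD n (s * mgen i) (t * mgen i) = comm t s * mgen i"
proof (rule TD_eqI)
  show "brD n (s * mgen i) (t * mgen i) \<in> TD n" "comm t s * mgen i \<in> TD n"
    using i s t by (auto intro: brD_TD single_TD Lie.comm)
  fix j assume j: "j < n"
  have ks: "kill i s = s" "kill i t = t" by (rule kill_rsub[OF s(2)], simp) (rule kill_rsub[OF t(2)], simp)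
  show "tail j (brD n (s * mgen i) (t * mgen i)) = tail j (comm t s * mgen i)"
    using i s t j
    by (cases "j = i") (simp_all add: tail_brD single_TD tail_mult_mgen ks delta_single)
qed

context reduced_free
begin

text \<open>Written exactly as \<open>hPSigma\<close>, with an abstract group in place of
  \<open>RF n\<close>, so that the two agree on unfolding.\<close>

definition CA :: "('a \<Rightarrow> 'a) monoid" where
  "CA = (AutoGroup Q)\<lparr>carrier :=
     {\<phi> \<in> auto Q. \<forall>i<n. \<exists>g\<in>carrier Q. \<phi> (xg i) = g \<otimes> xg i \<otimes> inv g}\<rparr>"

lemma CA_auto: "\<phi> \<in> carrier CA \<Longrightarrow> \<phi> \<in> auto Q"
  by (simp add: CA_def)

lemma CA_conj: "\<phi> \<in> carrier CA \<Longrightarrow> i < n \<Longrightarrow> \<exists>g\<in>carrier Q. \<phi> (xg i) = g \<otimes> xg i \<otimes> inv g"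
  by (simp add: CA_def)

lemma auto_closed: "\<phi> \<in> auto Q \<Longrightarrow> x \<in> carrier Q \<Longrightarrow> \<phi> x \<in> carrier Q"
  by (auto simp: auto_def hom_def)

lemma auto_mult: "\<phi> \<in> auto Q \<Longrightarrow> x \<in> carrier Q \<Longrightarrow> y \<in> carrier Q \<Longrightarrow> \<phi> (x \<otimes> y) = \<phi> x \<otimes> \<phi> y"
  by (auto simp: auto_def hom_def)

lemma auto_hom: "\<phi> \<in> auto Q \<Longrightarrow> group_hom Q Q \<phi>"
  by (auto simp: auto_def group_hom_def group_hom_axioms_def is_group)

lemma auto_one: "\<phi> \<in> auto Q \<Longrightarrow> \<phi> \<one> = \<one>"
  using group_hom.hom_one[OF auto_hom] .

lemma auto_inv: "\<phi> \<in> auto Q \<Longrightarrow> x \<in> carrier Q \<Longrightarrow> \<phi> (inv x) = inv (\<phi> x)"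
  using group_hom.hom_inv[OF auto_hom] .

lemma AutoGroup_mult:
  "\<phi> \<in> auto Q \<Longrightarrow> \<psi> \<in> auto Q \<Longrightarrow> x \<in> carrier Q \<Longrightarrow> (\<phi> \<otimes>\<^bsub>AutoGroup Q\<^esub> \<psi>) x = \<phi> (\<psi> x)"
  by (auto simp: AutoGroup_def BijGroup_def auto_def compose_def)

lemma AutoGroup_one: "x \<in> carrier Q \<Longrightarrow> \<one>\<^bsub>AutoGroup Q\<^esub> x = x"
  by (simp add: AutoGroup_def BijGroup_def)

lemma AutoGroup_carrier: "carrier (AutoGroup Q) = auto Q"
  by (simp add: AutoGroup_def)

lemma CA_subgroup: "subgroup (carrier CA) (AutoGroup Q)"
proof -
  interpret A: group "AutoGroup Q" by (rule AutoGroup)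
  show ?thesis
  proof (rule A.subgroupI)
    show "carrier CA \<subseteq> carrier (AutoGroup Q)"
      unfolding AutoGroup_carrier using CA_auto by blast
    have "\<one>\<^bsub>AutoGroup Q\<^esub> \<in> carrier CA"
      using A.one_closed unfolding CA_def
      by (auto simp: AutoGroup_carrier AutoGroup_one X_closed intro!: bexI[of _ \<one>])
    then show "carrier CA \<noteq> {}" by blast
  next
    fix \<phi> \<psi> assume p: "\<phi> \<in> carrier CA" "\<psi> \<in> carrier CA"
    have pa: "\<phi> \<in> auto Q" "\<psi> \<in> auto Q" using p CA_auto by auto
    have m: "\<phi> \<otimes>\<^bsub>AutoGroup Q\<^esub> \<psi> \<in> auto Q"
      using A.m_closed[of \<phi> \<psi>] pa by (simp add: AutoGroup_carrier)
    have "\<exists>g\<in>carrier Q. (\<phi> \<otimes>\<^bsub>AutoGroup Q\<^esub> \<psi>) (xg i) = g \<otimes> xg i \<otimes> inv g" if i: "i < n" for i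
    proof -
      obtain g h where g: "g \<in> carrier Q" "\<phi> (xg i) = g \<otimes> xg i \<otimes> inv g"
        and h: "h \<in> carrier Q" "\<psi> (xg i) = h \<otimes> xg i \<otimes> inv h"
        using CA_conj p i by metis
      have "(\<phi> \<otimes>\<^bsub>AutoGroup Q\<^esub> \<psi>) (xg i) = (\<phi> h \<otimes> g) \<otimes> xg i \<otimes> inv (\<phi> h \<otimes> g)"
        using pa g h X_closed[OF i]
        by (simp add: AutoGroup_mult auto_mult auto_inv auto_closed m_assoc inv_mult_group)
      then show ?thesis using g h pa by (metis auto_closed m_closed)
    qed
    then show "\<phi> \<otimes>\<^bsub>AutoGroup Q\<^esub> \<psi> \<in> carrier CA" using m by (simp add: CA_def)
  next
    fix \<phi> assume p: "\<phi> \<in> carrier CA"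
    then have pa: "\<phi> \<in> auto Q" using CA_auto by auto
    let ?i = "inv\<^bsub>AutoGroup Q\<^esub> \<phi>"
    have ia: "?i \<in> auto Q" using A.inv_closed[of \<phi>] pa by (simp add: AutoGroup_carrier)
    have il: "?i (\<phi> x) = x" if "x \<in> carrier Q" for x
      using A.l_inv[of \<phi>] pa ia that AutoGroup_mult[OF ia pa that] by (simp add: AutoGroup_carrier AutoGroup_one)
    have "\<exists>g\<in>carrier Q. ?i (xg i) = g \<otimes> xg i \<otimes> inv g" if i: "i < n" for i
    proof -
      obtain g where g: "g \<in> carrier Q" "\<phi> (xg i) = g \<otimes> xg i \<otimes> inv g"
        using CA_conj p i by metis
      let ?h = "?i g"
      have hc: "?h \<in> carrier Q" "?i (xg i) \<in> carrier Q" using g ia X_closed[OF i] by (auto intro: auto_closed)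
      have "xg i = ?i (\<phi> (xg i))" using il[OF X_closed[OF i]] by simp
      also have "\<dots> = ?h \<otimes> ?i (xg i) \<otimes> inv ?h"
        using g ia X_closed[OF i] by (simp add: auto_mult auto_inv)
      finally have "inv ?h \<otimes> xg i \<otimes> inv (inv ?h) = inv ?h \<otimes> (?h \<otimes> ?i (xg i) \<otimes> inv ?h) \<otimes> ?h"
        using hc by simp
      also have "\<dots> = ?i (xg i)"
        using hc by (simp add: m_assoc) (simp add: m_assoc[symmetric])
      finally show ?thesis using hc by (metis inv_closed)
    qed
    then show "?i \<in> carrier CA" using ia by (simp add: CA_def)
  qed
qed

lemma CA_group: "group CA"
proof -
  have "group ((AutoGroup Q)\<lparr>carrier := carrier CA\<rparr>)"
    by (rule subgroup.subgroup_is_group[OF CA_subgroup AutoGroup])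
  then show ?thesis by (simp add: CA_def)
qed

lemma CA_mult:
  "\<phi> \<in> carrier CA \<Longrightarrow> \<psi> \<in> carrier CA \<Longrightarrow> x \<in> carrier Q \<Longrightarrow> (\<phi> \<otimes>\<^bsub>CA\<^esub> \<psi>) x = \<phi> (\<psi> x)"
  using AutoGroup_mult[OF CA_auto CA_auto] by (simp add: CA_def)

lemma CA_one: "x \<in> carrier Q \<Longrightarrow> \<one>\<^bsub>CA\<^esub> x = x"
  using AutoGroup_one by (simp add: CA_def)

lemma CA_eqI:
  assumes "\<phi> \<in> carrier CA" "\<psi> \<in> carrier CA" "\<And>i. i < n \<Longrightarrow> \<phi> (xg i) = \<psi> (xg i)"
  shows "\<phi> = \<psi>"
proof (rule extensionalityI)
  have a: "\<phi> \<in> auto Q" "\<psi> \<in> auto Q" using assms CA_auto by auto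
  then show "\<phi> \<in> extensional (carrier Q)" "\<psi> \<in> extensional (carrier Q)"
    by (auto simp: auto_def Bij_def)
  fix x assume "x \<in> carrier Q"
  then show "\<phi> x = \<psi> x"
    unfolding gen[symmetric]
  proof (induction rule: generate.induct)
    case (eng x y)
    then show ?case using generate_in_carrier[OF Xs_closed[of n]] by (simp add: auto_mult[OF a(1)] auto_mult[OF a(2)])
  qed (use a assms(3) X_closed in \<open>auto simp: auto_one auto_inv\<close>)
qed

subsection \<open>The induced endomorphisms of the Magnus ring\<close>

text \<open>The value 0 from n on makes the condition of \<open>ext_mult\<close> hold at every
  index.\<close>

definition img :: "('a \<Rightarrow> 'a) \<Rightarrow> nat \<Rightarrow> rmag" where
  "img \<phi> i = (if i < n then \<mu> (\<phi> (xg i)) - 1 else 0)"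

definition E :: "('a \<Rightarrow> 'a) \<Rightarrow> rmag \<Rightarrow> rmag" where
  "E \<phi> = ext n (img \<phi>)"

lemma E_add [simp]: "E \<phi> (f + g) = E \<phi> f + E \<phi> g" and E_diff [simp]: "E \<phi> (f - g) = E \<phi> f - E \<phi> g"
  and E_1 [simp]: "E \<phi> 1 = 1"
  by (simp_all add: E_def)

lemma mu_rsub_n: "g \<in> carrier Q \<Longrightarrow> \<mu> g \<in> rsub {..<n}"
  using mu_rsub[of "{..<n}" g] gen by simp

lemma coef_mu_Nil: "g \<in> carrier Q \<Longrightarrow> coef (\<mu> g) [] = 1"
  unfolding gen[symmetric]
proof (induction rule: generate.induct)
  case (eng g h)
  then show ?case using generate_in_carrier[OF Xs_closed[of n]] by (simp add: mu_mult coef_mult)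
qed (auto simp: mu_one mu_X mu_inv_X coef_1 coef_mon)

lemma mu_ordge_1: "g \<in> carrier Q \<Longrightarrow> \<mu> g - 1 \<in> ordge 1"
  by (auto simp: ordge_def coef_mu_Nil coef_1)

text \<open>The conjugator h is chosen free of \<open>x_j\<close>, so \<open>\<mu> h\<close> has no
  \<open>y_j\<close>. Words ending in j then arise only from the constant term 1 of
  \<open>\<mu> (inv h)\<close>, and \<open>tail j\<close> reads off \<open>\<mu> h\<close>
  exactly.\<close>

lemma CA_repr:
  assumes p: "\<phi> \<in> carrier CA" and j: "j < n"
  obtains h where "h \<in> carrier Q" "\<mu> (\<phi> (xg j)) = 1 + \<mu> h * mgen j * \<mu> (inv h)"
    "tail j (\<mu> (\<phi> (xg j))) = \<mu> h"
proof -
  obtain g where g: "g \<in> carrier Q" "\<phi> (xg j) = g \<otimes> xg j \<otimes> inv g"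
    using CA_conj[OF p j] by blast
  obtain h where h: "h \<in> generate Q (xg ` ({..<n} - {j}))" "h \<in> carrier Q"
    "\<phi> (xg j) = h \<otimes> xg j \<otimes> inv h"
    using conj_X_avoid[OF j g(1)] g(2) by metis
  have m: "\<mu> (\<phi> (xg j)) = 1 + \<mu> h * mgen j * \<mu> (inv h)"
    using h X_closed[OF j] mu_inv[OF h(2)] by (simp add: mu_mult mu_X[OF j] algebra_simps)
  have k: "kill j (\<mu> h) = \<mu> h"
    by (rule kill_rsub[OF mu_rsub[OF _ h(1)]]) auto
  have "tail j (\<mu> (\<phi> (xg j))) = \<mu> h"
    unfolding m using h(2) by (simp add: tail_mult[of j "\<mu> h * mgen j"] tail_mult_mgen k kill_mon coef_mu_Nil)
  then show ?thesis using that h(2) m by blast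
qed

lemma img_null: "\<phi> \<in> carrier CA \<Longrightarrow> img \<phi> i * u * img \<phi> i = 0"
proof (cases "i < n")
  case True
  assume "\<phi> \<in> carrier CA"
  from CA_repr[OF this True] obtain h where "\<mu> (\<phi> (xg i)) = 1 + \<mu> h * mgen i * \<mu> (inv h)" by blast
  then have "img \<phi> i \<in> cont i" using True
    by (auto simp: img_def intro: cont_mult_left cont_mult_right cont_mgen)
  then show ?thesis by (intro cont_mult_eq_0 cont_mult_right)
qed (simp add: img_def)

lemma E_mult: "\<phi> \<in> carrier CA \<Longrightarrow> E \<phi> (f * g) = E \<phi> f * E \<phi> g"
  unfolding E_def by (rule ext_mult[OF img_null])

lemma E_mgen: "j < n \<Longrightarrow> E \<phi> (mgen j) = \<mu> (\<phi> (xg j)) - 1"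
  by (simp add: E_def ext_mgen img_def)

lemma E_mu:
  assumes p: "\<phi> \<in> carrier CA" and g: "g \<in> carrier Q"
  shows "\<mu> (\<phi> g) = E \<phi> (\<mu> g)"
  using g unfolding gen[symmetric]
proof (induction rule: generate.induct)
  case one
  then show ?case by (simp add: auto_one[OF CA_auto[OF p]] mu_one)
next
  case (incl h)
  then show ?case by (auto simp: mu_X E_mgen)
next
  case (inv h)
  then obtain i where i: "h = xg i" "i < n" by auto
  have x: "xg i \<in> carrier Q" "\<phi> (xg i) \<in> carrier Q"
    using X_closed i auto_closed[OF CA_auto[OF p]] by auto
  have "\<mu> (inv (\<phi> (xg i))) = E \<phi> (\<mu> (inv (xg i)))"
  proof (rule mu_inv_eqI[OF x(2)])
    have "\<mu> (\<phi> (xg i)) * E \<phi> (\<mu> (inv (xg i))) = E \<phi> (\<mu> (xg i) * \<mu> (inv (xg i)))"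
      using p i by (simp add: E_mult mu_X E_mgen)
    then show "\<mu> (\<phi> (xg i)) * E \<phi> (\<mu> (inv (xg i))) = 1" using mu_inv(1)[OF x(1)] by simp
  qed
  then show ?case using i x p by (simp add: auto_inv[OF CA_auto])
next
  case (eng g h)
  then have c: "g \<in> carrier Q" "h \<in> carrier Q" using generate_in_carrier[OF Xs_closed[of n]] by auto
  then show ?case
    using eng p by (simp add: auto_mult[OF CA_auto] auto_closed[OF CA_auto] mu_mult E_mult)
qed

lemma E_rsub: "\<phi> \<in> carrier CA \<Longrightarrow> E \<phi> f \<in> rsub {..<n}"
  unfolding E_def
proof (rule ext_rsub)
  fix i assume "\<phi> \<in> carrier CA" "i < n"
  then have "\<phi> (xg i) \<in> carrier Q" by (simp add: auto_closed[OF CA_auto] X_closed)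
  then show "img \<phi> i \<in> rsub {..<n}" by (simp add: img_def rsub_diff mu_rsub_n)
qed

subsection \<open>The Andreadakis-type filtration\<close>

text \<open>By \<open>CA_repr\<close> the tail is \<open>\<mu> h\<close> for a conjugator h of
  \<open>x_j\<close>; the condition bounds the depth of all conjugators from below.\<close>

definition fil :: "nat \<Rightarrow> ('a \<Rightarrow> 'a) \<Rightarrow> bool" where
  "fil k \<phi> \<longleftrightarrow> (\<forall>j<n. tail j (\<mu> (\<phi> (xg j))) - 1 \<in> ordge k)"

definition lead :: "nat \<Rightarrow> ('a \<Rightarrow> 'a) \<Rightarrow> rmag" where
  "lead k \<phi> = (\<Sum>j<n. part k (tail j (\<mu> (\<phi> (xg j)))) * mgen j)"

lemma tail_lead: "j < n \<Longrightarrow> tail j (lead k \<phi>) = part k (tail j (\<mu> (\<phi> (xg j))))"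
  unfolding lead_def by (simp add: tail_sum_mgen kill_part)

lemma fil_1: "\<phi> \<in> carrier CA \<Longrightarrow> fil 1 \<phi>"
  unfolding fil_def
proof (intro allI impI)
  fix j assume "\<phi> \<in> carrier CA" "j < n"
  then obtain h where "h \<in> carrier Q" "tail j (\<mu> (\<phi> (xg j))) = \<mu> h" by (rule CA_repr)
  then show "tail j (\<mu> (\<phi> (xg j))) - 1 \<in> ordge 1" by (simp add: mu_ordge_1 del: One_nat_def)
qed

lemma fil_mono: "fil k \<phi> \<Longrightarrow> l \<le> k \<Longrightarrow> fil l \<phi>"
  unfolding fil_def using ordge_mono by blast

lemma lead_TD:
  assumes p: "\<phi> \<in> carrier CA" and k: "1 \<le> k" and l: "fil k \<phi>"
  shows "lead k \<phi> \<in> TD n"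
  unfolding lead_def
proof (rule TD_sumI)
  fix j assume j: "j < n"
  obtain h where h: "h \<in> carrier Q" "tail j (\<mu> (\<phi> (xg j))) = \<mu> h"
    using CA_repr[OF p j] by metis
  show "part k (tail j (\<mu> (\<phi> (xg j)))) \<in> Lie n"
    unfolding h(2) by (rule lead_Lie[OF h(1) k]) (use l j h(2) in \<open>metis fil_def\<close>)
qed

lemma part_lead: "part l (lead k \<phi>) = (if l = Suc k then lead k \<phi> else 0)"
proof (rule part_hmg)
  show "lead k \<phi> \<in> hmg (Suc k)"
    unfolding lead_def by (rule hmg_sum) (use hmg_mult[OF hmg_part hmg_mgen] in fastforce)
qed

lemma tail_lead_hmg: "tail i (lead k \<phi>) \<in> hmg k"
  using hmg_tail[of "lead k \<phi>" k i] part_lead[of "Suc k" k \<phi>] hmg_part[of "Suc k" "lead k \<phi>"] by simp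

lemma part_1: "1 \<le> k \<Longrightarrow> part k 1 = 0"
  by (rule rmag_eqI) (auto simp: coef_part coef_1)

text \<open>The conjugate of y by a unit a with inverse b is y plus the bracket of a - 1 and y,
  times b. Replacing a - 1 by its leading part and b by 1 changes this only in order k + 2.\<close>

lemma img_lead:
  assumes p: "\<phi> \<in> carrier CA" and k: "1 \<le> k" and l: "fil k \<phi>" and j: "j < n"
  shows "img \<phi> j - mgen j - comm (tail j (lead k \<phi>)) (mgen j) \<in> ordge (k + 2)"
proof -
  obtain h where h: "h \<in> carrier Q" "\<mu> (\<phi> (xg j)) = 1 + \<mu> h * mgen j * \<mu> (inv h)"
    "tail j (\<mu> (\<phi> (xg j))) = \<mu> h"
    using CA_repr[OF p j] by metis
  let ?a = "\<mu> h" and ?b = "\<mu> (inv h)" and ?y = "mgen j"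
  have a: "?a - 1 \<in> ordge k" using l j h(3) by (metis fil_def)
  have ab: "?a * ?b = 1" using mu_inv[OF h(1)] by simp
  have "?b - 1 = - (?a - 1) * ?b" using ab by (simp add: algebra_simps)
  then have b: "?b - 1 \<in> ordge k" using ordge_mult[OF ordge_minus[OF a] ordge_zero[of ?b]] by simp
  have c: "comm (?a - 1) ?y \<in> ordge (k + 1)" using comm_ordge[OF a ordge_mon[of "[j]"]] by simp
  have s: "tail j (lead k \<phi>) = part k (?a - 1)" using tail_lead[OF j] h(3) part_1[OF k] by simp
  have "?a - 1 - part k (?a - 1) \<in> ordge (Suc k)" by (rule diff_part_ordge[OF a])
  from comm_ordge[OF this ordge_mon[of "[j]"]]
  have 1: "comm (?a - 1 - part k (?a - 1)) ?y \<in> ordge (k + 2)" by simp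
  have 2: "comm (?a - 1) ?y * (?b - 1) \<in> ordge (k + 2)"
    by (rule ordge_mono[OF ordge_mult[OF c b]]) (use k in simp)
  have "img \<phi> j - ?y = ?a * ?y * ?b - ?y * (?a * ?b)" using h(2) j ab by (simp add: img_def)
  also have "\<dots> = comm (?a - 1) ?y * ?b" by (simp add: comm_def algebra_simps)
  finally have zy: "img \<phi> j - ?y = comm (?a - 1) ?y * ?b" .
  have "z - y - c = (d - c) + d * (b - 1)" if "z - y = d * b" for z y b c d :: rmag
    using that by (simp add: algebra_simps)
  from this[OF zy] have "img \<phi> j - ?y - comm (tail j (lead k \<phi>)) ?y
      = comm (?a - 1 - part k (?a - 1)) ?y + comm (?a - 1) ?y * (?b - 1)"
    unfolding s comm_diff(1)[of "?a - 1" "part k (?a - 1)"] .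
  then show ?thesis using ordge_add[OF 1 2] by simp
qed

lemma tail_lead_ordge: "tail i (lead k \<phi>) \<in> ordge k"
  by (rule hmg_ordge[OF tail_lead_hmg])

lemma E_lead:
  assumes "\<phi> \<in> carrier CA" "1 \<le> k" "fil k \<phi>" "f \<in> rsub {..<n}" "f \<in> ordge e"
  shows "E \<phi> f - f - delta n (lead k \<phi>) f \<in> ordge (e + k + 1)" "E \<phi> f - f \<in> ordge (e + k)"
  unfolding E_def
  using ext_lead[OF assms(2) img_lead[OF assms(1,2,3)] tail_lead_ordge assms(4,5)]
    ext_lead_weak[OF assms(2) img_lead[OF assms(1,2,3)] tail_lead_ordge assms(4,5)] by simp_all

lemma tail_mu_E: "j < n \<Longrightarrow> tail j (\<mu> (\<phi> (xg j))) = 1 + tail j (E \<phi> (mgen j) - mgen j)"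
  by (simp add: E_mgen tail_mon_single)

lemma levI: "(\<And>j. j < n \<Longrightarrow> E \<phi> (mgen j) - mgen j \<in> ordge (Suc k)) \<Longrightarrow> fil k \<phi>"
  unfolding fil_def by (metis tail_mu_E tail_ordge add_diff_cancel_left')

lemma lead_E:
  assumes "1 \<le> k"
  shows "lead k \<phi> = (\<Sum>j<n. tail j (part (Suc k) (E \<phi> (mgen j) - mgen j)) * mgen j)"
  unfolding lead_def
  by (rule sum.cong) (use assms in \<open>simp_all add: tail_mu_E part_1 flip: part_tail del: tail_diff part_diff\<close>)

lemma mgen_rsub: "j < n \<Longrightarrow> mgen j \<in> rsub {..<n}" by auto

lemma mgen_ordge: "mgen j \<in> ordge 1" using ordge_mon[of "[j]"] by simp

lemma E_comp:
  assumes "\<phi> \<in> carrier CA" "\<psi> \<in> carrier CA" "j < n" "\<theta> (xg j) = \<phi> (\<psi> (xg j))"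
  shows "E \<theta> (mgen j) = E \<phi> (E \<psi> (mgen j))"
proof -
  have "\<psi> (xg j) \<in> carrier Q" using assms(2,3) by (simp add: X_closed auto_closed[OF CA_auto])
  then show ?thesis using assms by (simp add: E_mgen E_mu)
qed

text \<open>The displacement of a composite is the sum of the two displacements plus
  \<open>E \<phi> ?u - ?u\<close>, which has order 2k + 1, at least k + 2.\<close>

lemma fil_mult:
  assumes p: "\<phi> \<in> carrier CA" "\<psi> \<in> carrier CA" and k: "1 \<le> k" and l: "fil k \<phi>" "fil k \<psi>"
  shows "fil k (\<phi> \<otimes>\<^bsub>CA\<^esub> \<psi>)" "lead k (\<phi> \<otimes>\<^bsub>CA\<^esub> \<psi>) = lead k \<phi> + lead k \<psi>"
proof -
  let ?t = "\<phi> \<otimes>\<^bsub>CA\<^esub> \<psi>"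
  have w: "E \<phi> (mgen j) - mgen j \<in> ordge (Suc k)" "E \<psi> (mgen j) - mgen j \<in> ordge (Suc k)" if "j < n" for j
    using E_lead(2)[OF p(1) k l(1) mgen_rsub[OF that] mgen_ordge]
      E_lead(2)[OF p(2) k l(2) mgen_rsub[OF that] mgen_ordge] by simp_all
  have e: "E ?t (mgen j) - mgen j - ((E \<phi> (mgen j) - mgen j) + (E \<psi> (mgen j) - mgen j)) \<in> ordge (k + 2)"
    if j: "j < n" for j
  proof -
    let ?u = "E \<psi> (mgen j) - mgen j"
    have u: "?u \<in> rsub {..<n}" using p j by (intro rsub_diff E_rsub mgen_rsub)
    have "E ?t (mgen j) = E \<phi> (E \<psi> (mgen j))"
      by (rule E_comp[OF p j]) (simp add: CA_mult p X_closed j)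
    then have "E ?t (mgen j) - mgen j - ((E \<phi> (mgen j) - mgen j) + ?u) = E \<phi> ?u - ?u" by simp
    also have "\<dots> \<in> ordge (Suc k + k)" by (rule E_lead(2)[OF p(1) k l(1) u w(2)[OF j]])
    finally show ?thesis by (rule ordge_mono) (use k in simp)
  qed
  have "E ?t (mgen j) - mgen j \<in> ordge (Suc k)" if "j < n" for j
    using ordge_add[OF ordge_mono[OF e[OF that], of "Suc k"] ordge_add[OF w[OF that]]] by simp
  then show "fil k ?t" by (rule levI)
  have "part (Suc k) (E ?t (mgen j) - mgen j)
      = part (Suc k) (E \<phi> (mgen j) - mgen j) + part (Suc k) (E \<psi> (mgen j) - mgen j)" if "j < n" for j
    using part_ordge_0[OF e[OF that], of "Suc k"] by simp
  then show "lead k ?t = lead k \<phi> + lead k \<psi>"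
    unfolding lead_E[OF k] sum.distrib[symmetric]
    by (intro sum.cong refl) (simp add: distrib_right[symmetric] del: part_diff tail_diff)
qed

text \<open>The displacement v under the inverse satisfies v = -
  (\<open>E \<phi> (mgen j) - mgen j\<close>) - (\<open>E \<phi> v - v\<close>). As v has positive
  order, both terms have order k + 1.\<close>

lemma fil_inv:
  assumes p: "\<phi> \<in> carrier CA" and k: "1 \<le> k" and l: "fil k \<phi>"
  shows "fil k (inv\<^bsub>CA\<^esub> \<phi>)"
proof (rule levI)
  interpret P: group CA by (rule CA_group)
  let ?i = "inv\<^bsub>CA\<^esub> \<phi>"
  fix j assume j: "j < n"
  have i: "?i \<in> carrier CA" using p by simp
  let ?v = "E ?i (mgen j) - mgen j"
  have "xg j = \<phi> (?i (xg j))"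
    using CA_mult[OF p i X_closed[OF j]] p CA_one[OF X_closed[OF j]] by simp
  moreover have "?i (xg j) \<in> carrier Q" using i X_closed[OF j] by (simp add: auto_closed[OF CA_auto])
  ultimately have "1 + mgen j = E \<phi> (1 + E ?i (mgen j))"
    using p i E_mgen[OF j] E_mu mu_X[OF j] by (metis add.commute diff_add_cancel)
  then have e: "?v = - (E \<phi> (mgen j) - mgen j) - (E \<phi> ?v - ?v)" by (simp add: algebra_simps)
  have vr: "?v \<in> rsub {..<n}" using i j by (intro rsub_diff E_rsub mgen_rsub)
  have v: "?v \<in> ordge 1"
    using E_lead(2)[OF i _ fil_1[OF i] mgen_rsub[OF j] mgen_ordge] by (auto elim: ordge_mono)
  have 1: "E \<phi> ?v - ?v \<in> ordge (1 + k)" by (rule E_lead(2)[OF p k l vr v])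
  have 2: "E \<phi> (mgen j) - mgen j \<in> ordge (1 + k)"
    by (rule E_lead(2)[OF p k l mgen_rsub[OF j] mgen_ordge])
  have "?v \<in> ordge (1 + k)"
    by (subst e) (rule ordge_diff[OF ordge_minus[OF 2] 1])
  then show "?v \<in> ordge (Suc k)" by simp
qed

text \<open>To avoid inverses, the commutator c is studied through c \<psi> \<phi> = \<phi> \<psi>:
  it moves \<open>u j\<close> by \<open>\<Delta> j\<close>, whose leading part is the commutator of
  the two derivations. Since \<open>u j\<close> agrees with \<open>y_j\<close> below order 2, the
  level of c can be raised step by step.\<close>

lemma fil_gcomm:
  assumes p: "\<phi> \<in> carrier CA" "\<psi> \<in> carrier CA" and k: "1 \<le> k" "1 \<le> l" and l: "fil k \<phi>" "fil l \<psi>"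
  shows "fil (k + l) (gcomm CA \<phi> \<psi>)" "lead (k + l) (gcomm CA \<phi> \<psi>) = brD n (lead k \<phi>) (lead l \<psi>)"
proof -
  interpret P: group CA by (rule CA_group)
  let ?c = "gcomm CA \<phi> \<psi>" and ?d = "lead k \<phi>" and ?e = "lead l \<psi>"
  have c: "?c \<in> carrier CA" using p by (simp add: gcomm_def)
  have cc: "?c \<otimes>\<^bsub>CA\<^esub> (\<psi> \<otimes>\<^bsub>CA\<^esub> \<phi>) = \<phi> \<otimes>\<^bsub>CA\<^esub> \<psi>"
    using p by (simp add: gcomm_def P.m_assoc) (simp add: P.m_assoc[symmetric])
  define u where "u j = E \<psi> (E \<phi> (mgen j))" for j
  define \<Delta> where "\<Delta> j = E \<phi> (E \<psi> (mgen j)) - E \<psi> (E \<phi> (mgen j))" for j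
  define B where "B j = delta n ?d (delta n ?e (mgen j)) - delta n ?e (delta n ?d (mgen j))" for j
  have E\<Delta>: "E ?c (u j) - u j = \<Delta> j" if j: "j < n" for j
  proof -
    have m: "\<psi> \<otimes>\<^bsub>CA\<^esub> \<phi> \<in> carrier CA" "\<phi> \<otimes>\<^bsub>CA\<^esub> \<psi> \<in> carrier CA" using p by simp_all
    have "(\<phi> \<otimes>\<^bsub>CA\<^esub> \<psi>) (xg j) = ?c ((\<psi> \<otimes>\<^bsub>CA\<^esub> \<phi>) (xg j))"
      using CA_mult[OF c m(1) X_closed[OF j]] cc by simp
    then have "E (\<phi> \<otimes>\<^bsub>CA\<^esub> \<psi>) (mgen j) = E ?c (E (\<psi> \<otimes>\<^bsub>CA\<^esub> \<phi>) (mgen j))"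
      by (rule E_comp[OF c m(1) j])
    moreover have "E (\<phi> \<otimes>\<^bsub>CA\<^esub> \<psi>) (mgen j) = E \<phi> (E \<psi> (mgen j))"
      "E (\<psi> \<otimes>\<^bsub>CA\<^esub> \<phi>) (mgen j) = E \<psi> (E \<phi> (mgen j))"
      by (auto intro!: E_comp simp: CA_mult p X_closed j)
    ultimately show ?thesis by (simp add: u_def \<Delta>_def)
  qed
  \<comment> \<open>Composing two displacements gives the composite of two derivations to leading
    order. Stated for arbitrary automorphisms because it is applied with both orders of \<phi> and
    \<psi>.\<close>
  have half: "(E \<phi>' (E \<psi>' (mgen j) - mgen j) - (E \<psi>' (mgen j) - mgen j))
      - delta n (lead k' \<phi>') (delta n (lead l' \<psi>') (mgen j)) \<in> ordge (k' + l' + 2)"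
    if p': "\<phi>' \<in> carrier CA" "\<psi>' \<in> carrier CA" and k': "1 \<le> k'" "1 \<le> l'"
      and l': "fil k' \<phi>'" "fil l' \<psi>'" and j: "j < n" for \<phi>' \<psi>' k' l' j
  proof -
    let ?s = "delta n (lead l' \<psi>') (mgen j)" and ?u = "E \<psi>' (mgen j) - mgen j"
    have sr: "?s \<in> rsub {..<n}" by (rule delta_rsub[OF TD_rsub[OF lead_TD[OF p'(2) k'(2) l'(2)]]])
    have ur: "?u \<in> rsub {..<n}" using p' j by (intro rsub_diff E_rsub mgen_rsub)
    have so: "?s \<in> ordge (1 + l')" by (rule delta_ordge[OF tail_lead_ordge mgen_ordge])
    have R: "?u - ?s \<in> ordge (1 + l' + 1)"
      by (rule E_lead(1)[OF p'(2) k'(2) l'(2) mgen_rsub[OF j] mgen_ordge])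
    have 1: "E \<phi>' (?u - ?s) - (?u - ?s) \<in> ordge (1 + l' + 1 + k')"
      by (rule E_lead(2)[OF p'(1) k'(1) l'(1) rsub_diff[OF ur sr] R])
    have 2: "E \<phi>' ?s - ?s - delta n (lead k' \<phi>') ?s \<in> ordge (1 + l' + k' + 1)"
      by (rule E_lead(1)[OF p'(1) k'(1) l'(1) sr so])
    have "(E \<phi>' ?u - ?u) - delta n (lead k' \<phi>') ?s
        = (E \<phi>' (?u - ?s) - (?u - ?s)) + (E \<phi>' ?s - ?s - delta n (lead k' \<phi>') ?s)" by simp
    also have "\<dots> \<in> ordge (k' + l' + 2)"
      using ordge_add[OF ordge_mono[OF 1, of "k' + l' + 2"] ordge_mono[OF 2, of "k' + l' + 2"]] by simp
    finally show ?thesis .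
  qed
  have \<Delta>B: "\<Delta> j - B j \<in> ordge (k + l + 2)" if j: "j < n" for j
  proof -
    have "\<Delta> j - B j = ((E \<phi> (E \<psi> (mgen j) - mgen j) - (E \<psi> (mgen j) - mgen j)) - delta n ?d (delta n ?e (mgen j)))
      - ((E \<psi> (E \<phi> (mgen j) - mgen j) - (E \<phi> (mgen j) - mgen j)) - delta n ?e (delta n ?d (mgen j)))"
      by (simp add: \<Delta>_def B_def algebra_simps)
    then show ?thesis
      using ordge_diff[OF half[OF p k l j] ordge_mono[OF half[OF p(2,1) k(2,1) l(2,1) j], of "k + l + 2"]]
      by simp
  qed
  have Bh: "B j \<in> hmg (k + l + 1)" for j
  proof -
    have "delta n ?d (delta n ?e (mgen j)) \<in> hmg ((1 + l) + k)"
      by (intro delta_hmg tail_lead_hmg hmg_mgen)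
    moreover have "delta n ?e (delta n ?d (mgen j)) \<in> hmg ((1 + k) + l)"
      by (intro delta_hmg tail_lead_hmg hmg_mgen)
    ultimately show ?thesis unfolding B_def by (intro hmg_diff) (simp_all add: add_ac)
  qed
  have \<Delta>o: "\<Delta> j \<in> ordge (k + l + 1)" if j: "j < n" for j
    using ordge_add[OF ordge_mono[OF \<Delta>B[OF j], of "k + l + 1"] hmg_ordge[OF Bh[of j]]] by simp
  have ur: "u j - mgen j \<in> rsub {..<n}" if "j < n" for j
    unfolding u_def using p that by (intro rsub_diff E_rsub mgen_rsub)
  have uo: "u j - mgen j \<in> ordge 2" if j: "j < n" for j
  proof -
    have r: "E \<phi> (mgen j) \<in> rsub {..<n}" using p by (intro E_rsub)
    have 1: "E \<phi> (mgen j) - mgen j \<in> ordge (1 + 1)"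
      by (rule E_lead(2)[OF p(1) _ fil_1[OF p(1)] mgen_rsub[OF j] mgen_ordge]) simp
    have "E \<phi> (mgen j) \<in> ordge 1"
      using ordge_add[OF ordge_mono[OF 1, of 1] mgen_ordge[of j]] by simp
    then have "E \<psi> (E \<phi> (mgen j)) - E \<phi> (mgen j) \<in> ordge (1 + 1)"
      by (rule E_lead(2)[OF p(2) _ fil_1[OF p(2)] r, rotated]) simp
    from ordge_add[OF this 1] show ?thesis by (simp add: u_def numeral_2_eq_2)
  qed
  \<comment> \<open>Level m alone bounds the displacement of \<open>y_j\<close> by c in order m + 1;
    comparison with \<open>\<Delta> j\<close> gains one order, because \<open>u j - y_j\<close> has
    order 2.\<close>
  have step: "E ?c (mgen j) - mgen j - \<Delta> j \<in> ordge (m + 2)" if m: "1 \<le> m" "fil m ?c" and j: "j < n" for m j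
  proof -
    have "E ?c (mgen j) - mgen j - \<Delta> j = - (E ?c (u j - mgen j) - (u j - mgen j))"
      using E\<Delta>[OF j] by (simp add: algebra_simps)
    also have "\<dots> \<in> ordge (2 + m)"
      by (rule ordge_minus[OF E_lead(2)[OF c m ur[OF j] uo[OF j]]])
    finally show ?thesis by (simp add: add.commute)
  qed
  \<comment> \<open>Bootstrapping from level 1: each round gains one, until the order k + l + 1 of
    \<open>\<Delta> j\<close> is reached.\<close>
  have lv: "fil (Suc m) ?c" if "m < k + l" for m
    using that
  proof (induction m)
    case 0
    then show ?case using fil_1[OF c] by simp
  next
    case (Suc m)
    show ?case
    proof (rule levI)
      fix j assume j: "j < n"
      have "E ?c (mgen j) - mgen j - \<Delta> j \<in> ordge (Suc (Suc (Suc m)))"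
        using step[of "Suc m" j] Suc j by simp
      moreover have "\<Delta> j \<in> ordge (Suc (Suc (Suc m)))" by (rule ordge_mono[OF \<Delta>o[OF j]]) (use Suc.prems in simp)
      ultimately show "E ?c (mgen j) - mgen j \<in> ordge (Suc (Suc (Suc m)))"
        using ordge_add by fastforce
    qed
  qed
  show lkl: "fil (k + l) ?c" using lv[of "k + l - 1"] k by simp
  have kl: "1 \<le> k + l" using k by simp
  show "lead (k + l) ?c = brD n ?d ?e"
    unfolding lead_E[OF kl] brD_def B_def[symmetric]
  proof (rule sum.cong[OF refl])
    fix j assume "j \<in> {..<n}"
    then have j: "j < n" by simp
    have "E ?c (mgen j) - mgen j - B j \<in> ordge (k + l + 2)"
      using ordge_add[OF step[OF kl lkl j] \<Delta>B[OF j]] by simp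
    then have "part (Suc (k + l)) (E ?c (mgen j) - mgen j) = part (Suc (k + l)) (B j)"
      using part_ordge_0[of "E ?c (mgen j) - mgen j - B j" "k + l + 2" "Suc (k + l)"] by simp
    also have "\<dots> = B j" using part_hmg[OF Bh[of j], of "Suc (k + l)"] by simp
    finally show "tail j (part (Suc (k + l)) (E ?c (mgen j) - mgen j)) * mgen j = tail j (B j) * mgen j"
      by simp
  qed
qed

lemma lead_eq_0_iff:
  assumes k: "1 \<le> k" and l: "fil k \<phi>"
  shows "lead k \<phi> = 0 \<longleftrightarrow> fil (Suc k) \<phi>"
proof
  assume q: "lead k \<phi> = 0"
  show "fil (Suc k) \<phi>"
    unfolding fil_def
  proof (intro allI impI)
    fix j assume j: "j < n"
    have "part k (tail j (\<mu> (\<phi> (xg j))) - 1) = 0" using tail_lead[OF j, of k \<phi>] q part_1[OF k] by simp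
    then show "tail j (\<mu> (\<phi> (xg j))) - 1 \<in> ordge (Suc k)"
      using l j by (intro part_eq_0_ordge) (auto simp: fil_def)
  qed
next
  assume l': "fil (Suc k) \<phi>"
  have "part k (tail j (\<mu> (\<phi> (xg j)))) = 0" if "j < n" for j
    using part_ordge_0[of "tail j (\<mu> (\<phi> (xg j))) - 1" "Suc k" k] l' that part_1[OF k]
    by (simp add: fil_def)
  then show "lead k \<phi> = 0" unfolding lead_def by (intro sum.neutral) simp
qed

text \<open>Conjugators whose image differs from 1 only in order above n have image 1, so the
  automorphism fixes the generators by injectivity of \<open>\<mu>\<close>.\<close>

lemma fil_top:
  assumes p: "\<phi> \<in> carrier CA" and l: "fil (Suc n) \<phi>"
  shows "\<phi> = \<one>\<^bsub>CA\<^esub>"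
proof (rule CA_eqI[OF p group.is_monoid[OF CA_group, THEN monoid.one_closed]])
  fix j assume j: "j < n"
  obtain h where h: "h \<in> carrier Q" "\<mu> (\<phi> (xg j)) = 1 + \<mu> h * mgen j * \<mu> (inv h)"
    "tail j (\<mu> (\<phi> (xg j))) = \<mu> h"
    using CA_repr[OF p j] by metis
  have "\<mu> h - 1 = 0"
  proof (rule ordge_vanish[of _ n "Suc n"])
    show "\<mu> h - 1 \<in> rsub {..<n}" using h by (intro rsub_diff mu_rsub_n) auto
    show "\<mu> h - 1 \<in> ordge (Suc n)" using l j h(3) by (auto simp: fil_def)
  qed simp
  then have "\<mu> h = 1" "\<mu> (inv h) = 1" using mu_inv(1)[OF h(1)] by auto
  then have "\<mu> (\<phi> (xg j)) = \<mu> (xg j)" using h(2) mu_X[OF j] by simp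
  then have "\<phi> (xg j) = xg j"
    using X_closed[OF j] by (intro mu_inj) (simp_all add: auto_closed[OF CA_auto[OF p]])
  then show "\<phi> (xg j) = \<one>\<^bsub>CA\<^esub> (xg j)" using CA_one[OF X_closed[OF j]] by simp
qed

lemma fil_subgroup: "1 \<le> k \<Longrightarrow> subgroup {\<phi> \<in> carrier CA. fil k \<phi>} CA"
proof -
  assume k: "1 \<le> k"
  interpret P: group CA by (rule CA_group)
  have "fil k \<one>\<^bsub>CA\<^esub>"
    by (simp add: fil_def CA_one X_closed mu_X tail_mon_single)
  then show ?thesis
    by (intro P.subgroupI) (auto simp: fil_mult(1)[OF _ _ k] fil_inv[OF _ k])
qed

lemma lcs_CA_carrier: "\<phi> \<in> lcs CA k \<Longrightarrow> \<phi> \<in> carrier CA"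
  by (rule group.lcs_closed[OF CA_group])

lemma lcs_fil: "\<phi> \<in> lcs CA k \<Longrightarrow> fil (Suc k) \<phi>"
proof (induction k arbitrary: \<phi>)
  case 0
  then show ?case using fil_1 by simp
next
  case (Suc k)
  interpret P: group CA by (rule CA_group)
  have "lcs CA (Suc k) \<subseteq> {\<phi> \<in> carrier CA. fil (Suc (Suc k)) \<phi>}"
    unfolding lcs.simps(2)
  proof (rule P.generate_subgroup_incl[OF _ fil_subgroup], clarify)
    fix x y assume x: "x \<in> carrier CA" and y: "y \<in> lcs CA k"
    have yc: "y \<in> carrier CA" using y by (rule lcs_CA_carrier)
    have "fil (1 + Suc k) (gcomm CA x y)"
      by (rule fil_gcomm(1)[OF x yc _ _ fil_1[OF x] Suc.IH[OF y]]) auto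
    then show "gcomm CA x y \<in> carrier CA \<and> fil (Suc (Suc k)) (gcomm CA x y)"
      using P.gcomm_in_carrier[OF x yc] by simp
  qed simp
  then show ?case using Suc.prems by blast
qed

subsection \<open>Surjectivity onto the tangential derivations\<close>

definition leads :: "nat \<Rightarrow> rmag set" where
  "leads k = lead (Suc k) ` lcs CA k"

lemma leads_add: "a \<in> leads k \<Longrightarrow> b \<in> leads k \<Longrightarrow> a + b \<in> leads k"
proof -
  assume "a \<in> leads k" "b \<in> leads k"
  then obtain \<phi> \<psi> where p: "\<phi> \<in> lcs CA k" "a = lead (Suc k) \<phi>" "\<psi> \<in> lcs CA k" "b = lead (Suc k) \<psi>"
    by (auto simp: leads_def)
  have "\<phi> \<otimes>\<^bsub>CA\<^esub> \<psi> \<in> lcs CA k"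
    by (rule subgroup.m_closed[OF group.lcs_subgroup[OF CA_group] p(1,3)])
  moreover have "lead (Suc k) (\<phi> \<otimes>\<^bsub>CA\<^esub> \<psi>) = a + b"
    unfolding p(2,4)
    by (rule fil_mult(2)) (use p lcs_CA_carrier lcs_fil in auto)
  ultimately show ?thesis unfolding leads_def by (metis image_eqI)
qed

lemma lead_one: "1 \<le> k \<Longrightarrow> lead k \<one>\<^bsub>CA\<^esub> = 0"
  unfolding lead_def
  by (rule sum.neutral) (auto simp: CA_one X_closed mu_X tail_mon_single part_1)

lemma leads_0: "0 \<in> leads k"
  unfolding leads_def
  by (rule image_eqI[of _ _ "\<one>\<^bsub>CA\<^esub>"])
    (simp_all add: lead_one subgroup.one_closed[OF group.lcs_subgroup[OF CA_group]] del: lcs.simps)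

lemma leads_minus: "a \<in> leads k \<Longrightarrow> - a \<in> leads k"
proof -
  assume "a \<in> leads k"
  then obtain \<phi> where p: "\<phi> \<in> lcs CA k" "a = lead (Suc k) \<phi>" by (auto simp: leads_def)
  interpret P: group CA by (rule CA_group)
  have c: "\<phi> \<in> carrier CA" and l: "fil (Suc k) \<phi>" using p lcs_CA_carrier lcs_fil by auto
  have "lead (Suc k) (\<phi> \<otimes>\<^bsub>CA\<^esub> inv\<^bsub>CA\<^esub> \<phi>) = lead (Suc k) \<phi> + lead (Suc k) (inv\<^bsub>CA\<^esub> \<phi>)"
    by (rule fil_mult(2)) (use c l fil_inv in auto)
  then have "lead (Suc k) (inv\<^bsub>CA\<^esub> \<phi>) = - a"
    using c p(2) by (simp add: lead_one eq_neg_iff_add_eq_0 add.commute)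
  then show ?thesis
    unfolding leads_def using subgroup.m_inv_closed[OF P.lcs_subgroup p(1)] by (metis image_eqI)
qed

lemma leads_sum: "(\<And>a. a \<in> A \<Longrightarrow> f a \<in> leads k) \<Longrightarrow> sum f A \<in> leads k"
  by (induction A rule: infinite_finite_induct) (auto intro: leads_0 leads_add)

text \<open>The witness conjugates \<open>x_i\<close> by \<open>x_p\<close> and fixes the other
  generators. The locale has no universal property from which to define it; it is pulled back along
  the injective \<open>\<mu>\<close> from a substitution \<open>Gm\<close> of the ring.\<close>

lemma ex_chi:
  assumes i: "i < n" and p: "p < n" and ip: "i \<noteq> p"
  shows "\<exists>\<chi>\<in>carrier CA. lead 1 \<chi> = mgen p * mgen i"
proof -
  define zc where "zc j = (if j = i then (1 + mgen p) * mgen i * (1 - mgen p) else mgen j)" for j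
  define Gm where "Gm = ext n zc"
  have zc_cont: "zc j \<in> cont j" for j
    unfolding zc_def by (auto intro: cont_mult_left cont_mult_right cont_mgen)
  have G_mult: "Gm (f * g) = Gm f * Gm g" for f g
    unfolding Gm_def by (rule ext_mult) (rule cont_mult_eq_0[OF cont_mult_right[OF zc_cont] zc_cont])
  have G_add: "Gm (f + g) = Gm f + Gm g" and G_diff: "Gm (f - g) = Gm f - Gm g" and G_1: "Gm 1 = 1" for f g
    by (simp_all add: Gm_def)
  have G_gen: "Gm (mgen j) = zc j" if "j < n" for j
    using that by (simp add: Gm_def ext_mgen)
  define hh where "hh j = (if j = i then xg p \<otimes> xg i \<otimes> inv (xg p) else xg j)" for j
  have hh: "hh j \<in> carrier Q" "\<mu> (hh j) = Gm (\<mu> (xg j))" if j: "j < n" for j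
  proof -
    show "hh j \<in> carrier Q" using i p j X_closed by (simp add: hh_def)
    have "(1 + mgen p) * (1 - mgen p) = 1" by (simp add: algebra_simps mgen_sq)
    then have "(1 + mgen p) * (1 + mgen i) * (1 - mgen p) = 1 + (1 + mgen p) * mgen i * (1 - mgen p)"
      by (simp add: distrib_left distrib_right)
    then show "\<mu> (hh j) = Gm (\<mu> (xg j))"
      using i p j by (simp add: hh_def X_closed mu_mult mu_X mu_inv_X G_add G_1 G_gen zc_def)
  qed
  \<comment> \<open>The substitution preserves the image of \<open>\<mu>\<close>; with injectivity,
    the choice in the definition of \<chi> is unique and multiplicative.\<close>
  have ex: "\<exists>h. h \<in> carrier Q \<and> \<mu> h = Gm (\<mu> g)" if "g \<in> carrier Q" for g
    using that unfolding gen[symmetric]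
  proof (induction rule: generate.induct)
    case one
    then show ?case by (intro exI[of _ \<one>]) (simp add: gen mu_one G_1)
  next
    case (incl g)
    then show ?case using hh gen by auto
  next
    case (inv g)
    then obtain j where j: "g = xg j" "j < n" by auto
    have "\<mu> (inv (hh j)) = Gm (\<mu> (inv (xg j)))"
    proof (rule mu_inv_eqI[OF hh(1)[OF j(2)]])
      show "\<mu> (hh j) * Gm (\<mu> (inv (xg j))) = 1"
        using hh(2)[OF j(2)] mu_inv(1)[OF X_closed[OF j(2)]] by (simp add: G_1 flip: G_mult)
    qed
    then show ?case using j hh gen by (intro exI[of _ "inv (hh j)"]) auto
  next
    case (eng g1 g2)
    then obtain h1 h2 where "h1 \<in> carrier Q" "\<mu> h1 = Gm (\<mu> g1)" "h2 \<in> carrier Q" "\<mu> h2 = Gm (\<mu> g2)"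
      using gen by auto
    then show ?case using eng gen by (intro exI[of _ "h1 \<otimes> h2"]) (simp add: mu_mult G_mult)
  qed
  define \<chi> where "\<chi> = (\<lambda>g\<in>carrier Q. SOME h. h \<in> carrier Q \<and> \<mu> h = Gm (\<mu> g))"
  have chi: "\<chi> g \<in> carrier Q" "\<mu> (\<chi> g) = Gm (\<mu> g)" if "g \<in> carrier Q" for g
    using someI_ex[OF ex[OF that]] that by (simp_all add: \<chi>_def)
  have hom: "\<chi> \<in> hom Q Q"
    by (rule homI) (auto simp: chi mu_mult G_mult intro!: mu_inj)
  have tz: "tail j (mgen p * mgen i) = (if j = i then mgen p else 0)" for j
    using ip by (simp add: tail_mult_mgen kill_mon)
  have tail_zc: "zc j - mgen j - comm (tail j (mgen p * mgen i)) (mgen j) \<in> ordge (1 + 2)" for j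
  proof (cases "j = i")
    case True
    have "zc i - mgen i - comm (mgen p) (mgen i) = - (mgen p * mgen i * mgen p)"
      by (simp add: zc_def comm_def algebra_simps)
    then show ?thesis unfolding tz using True by (simp add: mon_mult)
  next
    case False
    then show ?thesis by (simp add: tz zc_def)
  qed
  \<comment> \<open>\<open>Gm\<close> is the identity up to higher order, so an element of its
    kernel has arbitrarily large order.\<close>
  have inj0: "f = 0" if f: "f \<in> rsub {..<n}" and G0: "Gm f = 0" for f
  proof -
    have "f \<in> ordge e" for e
    proof (induction e)
      case (Suc e)
      have "ext n zc f - f \<in> ordge (e + 1)"
      proof (rule ext_lead_weak[where d = "mgen p * mgen i"])
        show "tail j (mgen p * mgen i) \<in> ordge 1" for j
          using mgen_ordge[of p] by (simp add: tz)
      qed (use f Suc tail_zc in auto)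
      then show ?case using G0 ordge_minus[of "- f"] by (simp add: Gm_def)
    qed simp
    then show ?thesis using ordge_vanish[OF f, of "Suc n"] by simp
  qed
  have inj: "inj_on \<chi> (carrier Q)"
  proof (rule inj_onI)
    fix g h assume gh: "g \<in> carrier Q" "h \<in> carrier Q" "\<chi> g = \<chi> h"
    then have "Gm (\<mu> g - \<mu> h) = 0" using chi(2)[of g] chi(2)[of h] by (simp add: G_diff)
    moreover have "\<mu> g - \<mu> h \<in> rsub {..<n}" using gh by (intro rsub_diff mu_rsub_n)
    ultimately have "\<mu> g - \<mu> h = 0" by (metis inj0)
    then show "g = h" using gh by (intro mu_inj) auto
  qed
  have chi_X: "\<chi> (xg j) = hh j" if "j < n" for j
    using that chi[OF X_closed[OF that]] hh by (intro mu_inj) auto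
  interpret H: group_hom Q Q \<chi> by unfold_locales (rule hom)
  have img: "subgroup (\<chi> ` carrier Q) Q" by (rule H.img_is_subgroup)
  have xp: "xg j \<in> \<chi> ` carrier Q" if "j < n" "j \<noteq> i" for j
    using chi_X[of j] that X_closed by (metis hh_def image_eqI)
  have "xg i \<in> \<chi> ` carrier Q"
  proof -
    have "hh i \<in> \<chi> ` carrier Q" using chi_X[OF i] X_closed[OF i] by (metis image_eqI)
    then have "inv (xg p) \<otimes> hh i \<otimes> xg p \<in> \<chi> ` carrier Q"
      using xp[of p] p ip by (intro subgroup.m_closed[OF img] subgroup.m_inv_closed[OF img]) auto
    moreover have "inv (xg p) \<otimes> hh i \<otimes> xg p = xg i"
      using i p X_closed by (simp add: hh_def m_assoc) (simp add: m_assoc[symmetric])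
    ultimately show ?thesis by simp
  qed
  then have "xg ` {..<n} \<subseteq> \<chi> ` carrier Q" using xp by auto
  then have "carrier Q \<subseteq> \<chi> ` carrier Q"
    using generate_subgroup_incl[OF _ img, of "xg ` {..<n}"] gen by simp
  then have surj: "\<chi> ` carrier Q = carrier Q" using chi by auto
  have aut: "\<chi> \<in> auto Q"
    using hom inj surj by (auto simp: auto_def Bij_def bij_betw_def \<chi>_def)
  have "\<exists>g\<in>carrier Q. \<chi> (xg j) = g \<otimes> xg j \<otimes> inv g" if j: "j < n" for j
  proof (cases "j = i")
    case True
    then show ?thesis using chi_X[OF j] p X_closed by (auto simp: hh_def)
  next
    case False
    then show ?thesis using chi_X[OF j] X_closed[OF j] by (intro bexI[of _ \<one>]) (auto simp: hh_def)
  qed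
  then have CA: "\<chi> \<in> carrier CA" using aut by (simp add: CA_def)
  have t: "part 1 (tail j (\<mu> (\<chi> (xg j)))) = (if j = i then mgen p else 0)" if j: "j < n" for j
  proof -
    have m: "\<mu> (\<chi> (xg j)) = 1 + zc j"
      using chi(2)[OF X_closed[OF j]] j by (simp add: mu_X G_add G_1 G_gen)
    have "tail i (zc i) = 1 + mgen p"
      using ip by (simp add: zc_def tail_mult[of i "(1 + mgen p) * mgen i"] tail_mult_mgen kill_mon
          tail_mon_single coef_1 coef_mon)
    moreover have "part 1 (mgen p) = mgen p" by (subst part_hmg[OF hmg_mgen]) simp
    moreover have "tail j (zc j) = 1" if "j \<noteq> i" using that by (simp add: zc_def tail_mon_single)
    ultimately show ?thesis unfolding m by (simp add: part_1)
  qed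
  have "lead 1 \<chi> = (\<Sum>j<n. if j = i then mgen p * mgen i else 0)"
    unfolding lead_def by (rule sum.cong) (use t in auto)
  then have "lead 1 \<chi> = mgen p * mgen i" using i by simp
  then show ?thesis using CA by blast
qed

text \<open>Bracketing with the derivation of \<open>ex_chi\<close> prefixes the letter p up to
  sign, while the group commutator goes one step down the lower central series.\<close>

lemma rn_br_leads:
  assumes i: "i < n"
  shows "set w \<subseteq> {..<n} \<Longrightarrow> distinct (w @ [i]) \<Longrightarrow> length w = Suc k \<Longrightarrow> rn_br w * mgen i \<in> leads k"
proof (induction w arbitrary: k)
  case (Cons p w)
  then obtain \<chi> where chi: "\<chi> \<in> carrier CA" "lead 1 \<chi> = mgen p * mgen i"
    using ex_chi[OF i, of p] by auto
  show ?case
  proof (cases "w = []")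
    case True
    then show ?thesis
      using chi Cons.prems unfolding leads_def by (intro image_eqI[of _ _ \<chi>]) auto
  next
    case False
    then obtain l where l: "length w = Suc l" by (cases w) auto
    have k: "k = Suc l" using Cons.prems l by simp
    obtain \<psi> where psi: "\<psi> \<in> lcs CA l" "lead (Suc l) \<psi> = rn_br w * mgen i"
      using Cons.IH[of l] Cons.prems l by (auto simp: leads_def)
    have c: "gcomm CA \<chi> \<psi> \<in> lcs CA k"
      unfolding k by (rule group.lcs_gcomm[OF CA_group chi(1) psi(1)])
    have "lead (1 + Suc l) (gcomm CA \<chi> \<psi>) = brD n (lead 1 \<chi>) (lead (Suc l) \<psi>)"
      by (rule fil_gcomm(2)[OF chi(1) lcs_CA_carrier[OF psi(1)] _ _ fil_1[OF chi(1)] lcs_fil[OF psi(1)]]) auto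
    also have "\<dots> = comm (rn_br w) (mgen p) * mgen i"
      unfolding chi(2) psi(2)
      by (rule brD_single[OF i])
        (use Cons.prems in \<open>auto intro: Lie.gen rn_br_Lie rsub_mgen rn_br_rsub\<close>)
    also have "\<dots> = - (rn_br (p # w) * mgen i)"
      using False by (simp add: rn_br_Cons comm_swap[of "rn_br w"])
    finally have "- (rn_br (p # w) * mgen i) \<in> leads k"
      using c k unfolding leads_def by (metis image_eqI plus_1_eq_Suc)
    then show ?thesis using leads_minus by fastforce
  qed
qed simp

lemma TD_leads:
  assumes "d \<in> TD n"
  shows "part (k + 2) d \<in> leads k"
proof -
  have "part (Suc (Suc k)) d = (\<Sum>i<n. part (Suc k) (tail i d) * mgen i)"
    using arg_cong[OF tail_decomp[OF TD_rsub[OF assms] TD_Nil[OF assms]], of "part (Suc (Suc k))"]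
    by (simp add: part_sum part_mult_mgen)
  also have "\<dots> \<in> leads k"
  proof (rule leads_sum)
    fix i assume "i \<in> {..<n}"
    then have i: "i < n" by simp
    \<comment> \<open>A tail has no \<open>y_i\<close>, so \<open>kill i\<close> loses nothing, and
      it discards the spanning brackets to which \<open>rn_br_leads\<close> does not apply.\<close>
    let ?Y = "{x. part (Suc k) (kill i x) * mgen i \<in> leads k}"
    have "tail i d \<in> ?Y"
    proof (rule Lie_span[OF _ _ _ _ TD_tail[OF assms i]])
      fix w assume w: "w \<in> dwords n" "w \<noteq> []"
      show "rn_br w \<in> ?Y"
        using rn_br_leads[OF i, of w k] w by (auto simp: kill_rn_br part_rn_br dwords_def leads_0)
    qed (auto simp: leads_0 leads_minus distrib_right intro: leads_add)
    then show "part (Suc k) (tail i d) * mgen i \<in> leads k" by simp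
  qed
  finally show ?thesis by simp
qed

text \<open>Descending induction on k: an element of the series with the same leading term is
  divided out, and the quotient lies one step deeper. Beyond depth n only the identity is
  left.\<close>

lemma fil_lcs: "\<phi> \<in> carrier CA \<Longrightarrow> fil (Suc k) \<phi> \<Longrightarrow> \<phi> \<in> lcs CA k"
proof (induction "n - k" arbitrary: k \<phi>)
  case 0
  then have "fil (Suc n) \<phi>" by (auto intro: fil_mono)
  then have "\<phi> = \<one>\<^bsub>CA\<^esub>" using 0 fil_top by blast
  then show ?case using subgroup.one_closed[OF group.lcs_subgroup[OF CA_group]] by blast
next
  case (Suc m)
  interpret P: group CA by (rule CA_group)
  have "lead (Suc k) \<phi> = part (k + 2) (lead (Suc k) \<phi>)" by (simp add: part_lead)
  also have "\<dots> \<in> leads k" using Suc by (intro TD_leads lead_TD) auto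
  finally obtain \<psi> where psi: "\<psi> \<in> lcs CA k" "lead (Suc k) \<psi> = lead (Suc k) \<phi>" by (auto simp: leads_def)
  have psc: "\<psi> \<in> carrier CA" "fil (Suc k) \<psi>" using psi lcs_CA_carrier lcs_fil by auto
  have il: "fil (Suc k) (inv\<^bsub>CA\<^esub> \<psi>)" using psc fil_inv by simp
  let ?t = "\<phi> \<otimes>\<^bsub>CA\<^esub> inv\<^bsub>CA\<^esub> \<psi>"
  have t: "?t \<in> carrier CA" "fil (Suc k) ?t" using Suc psc il fil_mult(1) by auto
  have e: "\<phi> = ?t \<otimes>\<^bsub>CA\<^esub> \<psi>" using Suc.prems psc by (simp add: P.m_assoc)
  have "lead (Suc k) (?t \<otimes>\<^bsub>CA\<^esub> \<psi>) = lead (Suc k) ?t + lead (Suc k) \<psi>"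
    by (rule fil_mult(2)) (use t psc in auto)
  then have "lead (Suc k) ?t = 0" using e psi(2) by simp
  then have "fil (Suc (Suc k)) ?t" using lead_eq_0_iff[of "Suc k" ?t] t by simp
  then have "?t \<in> lcs CA (Suc k)" using Suc.hyps(1)[of "Suc k" ?t] Suc.hyps(2) t by simp
  then have "?t \<in> lcs CA k" using P.lcs_Suc by blast
  then show ?case using subgroup.m_closed[OF P.lcs_subgroup _ psi(1)] e by metis
qed

lemma lcs_CA_iff: "\<phi> \<in> lcs CA k \<longleftrightarrow> \<phi> \<in> carrier CA \<and> fil (Suc k) \<phi>"
  using fil_lcs lcs_fil lcs_CA_carrier by blast

text \<open>Components are Lie elements without constant term, so encodings start in length 2. This
  accounts for the shift by two in \<open>D_sum\<close>.\<close>

lemma TD_part_1: "d \<in> TD n \<Longrightarrow> part 0 d = 0" "d \<in> TD n \<Longrightarrow> part (Suc 0) d = 0"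
proof -
  assume d: "d \<in> TD n"
  show "part 0 d = 0" by (rule rmag_eqI) (simp add: coef_part TD_Nil[OF d])
  show "part (Suc 0) d = 0"
  proof (rule rmag_eqI)
    fix w :: "nat list"
    have "coef (tail j d) [] = 0" for j
      using tail_rsub_ge[OF TD_rsub[OF d], of j] TD_tail[OF d, of j] Lie_coef_Nil by (cases "j < n") auto
    then show "coef (part (Suc 0) d) w = coef 0 w"
      by (auto simp: coef_part coef_tail length_Suc_conv)
  qed
qed

lemma lie_graded_CA: "lie_graded CA (\<lambda>k. lead (Suc k)) (brD n) (TD n) n"
proof -
  interpret P: group CA by (rule CA_group)
  show ?thesis
  proof unfold_locales
    fix x y k assume "x \<in> lcs CA k" "y \<in> lcs CA k"
    then show "lead (Suc k) (x \<otimes>\<^bsub>CA\<^esub> y) = lead (Suc k) x + lead (Suc k) y"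
      by (intro fil_mult(2)) (auto simp: lcs_CA_iff)
  next
    fix x k assume "x \<in> lcs CA k"
    then show "lead (Suc k) x = 0 \<longleftrightarrow> x \<in> lcs CA (Suc k)"
      using lead_eq_0_iff[of "Suc k" x] by (simp add: lcs_CA_iff del: lcs.simps)
  next
    fix x y i j assume xy: "x \<in> lcs CA i" "y \<in> lcs CA j"
    have e: "Suc i + Suc j = Suc (i + j + 1)" by simp
    have l: "fil (Suc i + Suc j) (gcomm CA x y)"
      "lead (Suc i + Suc j) (gcomm CA x y) = brD n (lead (Suc i) x) (lead (Suc j) y)"
      by (rule fil_gcomm; use xy in \<open>simp add: lcs_CA_iff\<close>)+
    show "gcomm CA x y \<in> lcs CA (i + j + 1)"
      using l(1) xy P.gcomm_in_carrier unfolding e by (simp add: lcs_CA_iff del: lcs.simps)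
    show "lead (Suc (i + j + 1)) (gcomm CA x y) = brD n (lead (Suc i) x) (lead (Suc j) y)"
      using l(2) unfolding e .
  next
    fix k assume "n \<le> k"
    then have "lcs CA k \<subseteq> {\<one>\<^bsub>CA\<^esub>}"
      using fil_top fil_mono[of "Suc k" _ "Suc n"] by (auto simp: lcs_CA_iff)
    then show "lcs CA k = {\<one>\<^bsub>CA\<^esub>}"
      using subgroup.one_closed[OF P.lcs_subgroup[of k]] by blast
  next
    fix x k assume "x \<in> lcs CA k"
    then show "lead (Suc k) x \<in> TD n" by (intro lead_TD) (auto simp: lcs_CA_iff)
  next
    fix d k assume "d \<in> TD n"
    then show "\<exists>x\<in>lcs CA k. lead (Suc k) x = part (k + 2) d"
      using TD_leads[of d k] by (auto simp: leads_def)
  next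
    fix d assume d: "d \<in> TD n"
    have "(\<Sum>k<Suc (Suc n). part k d) = d" by (rule sum_parts[OF TD_rsub[OF d]]) simp
    then show "d = (\<Sum>k<n. part (k + 2) d)"
      using TD_part_1[OF d] by (simp add: sum.lessThan_Suc_shift del: sum.lessThan_Suc)
  qed (auto simp: part_lead brD_add_left brD_add_right TD_add)
qed

theorem LieG_CA_rep: "\<exists>F. lie_rep (LieG CA) F (brD n) (TD n)"
  using lie_graded.LieG_rep[OF lie_graded_CA] by blast

end

section \<open>Normal forms in free groups and the Magnus map on the reduced quotient\<close>

section \<open>The free group and its reduced quotient\<close>

definition linv :: "nat \<times> bool \<Rightarrow> nat \<times> bool" where
  "linv x = (fst x, \<not> snd x)"

lemma linv_linv [simp]: "linv (linv x) = x"
  by (simp add: linv_def)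

lemma fst_linv [simp]: "fst (linv x) = fst x"
  by (simp add: linv_def)

fun red :: "fword \<Rightarrow> bool" where
  "red [] = True"
| "red [x] = True"
| "red (x # y # w) = (y \<noteq> linv x \<and> red (y # w))"

lemma red_tl: "red (x # w) \<Longrightarrow> red w"
  by (cases w) auto

lemma fg_step_simps:
  "fg_step x [] = [x]" "fg_step x (y # w) = (if y = linv x then w else x # y # w)"
  by (simp_all add: fg_step_def linv_def)

lemma red_fg_step: "red w \<Longrightarrow> red (fg_step x w)"
  by (cases w) (auto simp: fg_step_simps dest: red_tl)

lemma red_foldr: "red w \<Longrightarrow> red (foldr fg_step u w)"
  by (induction u) (auto simp: red_fg_step)

lemma red_fg_reduce: "red (fg_reduce w)"
  unfolding fg_reduce_def by (rule red_foldr) simp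

lemma fg_step_red: "red (x # w) \<Longrightarrow> fg_step x w = x # w"
  by (cases w) (auto simp: fg_step_simps)

lemma fg_reduce_red: "red w \<Longrightarrow> fg_reduce w = w"
proof (induction w)
  case (Cons x w)
  then have "fg_reduce w = w" using red_tl by blast
  then show ?case using fg_step_red[OF Cons.prems] by (simp add: fg_reduce_def)
qed (simp add: fg_reduce_def)

lemma fg_reduce_iff: "fg_reduce w = w \<longleftrightarrow> red w"
  using fg_reduce_red red_fg_reduce by metis

lemma fg_step_cancel: "red w \<Longrightarrow> fg_step (linv x) (fg_step x w) = w"
proof (cases w)
  case (Cons y v)
  assume r: "red w"
  show ?thesis
  proof (cases "y = linv x")
    case True
    then show ?thesis using Cons r by (cases v) (auto simp: fg_step_simps)
  qed (simp add: Cons fg_step_simps)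
qed (simp add: fg_step_simps)

text \<open>Letters act on reduced words, and inverse letters by inverse maps, so a cancellation
  inside u does not change its action. Associativity of the free group rests on this.\<close>

lemma foldr_fg_step: "red w \<Longrightarrow> foldr fg_step (fg_step x u) w = fg_step x (foldr fg_step u w)"
proof (cases u)
  case (Cons y v)
  assume "red w"
  then have "fg_step x (fg_step (linv x) (foldr fg_step v w)) = foldr fg_step v w"
    using fg_step_cancel[OF red_foldr, of w "linv x" v] by simp
  then show ?thesis using Cons by (simp add: fg_step_simps)
qed (simp add: fg_step_simps)

lemma foldr_fg_reduce: "red w \<Longrightarrow> foldr fg_step (fg_reduce u) w = foldr fg_step u w"
  by (induction u) (simp_all add: fg_reduce_def foldr_fg_step)

lemma fg_reduce_append: "fg_reduce (u @ v) = foldr fg_step u (fg_reduce v)"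
  by (simp add: fg_reduce_def)

lemma set_fg_reduce: "set (fg_reduce w) \<subseteq> set w"
proof -
  have step: "set (fg_step x v) \<subseteq> insert x (set v)" for x v
    by (cases v) (auto simp: fg_step_simps)
  show ?thesis
  proof (induction w)
    case (Cons x w)
    have "fg_reduce (x # w) = fg_step x (fg_reduce w)" by (simp add: fg_reduce_def)
    then have "set (fg_reduce (x # w)) \<subseteq> insert x (set (fg_reduce w))"
      by (simp only: step)
    then show ?case using Cons.IH by auto
  qed (simp add: fg_reduce_def)
qed

lemma foldr_inverse: "red v \<Longrightarrow> foldr fg_step (rev (map linv w)) (foldr fg_step w v) = v"
  by (induction w) (simp_all add: fg_step_cancel red_foldr)

lemma free_grp_carrier: "w \<in> carrier (free_grp n) \<longleftrightarrow> (\<forall>x\<in>set w. fst x < n) \<and> red w"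
  by (simp add: free_grp_def fg_reduce_iff)

lemma free_grp_mult: "v \<otimes>\<^bsub>free_grp n\<^esub> w = fg_reduce (v @ w)"
  and free_grp_one: "\<one>\<^bsub>free_grp n\<^esub> = []"
  by (simp_all add: free_grp_def)

lemma free_grp_group: "group (free_grp n)"
proof (rule groupI)
  fix u v assume "u \<in> carrier (free_grp n)" "v \<in> carrier (free_grp n)"
  then show "u \<otimes>\<^bsub>free_grp n\<^esub> v \<in> carrier (free_grp n)"
    using set_fg_reduce[of "u @ v"] by (auto simp: free_grp_carrier free_grp_mult red_fg_reduce)
next
  fix u v w
  have "fg_reduce (fg_reduce (u @ v) @ w) = foldr fg_step (u @ v) (fg_reduce w)"
    by (simp only: fg_reduce_append[of "fg_reduce (u @ v)" w] foldr_fg_reduce[OF red_fg_reduce])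
  moreover have "fg_reduce (u @ fg_reduce (v @ w)) = foldr fg_step u (foldr fg_step v (fg_reduce w))"
    by (subst fg_reduce_append, subst fg_reduce_red[OF red_fg_reduce], subst fg_reduce_append, rule refl)
  ultimately show "u \<otimes>\<^bsub>free_grp n\<^esub> v \<otimes>\<^bsub>free_grp n\<^esub> w = u \<otimes>\<^bsub>free_grp n\<^esub> (v \<otimes>\<^bsub>free_grp n\<^esub> w)"
    by (simp add: free_grp_mult)
next
  fix w assume w: "w \<in> carrier (free_grp n)"
  let ?i = "fg_reduce (rev (map linv w))"
  have "?i \<in> carrier (free_grp n)"
    using w set_fg_reduce[of "rev (map linv w)"] by (fastforce simp: free_grp_carrier red_fg_reduce)
  moreover have "?i \<otimes>\<^bsub>free_grp n\<^esub> w = \<one>\<^bsub>free_grp n\<^esub>"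
    unfolding free_grp_mult free_grp_one fg_reduce_append foldr_fg_reduce[OF red_fg_reduce]
    using foldr_inverse[of "[]" w] by (simp add: fg_reduce_def)
  ultimately show "\<exists>y\<in>carrier (free_grp n). y \<otimes>\<^bsub>free_grp n\<^esub> w = \<one>\<^bsub>free_grp n\<^esub>" by blast
qed (auto simp: free_grp_carrier free_grp_mult free_grp_one fg_reduce_red)

lemma fgen_closed: "i < n \<Longrightarrow> fgen i \<in> carrier (free_grp n)"
  by (simp add: fgen_def free_grp_carrier)

lemma inv_fgen: "i < n \<Longrightarrow> inv\<^bsub>free_grp n\<^esub> (fgen i) = [(i, False)]"
  by (rule group.inv_equality[OF free_grp_group])
    (simp_all add: fgen_def free_grp_carrier free_grp_mult free_grp_one fg_reduce_def fg_step_simps linv_def)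

lemma free_grp_generate: "generate (free_grp n) (fgen ` {..<n}) = carrier (free_grp n)"
proof (rule equalityI)
  interpret F: group "free_grp n" by (rule free_grp_group)
  show "generate (free_grp n) (fgen ` {..<n}) \<subseteq> carrier (free_grp n)"
    by (rule F.generate_incl) (auto simp: fgen_closed)
  show "carrier (free_grp n) \<subseteq> generate (free_grp n) (fgen ` {..<n})"
  proof
    fix w assume "w \<in> carrier (free_grp n)"
    then show "w \<in> generate (free_grp n) (fgen ` {..<n})"
    proof (induction w)
      case Nil
      then show ?case using generate.one[of "free_grp n"] by (simp add: free_grp_one)
    next
      case (Cons x w)
      then have w: "w \<in> generate (free_grp n) (fgen ` {..<n})" and r: "red (x # w)" and x: "fst x < n"
        using red_tl[of x w] by (simp_all add: free_grp_carrier)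
      have "[x] \<in> generate (free_grp n) (fgen ` {..<n})"
      proof (cases "snd x")
        case True
        then have "[x] = fgen (fst x)" by (cases x) (simp add: fgen_def)
        then show ?thesis using x by (auto intro: generate.incl)
      next
        case False
        then have "[x] = inv\<^bsub>free_grp n\<^esub> (fgen (fst x))" using x by (cases x) (simp add: inv_fgen)
        then show ?thesis using x by (auto intro: generate.inv)
      qed
      from generate.eng[OF this w] have "[x] \<otimes>\<^bsub>free_grp n\<^esub> w \<in> generate (free_grp n) (fgen ` {..<n})" .
      then show ?case using fg_reduce_red[OF r] by (simp add: free_grp_mult)
    qed
  qed
qed

definition mu_letter :: "nat \<times> bool \<Rightarrow> rmag" where
  "mu_letter x = (if snd x then 1 + mgen (fst x) else 1 - mgen (fst x))"

definition mu_word :: "fword \<Rightarrow> rmag" where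
  "mu_word w = prod_list (map mu_letter w)"

lemma mu_letter_linv: "mu_letter x * mu_letter (linv x) = 1"
  by (auto simp: mu_letter_def linv_def algebra_simps mon_mult)

lemma mu_word_fg_step: "mu_word (fg_step x w) = mu_letter x * mu_word w"
proof (cases w)
  case (Cons y v)
  have "mu_letter x * (mu_letter (linv x) * a) = a" for a
    by (simp add: mu_letter_linv mult.assoc[symmetric])
  then show ?thesis using Cons by (simp add: fg_step_simps mu_word_def)
qed (simp add: mu_word_def fg_step_simps)

lemma mu_word_fg_reduce: "mu_word (fg_reduce w) = mu_word w"
  by (induction w) (simp_all add: fg_reduce_def mu_word_fg_step, simp_all add: mu_word_def)

lemma mu_word_mult: "mu_word (v \<otimes>\<^bsub>free_grp n\<^esub> w) = mu_word v * mu_word w"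
  by (simp add: free_grp_mult mu_word_fg_reduce) (simp add: mu_word_def)

lemma mu_word_one: "mu_word (\<one>\<^bsub>free_grp n\<^esub>) = 1"
  by (simp add: free_grp_one mu_word_def)

lemma mu_word_inv: "g \<in> carrier (free_grp n) \<Longrightarrow> mu_word g * mu_word (inv\<^bsub>free_grp n\<^esub> g) = 1"
  "g \<in> carrier (free_grp n) \<Longrightarrow> mu_word (inv\<^bsub>free_grp n\<^esub> g) * mu_word g = 1"
  by (simp_all add: mu_word_one group.r_inv[OF free_grp_group] group.l_inv[OF free_grp_group] flip: mu_word_mult[where n = n])

lemma mu_word_gcomm:
  assumes "a \<in> carrier (free_grp n)" "b \<in> carrier (free_grp n)" "mu_word a * mu_word b = mu_word b * mu_word a"
  shows "mu_word (gcomm (free_grp n) a b) = 1"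
proof -
  have "mu_word (gcomm (free_grp n) a b) = mu_word b * (mu_word a * mu_word (inv\<^bsub>free_grp n\<^esub> a)) * mu_word (inv\<^bsub>free_grp n\<^esub> b)"
    using assms(3) by (simp add: gcomm_def mu_word_mult mult.assoc)
  then show ?thesis using assms by (simp add: mu_word_inv)
qed

lemma RF_rels_closed: "RF_rels n \<subseteq> carrier (free_grp n)"
proof -
  interpret F: group "free_grp n" by (rule free_grp_group)
  show ?thesis by (auto simp: RF_rels_def fgen_closed intro!: F.gcomm_in_carrier)
qed

text \<open>A conjugate of \<open>x_i\<close> has image 1 + z with z containing \<open>y_i\<close>;
  z and \<open>y_i\<close> annihilate each other, so the two images commute.\<close>

lemma mu_word_RF_rels: "s \<in> RF_rels n \<Longrightarrow> mu_word s = 1"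
proof -
  interpret F: group "free_grp n" by (rule free_grp_group)
  assume "s \<in> RF_rels n"
  then obtain i y where s: "s = gcomm (free_grp n) (fgen i) (inv\<^bsub>free_grp n\<^esub> y \<otimes>\<^bsub>free_grp n\<^esub> fgen i \<otimes>\<^bsub>free_grp n\<^esub> y)"
    and i: "i < n" and y: "y \<in> carrier (free_grp n)" by (auto simp: RF_rels_def)
  let ?z = "mu_word (inv\<^bsub>free_grp n\<^esub> y) * mgen i * mu_word y"
  have g: "mu_word (fgen i) = 1 + mgen i" by (simp add: mu_word_def fgen_def mu_letter_def)
  have c: "mu_word (inv\<^bsub>free_grp n\<^esub> y \<otimes>\<^bsub>free_grp n\<^esub> fgen i \<otimes>\<^bsub>free_grp n\<^esub> y) = 1 + ?z"
    using mu_word_inv(2)[OF y] by (simp add: mu_word_mult g algebra_simps)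
  have "?z \<in> cont i" by (intro cont_mult_right cont_mult_left cont_mgen)
  then have "mgen i * ?z = 0" "?z * mgen i = 0" by (simp_all add: cont_mult_eq_0[of _ i])
  then show ?thesis
    unfolding s using i y
    by (intro mu_word_gcomm) (simp_all add: fgen_closed c g, simp add: algebra_simps)
qed

abbreviation RF_ker :: "nat \<Rightarrow> fword set" where
  "RF_ker n \<equiv> normal_closure (free_grp n) (RF_rels n)"

lemma RF_ker_conjs_closed:
  "(\<Union>g\<in>carrier (free_grp n). (\<lambda>s. g \<otimes>\<^bsub>free_grp n\<^esub> s \<otimes>\<^bsub>free_grp n\<^esub> inv\<^bsub>free_grp n\<^esub> g) ` RF_rels n)
    \<subseteq> carrier (free_grp n)"
proof -
  interpret F: group "free_grp n" by (rule free_grp_group)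
  show ?thesis using RF_rels_closed by auto
qed

lemma RF_ker_normal: "RF_ker n \<lhd> free_grp n"
  unfolding normal_closure_def
proof (rule group.normal_generateI[OF free_grp_group RF_ker_conjs_closed])
  interpret F: group "free_grp n" by (rule free_grp_group)
  let ?S = "\<Union>g\<in>carrier (free_grp n). (\<lambda>s. g \<otimes>\<^bsub>free_grp n\<^esub> s \<otimes>\<^bsub>free_grp n\<^esub> inv\<^bsub>free_grp n\<^esub> g) ` RF_rels n"
  fix h g assume "h \<in> ?S" and g: "g \<in> carrier (free_grp n)"
  then obtain k s where k: "k \<in> carrier (free_grp n)" "s \<in> RF_rels n"
    "h = k \<otimes>\<^bsub>free_grp n\<^esub> s \<otimes>\<^bsub>free_grp n\<^esub> inv\<^bsub>free_grp n\<^esub> k" by auto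
  have s: "s \<in> carrier (free_grp n)" using k RF_rels_closed by blast
  have "g \<otimes>\<^bsub>free_grp n\<^esub> h \<otimes>\<^bsub>free_grp n\<^esub> inv\<^bsub>free_grp n\<^esub> g
      = (g \<otimes>\<^bsub>free_grp n\<^esub> k) \<otimes>\<^bsub>free_grp n\<^esub> s \<otimes>\<^bsub>free_grp n\<^esub> inv\<^bsub>free_grp n\<^esub> (g \<otimes>\<^bsub>free_grp n\<^esub> k)"
    using g k s by (simp add: F.m_assoc F.inv_mult_group)
  then show "g \<otimes>\<^bsub>free_grp n\<^esub> h \<otimes>\<^bsub>free_grp n\<^esub> inv\<^bsub>free_grp n\<^esub> g \<in> ?S"
    using g k(1,2) by blast
qed

lemma RF_rels_RF_ker: "s \<in> RF_rels n \<Longrightarrow> s \<in> RF_ker n"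
proof -
  interpret F: group "free_grp n" by (rule free_grp_group)
  assume s: "s \<in> RF_rels n"
  then have "s = \<one>\<^bsub>free_grp n\<^esub> \<otimes>\<^bsub>free_grp n\<^esub> s \<otimes>\<^bsub>free_grp n\<^esub> inv\<^bsub>free_grp n\<^esub> \<one>\<^bsub>free_grp n\<^esub>"
    using RF_rels_closed[of n] by (simp add: subset_iff)
  then show ?thesis
    unfolding normal_closure_def using s F.one_closed by (intro generate.incl) blast
qed

lemma mu_word_RF_ker: "k \<in> RF_ker n \<Longrightarrow> mu_word k = 1"
  unfolding normal_closure_def
proof (induction rule: generate.induct)
  case one
  then show ?case by (rule mu_word_one)
next
  case (incl h)
  then obtain g s where g: "g \<in> carrier (free_grp n)" "s \<in> RF_rels n"
    "h = g \<otimes>\<^bsub>free_grp n\<^esub> s \<otimes>\<^bsub>free_grp n\<^esub> inv\<^bsub>free_grp n\<^esub> g" by auto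
  then show ?case by (simp add: mu_word_mult mu_word_RF_rels mu_word_inv)
next
  case (inv h)
  then have hc: "h \<in> carrier (free_grp n)" using RF_ker_conjs_closed by blast
  from inv obtain g s where g: "g \<in> carrier (free_grp n)" "s \<in> RF_rels n"
    "h = g \<otimes>\<^bsub>free_grp n\<^esub> s \<otimes>\<^bsub>free_grp n\<^esub> inv\<^bsub>free_grp n\<^esub> g" by auto
  then have "mu_word h = 1" by (simp add: mu_word_mult mu_word_RF_rels mu_word_inv)
  then show ?case using mu_word_inv(1)[OF hc] by simp
next
  case (eng a b)
  then show ?case by (simp add: mu_word_mult)
qed

definition mu_RF :: "fword set \<Rightarrow> rmag" where
  "mu_RF U = mu_word (SOME w. w \<in> U)"

text \<open>Since \<open>mu_word\<close> is 1 on the kernel, the representative picked by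
  \<open>mu_RF\<close> does not matter.\<close>

lemma mu_RF_coset:
  assumes "w \<in> carrier (free_grp n)"
  shows "mu_RF (RF_ker n #>\<^bsub>free_grp n\<^esub> w) = mu_word w"
proof -
  interpret K: normal "RF_ker n" "free_grp n" by (rule RF_ker_normal)
  have "w \<in> RF_ker n #>\<^bsub>free_grp n\<^esub> w" by (rule K.rcos_self[OF assms K.is_subgroup])
  then have "(SOME v. v \<in> RF_ker n #>\<^bsub>free_grp n\<^esub> w) \<in> RF_ker n #>\<^bsub>free_grp n\<^esub> w" by (rule someI)
  then obtain k where "k \<in> RF_ker n" "(SOME v. v \<in> RF_ker n #>\<^bsub>free_grp n\<^esub> w) = k \<otimes>\<^bsub>free_grp n\<^esub> w"
    by (auto simp: r_coset_def)
  then show ?thesis by (simp add: mu_RF_def mu_word_mult mu_word_RF_ker)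
qed

lemma (in group) commute_if_gcomm:
  assumes "x \<in> carrier G" "y \<in> carrier G" "x \<otimes> y \<otimes> inv x \<otimes> inv y = \<one>"
  shows "x \<otimes> y = y \<otimes> x"
proof -
  have "inv y \<otimes> (y \<otimes> x) = x"
    using assms(1,2) by (simp add: m_assoc[symmetric])
  then have "x \<otimes> y = (x \<otimes> y \<otimes> inv x \<otimes> inv y) \<otimes> (y \<otimes> x)"
    using assms(1,2) by (simp add: m_assoc)
  then show ?thesis using assms by simp
qed

theorem RF_reduced_free: "reduced_free (RF n) n (rgen n) mu_RF"
proof -
  interpret F: group "free_grp n" by (rule free_grp_group)
  interpret K: normal "RF_ker n" "free_grp n" by (rule RF_ker_normal)
  let ?h = "\<lambda>w. RF_ker n #>\<^bsub>free_grp n\<^esub> w"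
  have RF: "RF n = free_grp n Mod RF_ker n" by (simp add: RF_def)
  have grp: "group (RF n)" unfolding RF by (rule K.factorgroup_is_group)
  have hom: "?h \<in> hom (free_grp n) (RF n)" unfolding RF by (rule K.r_coset_hom_Mod)
  interpret H: group_hom "free_grp n" "RF n" ?h
    using grp hom by (simp add: group_hom_def group_hom_axioms_def free_grp_group)
  have surj: "\<exists>w\<in>carrier (free_grp n). U = ?h w" if "U \<in> carrier (RF n)" for U
    using that unfolding RF FactGroup_def RCOSETS_def by auto
  have rg: "rgen n i = ?h (fgen i)" for i by (simp add: rgen_def)
  show ?thesis
  proof (rule reduced_free.intro[OF grp], unfold_locales)
    fix i assume i: "i < n"
    show "rgen n i \<in> carrier (RF n)" unfolding rg using i by (intro H.hom_closed fgen_closed)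
    show "mu_RF (rgen n i) = 1 + mgen i"
      unfolding rg using i by (simp add: mu_RF_coset fgen_closed) (simp add: mu_word_def fgen_def mu_letter_def)
    fix g assume "g \<in> carrier (RF n)"
    then obtain w where w: "w \<in> carrier (free_grp n)" "g = ?h w" using surj by blast
    \<comment> \<open>The relations have the inverse of y on the left, so y is taken to be the
      inverse of w to obtain the conjugate by w.\<close>
    let ?x = "fgen i" and ?y = "inv\<^bsub>free_grp n\<^esub> w"
    let ?c = "inv\<^bsub>free_grp n\<^esub> ?y \<otimes>\<^bsub>free_grp n\<^esub> ?x \<otimes>\<^bsub>free_grp n\<^esub> ?y"
    have x: "?x \<in> carrier (free_grp n)" and c: "?c \<in> carrier (free_grp n)" using i w fgen_closed by auto
    have "?y \<in> carrier (free_grp n)" using w by simp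
    then have "gcomm (free_grp n) ?x ?c \<in> RF_rels n"
      unfolding RF_rels_def using i by blast
    then have "gcomm (free_grp n) ?x ?c \<in> RF_ker n" by (rule RF_rels_RF_ker)
    then have "?h (gcomm (free_grp n) ?x ?c) = \<one>\<^bsub>RF n\<^esub>"
      by (simp add: RF FactGroup_def K.rcos_const)
    then have "?h ?x \<otimes>\<^bsub>RF n\<^esub> ?h ?c \<otimes>\<^bsub>RF n\<^esub> inv\<^bsub>RF n\<^esub> (?h ?x) \<otimes>\<^bsub>RF n\<^esub> inv\<^bsub>RF n\<^esub> (?h ?c) = \<one>\<^bsub>RF n\<^esub>"
      using x c by (simp only: gcomm_def H.hom_mult H.hom_inv F.m_closed F.inv_closed)
    then have "?h ?x \<otimes>\<^bsub>RF n\<^esub> ?h ?c = ?h ?c \<otimes>\<^bsub>RF n\<^esub> ?h ?x"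
      using H.hom_closed[OF x] H.hom_closed[OF c]
      by (rule group.commute_if_gcomm[OF grp, rotated 2])
    moreover have "?h ?c = g \<otimes>\<^bsub>RF n\<^esub> rgen n i \<otimes>\<^bsub>RF n\<^esub> inv\<^bsub>RF n\<^esub> g"
      using x w unfolding rg w(2) by (simp only: H.hom_mult H.hom_inv F.m_closed F.inv_closed F.inv_inv)
    ultimately show "rgen n i \<otimes>\<^bsub>RF n\<^esub> (g \<otimes>\<^bsub>RF n\<^esub> rgen n i \<otimes>\<^bsub>RF n\<^esub> inv\<^bsub>RF n\<^esub> g)
        = g \<otimes>\<^bsub>RF n\<^esub> rgen n i \<otimes>\<^bsub>RF n\<^esub> inv\<^bsub>RF n\<^esub> g \<otimes>\<^bsub>RF n\<^esub> rgen n i"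
      by (simp only: rg)
  next
    have "rgen n ` {..<n} = ?h ` (fgen ` {..<n})" by (simp add: rg image_image)
    then have "generate (RF n) (rgen n ` {..<n}) = ?h ` carrier (free_grp n)"
      using H.generate_img[of "fgen ` {..<n}"] fgen_closed free_grp_generate[of n]
      by (simp add: image_subset_iff)
    then show "generate (RF n) (rgen n ` {..<n}) = carrier (RF n)"
      by (auto dest!: surj)
  next
    have "\<one>\<^bsub>RF n\<^esub> = ?h \<one>\<^bsub>free_grp n\<^esub>" by simp
    then show "mu_RF \<one>\<^bsub>RF n\<^esub> = 1" using mu_RF_coset[OF F.one_closed] mu_word_one by metis
  next
    fix g h assume "g \<in> carrier (RF n)" "h \<in> carrier (RF n)"
    then obtain v w where "v \<in> carrier (free_grp n)" "g = ?h v" "w \<in> carrier (free_grp n)" "h = ?h w"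
      using surj by metis
    then show "mu_RF (g \<otimes>\<^bsub>RF n\<^esub> h) = mu_RF g * mu_RF h"
      by (simp add: mu_RF_coset mu_word_mult flip: H.hom_mult)
  qed
qed

theorem LieG_hPSigma_rep: "\<exists>F. lie_rep (LieG (hPSigma n)) F (brD n) (TD n)"
proof -
  interpret reduced_free "RF n" n "rgen n" mu_RF by (rule RF_reduced_free)
  have "hPSigma n = CA" by (simp add: hPSigma_def CA_def)
  then show ?thesis using LieG_CA_rep by simp
qed

section \<open>A basis of the reduced free Lie ring and its faithful evaluation\<close>

section \<open>The presented reduced free Lie ring\<close>

fun evt :: "mtree \<Rightarrow> rmag" where
  "evt (MLeaf i) = mgen i"
| "evt (MNode a b) = comm (evt a) (evt b)"

text \<open>The Lie evaluation of nonassociative polynomials in the Magnus ring; its kernel turns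
  out to be the ideal of relations, see \<open>ev_eq_0_iff\<close>.\<close>

definition ev :: "(mtree \<Rightarrow> int) \<Rightarrow> rmag" where
  "ev p = (\<Sum>t | p t \<noteq> 0. of_int (p t) * evt t)"

lemma ev_eq: "finite S \<Longrightarrow> (\<And>t. p t \<noteq> 0 \<Longrightarrow> t \<in> S) \<Longrightarrow> ev p = (\<Sum>t\<in>S. of_int (p t) * evt t)"
  unfolding ev_def by (rule sum.mono_neutral_left) auto

lemma ev_zero [simp]: "ev (\<lambda>t. 0) = 0"
  by (simp add: ev_def)

lemma ev_add:
  assumes "finite {t. p t \<noteq> 0}" "finite {t. q t \<noteq> 0}"
  shows "ev (\<lambda>t. p t + q t) = ev p + ev q"
proof -
  let ?S = "{t. p t \<noteq> 0} \<union> {t. q t \<noteq> 0}"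
  have "finite ?S" using assms by simp
  then have "ev (\<lambda>t. p t + q t) = (\<Sum>t\<in>?S. of_int (p t + q t) * evt t)"
    "ev p = (\<Sum>t\<in>?S. of_int (p t) * evt t)" "ev q = (\<Sum>t\<in>?S. of_int (q t) * evt t)"
    by (rule ev_eq; auto)+
  then show ?thesis by (simp add: algebra_simps sum.distrib)
qed

lemma ev_minus: "ev (\<lambda>t. - p t) = - ev p"
  by (simp add: ev_def sum_negf)

lemma finite_mmul: "finite {t. p t \<noteq> 0} \<Longrightarrow> finite {t. q t \<noteq> 0} \<Longrightarrow> finite {t. mmul p q t \<noteq> 0}"
proof (rule finite_subset)
  show "{t. mmul p q t \<noteq> 0} \<subseteq> (\<lambda>(a, b). MNode a b) ` ({t. p t \<noteq> 0} \<times> {t. q t \<noteq> 0})"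
  proof
    fix t assume "t \<in> {t. mmul p q t \<noteq> 0}"
    then show "t \<in> (\<lambda>(a, b). MNode a b) ` ({t. p t \<noteq> 0} \<times> {t. q t \<noteq> 0})"
      by (cases t) auto
  qed
qed simp

lemma comm_of_int: "comm (of_int c * x) y = of_int c * comm x y" "comm x (of_int c * y) = of_int c * comm x y"
  by (rule of_int_additive[of "\<lambda>x. comm x y"], simp add: comm_add)
    (rule of_int_additive[of "\<lambda>y. comm x y"], simp add: comm_add)

lemma comm_sum: "comm (sum f A) y = (\<Sum>a\<in>A. comm (f a) y)" "comm y (sum f A) = (\<Sum>a\<in>A. comm y (f a))"
  by (induction A rule: infinite_finite_induct) (simp_all add: comm_add)

lemma ev_mmul:
  assumes "finite {t. p t \<noteq> 0}" "finite {t. q t \<noteq> 0}"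
  shows "ev (mmul p q) = comm (ev p) (ev q)"
proof -
  let ?P = "{t. p t \<noteq> 0}" and ?Q = "{t. q t \<noteq> 0}"
  let ?S = "(\<lambda>(a, b). MNode a b) ` (?P \<times> ?Q)"
  have "ev (mmul p q) = (\<Sum>t\<in>?S. of_int (mmul p q t) * evt t)"
  proof (rule ev_eq)
    show "t \<in> ?S" if "mmul p q t \<noteq> 0" for t using that by (cases t) auto
  qed (use assms in simp)
  also have "\<dots> = (\<Sum>(a, b)\<in>?P \<times> ?Q. of_int (p a * q b) * comm (evt a) (evt b))"
    by (subst sum.reindex) (auto simp: inj_on_def case_prod_beta')
  also have "\<dots> = (\<Sum>a\<in>?P. \<Sum>b\<in>?Q. of_int (p a * q b) * comm (evt a) (evt b))"
    by (simp add: sum.cartesian_product)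
  also have "\<dots> = comm (ev p) (ev q)"
  proof -
    have "comm (of_int c * x) (of_int d * z) = of_int (c * d) * comm x z" for c d x z
      by (subst comm_of_int(1), subst comm_of_int(2)) (simp add: mult.assoc)
    then show ?thesis
      by (simp only: ev_def comm_sum(1)) (simp only: comm_sum(2))
  qed
  finally show ?thesis .
qed

lemma mcarrier_finite: "p \<in> mcarrier m \<Longrightarrow> finite {t. p t \<noteq> 0}"
  by (simp add: mcarrier_def)

lemma mcarrier_zero: "(\<lambda>t. 0) \<in> mcarrier m"
  by (simp add: mcarrier_def)

lemma mcarrier_add:
  assumes "p \<in> mcarrier m" "q \<in> mcarrier m"
  shows "(\<lambda>t. p t + q t) \<in> mcarrier m"
proof -
  have "{t. p t + q t \<noteq> 0} \<subseteq> {t. p t \<noteq> 0} \<union> {t. q t \<noteq> 0}" by auto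
  then have "finite {t. p t + q t \<noteq> 0}" by (rule finite_subset) (use assms in \<open>simp add: mcarrier_def\<close>)
  moreover have "mleaves t \<subseteq> {..<m}" if "p t + q t \<noteq> 0" for t
    using that assms unfolding mcarrier_def by (cases "p t = 0") auto
  ultimately show ?thesis by (simp add: mcarrier_def)
qed

lemma mcarrier_neg: "p \<in> mcarrier m \<Longrightarrow> (\<lambda>t. - p t) \<in> mcarrier m"
  by (simp add: mcarrier_def)

lemma mcarrier_mmul:
  assumes "p \<in> mcarrier m" "q \<in> mcarrier m"
  shows "mmul p q \<in> mcarrier m"
proof -
  have "mleaves t \<subseteq> {..<m}" if "mmul p q t \<noteq> 0" for t
    using that assms by (cases t) (auto simp: mcarrier_def)
  then show ?thesis using finite_mmul assms by (simp add: mcarrier_def)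
qed

definition tmon :: "mtree \<Rightarrow> mtree \<Rightarrow> int" where
  "tmon t = (\<lambda>s. if s = t then 1 else 0)"

lemma ygen_tmon: "ygen i = tmon (MLeaf i)"
  by (simp add: ygen_def tmon_def)

lemma mmul_tmon: "mmul (tmon a) (tmon b) = tmon (MNode a b)"
proof
  fix t show "mmul (tmon a) (tmon b) t = tmon (MNode a b) t" by (cases t) (auto simp: tmon_def)
qed

lemma tmon_mcarrier: "mleaves t \<subseteq> {..<m} \<Longrightarrow> tmon t \<in> mcarrier m"
  by (auto simp: mcarrier_def tmon_def)

lemma ygen_mcarrier: "i < m \<Longrightarrow> ygen i \<in> mcarrier m"
  by (simp add: ygen_tmon tmon_mcarrier)

lemma ev_tmon: "ev (tmon t) = evt t"
  by (subst ev_eq[of "{t}"]) (auto simp: tmon_def split: if_splits)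

lemma ev_ygen: "ev (ygen i) = mgen i"
  by (simp add: ygen_tmon ev_tmon)

lemma rbr_Cons: "w \<noteq> [] \<Longrightarrow> rbr (i # w) = mmul (ygen i) (rbr w)"
  by (cases w) auto

lemma rbr_mcarrier: "set w \<subseteq> {..<m} \<Longrightarrow> rbr w \<in> mcarrier m"
  by (induction w rule: rbr.induct)
    (auto intro: mcarrier_zero ygen_mcarrier mcarrier_mmul)

lemma ev_rbr: "ev (rbr w) = rn_br w"
proof (induction w rule: rn_br.induct)
  case (3 i j w)
  obtain m where "set (i # j # w) \<subseteq> {..<m}"
    using finite_nat_iff_bounded[of "set (i # j # w)"] by auto
  then have "finite {t. ygen i t \<noteq> 0}" "finite {t. rbr (j # w) t \<noteq> 0}"
    by (auto intro!: mcarrier_finite[of _ m] ygen_mcarrier rbr_mcarrier)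
  then show ?case using 3 by (simp add: ev_mmul ev_ygen)
qed (simp_all add: ev_ygen)

subsection \<open>The ideal of relations\<close>

lemma mjac_mcarrier:
  "p \<in> mcarrier m \<Longrightarrow> q \<in> mcarrier m \<Longrightarrow> r \<in> mcarrier m \<Longrightarrow> mjac p q r \<in> mcarrier m"
  unfolding mjac_def by (intro mcarrier_add mcarrier_mmul)

lemma RL_rels_mcarrier: "RL_rels m \<subseteq> mcarrier m"
  unfolding RL_rels_def by (auto intro: mcarrier_mmul mjac_mcarrier rbr_mcarrier)

lemma ev_RL_rels: "p \<in> RL_rels m \<Longrightarrow> ev p = 0"
  unfolding RL_rels_def
proof (elim UnE CollectE exE conjE)
  fix q assume "p = mmul q q" "q \<in> mcarrier m"
  then show "ev p = 0" by (simp add: ev_mmul mcarrier_finite comm_def)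
next
  fix a b c assume p: "p = mjac a b c" and c: "a \<in> mcarrier m" "b \<in> mcarrier m" "c \<in> mcarrier m"
  have f: "finite {t. mmul x y t \<noteq> 0}" if "x \<in> mcarrier m" "y \<in> mcarrier m" for x y
    using that mcarrier_mmul mcarrier_finite by blast
  have "(\<lambda>t. mmul a (mmul b c) t + mmul b (mmul c a) t) \<in> mcarrier m"
    using c by (intro mcarrier_add mcarrier_mmul)
  then have "ev p = comm (ev a) (comm (ev b) (ev c)) + comm (ev b) (comm (ev c) (ev a)) + comm (ev c) (comm (ev a) (ev b))"
    unfolding p mjac_def using c
    by (simp add: ev_add ev_mmul f mcarrier_mmul mcarrier_finite)
  then show "ev p = 0" by (simp add: comm_def algebra_simps)
qed (simp add: ev_rbr rn_br_not_distinct)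

lemma RL_ideal_mcarrier: "p \<in> RL_ideal m \<Longrightarrow> p \<in> mcarrier m"
  unfolding RL_ideal_def
  by (induction rule: mideal.induct)
    (use RL_rels_mcarrier in \<open>auto intro: mcarrier_zero mcarrier_add mcarrier_neg mcarrier_mmul\<close>)

lemma ev_RL_ideal: "p \<in> RL_ideal m \<Longrightarrow> ev p = 0"
  unfolding RL_ideal_def
proof (induction rule: mideal.induct)
  case (gen s)
  then show ?case by (rule ev_RL_rels)
next
  case zero
  then show ?case by simp
next
  case (add x y)
  then show ?case
    using RL_ideal_mcarrier mcarrier_finite by (subst ev_add) (auto simp: RL_ideal_def)
next
  case (neg x)
  then show ?case by (simp add: ev_minus)
next
  case (lmul a x)
  then show ?case
    using RL_ideal_mcarrier mcarrier_finite by (subst ev_mmul) (auto simp: RL_ideal_def)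
next
  case (rmul a x)
  then show ?case
    using RL_ideal_mcarrier mcarrier_finite by (subst ev_mmul) (auto simp: RL_ideal_def)
qed

lemma RL_ideal_zero: "(\<lambda>t. 0) \<in> RL_ideal m"
  unfolding RL_ideal_def by (rule mideal.zero)
lemma RL_ideal_add: "x \<in> RL_ideal m \<Longrightarrow> y \<in> RL_ideal m \<Longrightarrow> (\<lambda>t. x t + y t) \<in> RL_ideal m"
  unfolding RL_ideal_def by (rule mideal.add)
lemma RL_ideal_neg: "x \<in> RL_ideal m \<Longrightarrow> (\<lambda>t. - x t) \<in> RL_ideal m"
  unfolding RL_ideal_def by (rule mideal.neg)
lemma RL_ideal_lmul: "a \<in> mcarrier m \<Longrightarrow> x \<in> RL_ideal m \<Longrightarrow> mmul a x \<in> RL_ideal m"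
  unfolding RL_ideal_def by (rule mideal.lmul)
lemma RL_ideal_diff: "x \<in> RL_ideal m \<Longrightarrow> y \<in> RL_ideal m \<Longrightarrow> (\<lambda>t. x t - y t) \<in> RL_ideal m"
  using RL_ideal_add[OF _ RL_ideal_neg] by fastforce
lemma RL_ideal_rel: "x \<in> RL_rels m \<Longrightarrow> x \<in> RL_ideal m"
  unfolding RL_ideal_def by (rule mideal.gen)

lemma mmul_add_left: "mmul (\<lambda>t. x t + y t) z = (\<lambda>t. mmul x z t + mmul y z t)"
proof
  fix t show "mmul (\<lambda>t. x t + y t) z t = mmul x z t + mmul y z t"
    by (cases t) (auto simp: algebra_simps)
qed

lemma mmul_add_right: "mmul z (\<lambda>t. x t + y t) = (\<lambda>t. mmul z x t + mmul z y t)"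
proof
  fix t show "mmul z (\<lambda>t. x t + y t) t = mmul z x t + mmul z y t"
    by (cases t) (auto simp: algebra_simps)
qed

lemma mmul_neg_right: "mmul z (\<lambda>t. - x t) = (\<lambda>t. - mmul z x t)"
proof
  fix t show "mmul z (\<lambda>t. - x t) t = - mmul z x t" by (cases t) auto
qed

text \<open>Polarisation of the relation that squares vanish.\<close>

lemma RL_antisym:
  assumes "x \<in> mcarrier m" "y \<in> mcarrier m"
  shows "(\<lambda>t. mmul x y t + mmul y x t) \<in> RL_ideal m"
proof -
  have sq: "mmul p p \<in> RL_ideal m" if "p \<in> mcarrier m" for p
    using that by (intro RL_ideal_rel) (auto simp: RL_rels_def)
  have "(\<lambda>t. (mmul (\<lambda>t. x t + y t) (\<lambda>t. x t + y t) t - mmul x x t) - mmul y y t) \<in> RL_ideal m"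
    by (intro RL_ideal_diff sq mcarrier_add assms)
  then show ?thesis by (simp add: mmul_add_left mmul_add_right add_ac)
qed

text \<open>The Jacobi relation rearranged by antisymmetry: modulo the ideal, left multiplication by
  a product is the commutator of the left multiplications.\<close>

lemma RL_leibniz:
  assumes "x \<in> mcarrier m" "y \<in> mcarrier m" "z \<in> mcarrier m"
  shows "(\<lambda>t. mmul (mmul x y) z t - mmul x (mmul y z) t + mmul y (mmul x z) t) \<in> RL_ideal m"
proof -
  have 1: "mjac x y z \<in> RL_ideal m" using assms by (intro RL_ideal_rel) (auto simp: RL_rels_def)
  have 2: "(\<lambda>t. mmul (mmul x y) z t + mmul z (mmul x y) t) \<in> RL_ideal m"
    by (intro RL_antisym mcarrier_mmul assms)
  have 3: "mmul y (\<lambda>t. mmul z x t + mmul x z t) \<in> RL_ideal m"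
    by (intro RL_ideal_lmul RL_antisym assms)
  have "(\<lambda>t. (mmul (mmul x y) z t + mmul z (mmul x y) t - mjac x y z t)
      + mmul y (\<lambda>t. mmul z x t + mmul x z t) t) \<in> RL_ideal m"
    by (rule RL_ideal_add[OF RL_ideal_diff[OF 2 1] 3])
  also have "(\<lambda>t. (mmul (mmul x y) z t + mmul z (mmul x y) t - mjac x y z t)
      + mmul y (\<lambda>t. mmul z x t + mmul x z t) t)
    = (\<lambda>t. mmul (mmul x y) z t - mmul x (mmul y z) t + mmul y (mmul x z) t)"
    by (simp add: mmul_add_right mjac_def fun_eq_iff)
  finally show ?thesis .
qed

subsection \<open>Spanning by right-normed brackets\<close>

text \<open>Including the ideal allows computing modulo the relations on polynomials themselves,
  without passing to the quotient.\<close>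

inductive_set aspan :: "nat \<Rightarrow> (mtree \<Rightarrow> int) set \<Rightarrow> (mtree \<Rightarrow> int) set" for m B where
  base: "b \<in> B \<Longrightarrow> b \<in> aspan m B"
| ideal: "x \<in> RL_ideal m \<Longrightarrow> x \<in> aspan m B"
| add: "x \<in> aspan m B \<Longrightarrow> y \<in> aspan m B \<Longrightarrow> (\<lambda>t. x t + y t) \<in> aspan m B"
| neg: "x \<in> aspan m B \<Longrightarrow> (\<lambda>t. - x t) \<in> aspan m B"

lemma aspan_mcarrier: "x \<in> aspan m B \<Longrightarrow> B \<subseteq> mcarrier m \<Longrightarrow> x \<in> mcarrier m"
  by (induction rule: aspan.induct) (auto intro: RL_ideal_mcarrier mcarrier_add mcarrier_neg)

lemma aspan_diff: "x \<in> aspan m B \<Longrightarrow> y \<in> aspan m B \<Longrightarrow> (\<lambda>t. x t - y t) \<in> aspan m B"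
  using aspan.add[OF _ aspan.neg] by fastforce

lemma aspan_trans:
  assumes "x \<in> aspan m B" "\<And>b. b \<in> B \<Longrightarrow> b \<in> aspan m B'"
  shows "x \<in> aspan m B'"
  using assms(1) by (induction rule: aspan.induct) (auto intro: aspan.intros assms(2))

text \<open>A tree acts by iterated commutators of its letters, by \<open>RL_leibniz\<close>, so
  closure under the letters suffices. L may be smaller than m in order to speak of trees in the
  first L letters only.\<close>

lemma aspan_mmul_tree:
  assumes B: "B \<subseteq> mcarrier m" and L: "L \<le> m"
    and gen: "\<And>i b. i < L \<Longrightarrow> b \<in> B \<Longrightarrow> mmul (ygen i) b \<in> aspan m B"
  shows "mleaves t \<subseteq> {..<L} \<Longrightarrow> z \<in> aspan m B \<Longrightarrow> mmul (tmon t) z \<in> aspan m B"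
proof (induction t arbitrary: z)
  case (MLeaf i)
  then have i: "i < L" "ygen i \<in> mcarrier m" using L by (auto intro: ygen_mcarrier)
  show ?case
    unfolding ygen_tmon[symmetric] using MLeaf(2)
    by (induction rule: aspan.induct)
      (auto simp: mmul_add_right mmul_neg_right intro: gen i aspan.intros RL_ideal_lmul)
next
  case (MNode a b)
  then have ab: "mleaves a \<subseteq> {..<L}" "mleaves b \<subseteq> {..<L}" by auto
  then have c: "tmon a \<in> mcarrier m" "tmon b \<in> mcarrier m" using L by (auto intro!: tmon_mcarrier)
  have zc: "z \<in> mcarrier m" using aspan_mcarrier[OF MNode.prems(2) B] .
  have 1: "mmul (tmon a) (mmul (tmon b) z) \<in> aspan m B" "mmul (tmon b) (mmul (tmon a) z) \<in> aspan m B"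
    using MNode.IH ab MNode.prems(2) by auto
  have "(\<lambda>t. ((mmul (mmul (tmon a) (tmon b)) z t - mmul (tmon a) (mmul (tmon b) z) t + mmul (tmon b) (mmul (tmon a) z) t)
      + mmul (tmon a) (mmul (tmon b) z) t) - mmul (tmon b) (mmul (tmon a) z) t) \<in> aspan m B"
    by (intro aspan_diff[OF aspan.add[OF aspan.ideal[OF RL_leibniz[OF c zc]] 1(1)] 1(2)])
  then show ?case by (simp add: mmul_tmon)
qed

fun rn_tree :: "nat list \<Rightarrow> mtree" where
  "rn_tree [] = MLeaf 0"
| "rn_tree [i] = MLeaf i"
| "rn_tree (i # j # w) = MNode (MLeaf i) (rn_tree (j # w))"

lemma rbr_rn_tree: "w \<noteq> [] \<Longrightarrow> rbr w = tmon (rn_tree w)"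
  by (induction w rule: rn_tree.induct) (simp_all add: ygen_tmon mmul_tmon)

lemma mleaves_rn_tree: "w \<noteq> [] \<Longrightarrow> mleaves (rn_tree w) = set w"
  by (induction w rule: rn_tree.induct) auto

lemma tree_span:
  "mleaves t \<subseteq> {..<m} \<Longrightarrow> tmon t \<in> aspan m {rbr u |u. u \<noteq> [] \<and> set u \<subseteq> {..<m}}"
proof (induction t)
  case (MLeaf i)
  then have "tmon (MLeaf i) = rbr [i]" "set [i] \<subseteq> {..<m}" by (simp_all add: ygen_tmon)
  then show ?case by (intro aspan.base) blast
next
  case (MNode a b)
  let ?B = "{rbr u |u. u \<noteq> [] \<and> set u \<subseteq> {..<m}}"
  have "mmul (tmon a) (tmon b) \<in> aspan m ?B"
  proof (rule aspan_mmul_tree[of _ _ m])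
    show "?B \<subseteq> mcarrier m" by (auto intro: rbr_mcarrier)
    fix i b assume i: "i < m" and "b \<in> ?B"
    then obtain u where "b = rbr u" "u \<noteq> []" "set u \<subseteq> {..<m}" by blast
    then have "mmul (ygen i) b = rbr (i # u)" "i # u \<noteq> []" "set (i # u) \<subseteq> {..<m}"
      using i by (simp_all add: rbr_Cons)
    then show "mmul (ygen i) b \<in> aspan m ?B" by (intro aspan.base) blast
  qed (use MNode in auto)
  then show ?case by (simp add: mmul_tmon)
qed

text \<open>When k is the outermost letter, antisymmetry turns the product of \<open>y_k\<close> and
  v into minus that of v and \<open>y_k\<close>, where v acts on an innermost \<open>y_k\<close>.
  Otherwise the outer letter acts on a bracket already rewritten.\<close>

lemma rbr_move_last:
  assumes L: "L \<le> m" "k < L"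
  shows "set u \<subseteq> {..<L} \<Longrightarrow> k \<in> set u \<Longrightarrow> rbr u \<in> aspan m {rbr (w @ [k]) |w. set w \<subseteq> {..<L}}"
proof (induction u)
  case (Cons i u)
  let ?B = "{rbr (w @ [k]) |w. set w \<subseteq> {..<L}}"
  have Bm: "?B \<subseteq> mcarrier m" using L by (fastforce intro!: rbr_mcarrier)
  have mul: "mmul (tmon t) z \<in> aspan m ?B" if "mleaves t \<subseteq> {..<L}" "z \<in> aspan m ?B" for t z
    using that
  proof (rule aspan_mmul_tree[OF Bm L(1), rotated])
    fix i b assume i: "i < L" and "b \<in> ?B"
    then obtain w where "b = rbr (w @ [k])" "set w \<subseteq> {..<L}" by blast
    then have "mmul (ygen i) b = rbr ((i # w) @ [k])" "set (i # w) \<subseteq> {..<L}"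
      using i by (simp_all add: rbr_Cons)
    then show "mmul (ygen i) b \<in> aspan m ?B" by (intro aspan.base) blast
  qed
  have yk: "ygen k \<in> aspan m ?B"
  proof (rule aspan.base)
    show "ygen k \<in> ?B" by (intro CollectI exI[of _ "[]"]) simp
  qed
  consider "k \<in> set u" | "i = k" "u = []" | "i = k" "u \<noteq> []" using Cons.prems by auto
  then show ?case
  proof cases
    case 1
    then have "rbr u \<in> aspan m ?B" "u \<noteq> []" using Cons by auto
    then show ?thesis using mul[of "MLeaf i" "rbr u"] Cons.prems by (simp add: rbr_Cons ygen_tmon)
  next
    case 2
    then show ?thesis using yk by simp
  next
    case 3
    have yc: "ygen k \<in> mcarrier m" using L by (intro ygen_mcarrier) simp
    have uc: "rbr u \<in> mcarrier m" using Cons.prems L by (intro rbr_mcarrier) auto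
    have "mmul (rbr u) (ygen k) \<in> aspan m ?B"
      unfolding rbr_rn_tree[OF 3(2)]
      by (rule mul[OF _ yk]) (use 3 Cons.prems in \<open>simp add: mleaves_rn_tree\<close>)
    from aspan_diff[OF aspan.ideal[OF RL_antisym[OF yc uc]] this]
    show ?thesis using 3 by (simp add: rbr_Cons)
  qed
qed simp

text \<open>The largest letter is innermost and the others come in any order. Grouping by the
  largest letter k matches the images of the maps \<open>T k k\<close>.\<close>

definition Hall :: "nat \<Rightarrow> (mtree \<Rightarrow> int) set" where
  "Hall m = {rbr (w @ [k]) |w k. k < m \<and> w \<in> dwords k}"

text \<open>Induction on a bound for the letters: the largest one is moved to the innermost place,
  and a bracket with a repetition is itself a relation.\<close>

lemma rbr_Hall: "L \<le> m \<Longrightarrow> u \<noteq> [] \<Longrightarrow> set u \<subseteq> {..<L} \<Longrightarrow> rbr u \<in> aspan m (Hall m)"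
proof (induction L)
  case (Suc L)
  show ?case
  proof (cases "L \<in> set u")
    case True
    have "rbr u \<in> aspan m {rbr (w @ [L]) |w. set w \<subseteq> {..<Suc L}}"
      by (rule rbr_move_last) (use True Suc.prems in auto)
    then show ?thesis
    proof (rule aspan_trans)
      fix b assume "b \<in> {rbr (w @ [L]) |w. set w \<subseteq> {..<Suc L}}"
      then obtain w where w: "b = rbr (w @ [L])" "set w \<subseteq> {..<Suc L}" by blast
      show "b \<in> aspan m (Hall m)"
      proof (cases "distinct (w @ [L])")
        case True
        then have "w \<in> dwords L" using w by (auto simp: dwords_def less_Suc_eq)
        then show ?thesis
          unfolding Hall_def using w(1) Suc.prems(1)
          by (intro aspan.base CollectI exI[of _ w] exI[of _ L]) auto
      next
        case False
        then have "2 \<le> length (w @ [L])" by (cases w) auto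
        moreover have "set (w @ [L]) \<subseteq> {..<m}" using w(2) Suc.prems(1) by auto
        ultimately have "b \<in> RL_rels m" unfolding RL_rels_def w(1) using False by blast
        then show ?thesis by (intro aspan.ideal RL_ideal_rel)
      qed
    qed
  next
    case False
    then have "set u \<subseteq> {..<L}" using Suc.prems(3) by (auto simp: less_Suc_eq)
    then show ?thesis using Suc by simp
  qed
qed simp

lemma mcarrier_span: "p \<in> mcarrier m \<Longrightarrow> p \<in> aspan m (Hall m)"
proof -
  let ?A = "aspan m (Hall m)"
  assume p: "p \<in> mcarrier m"
  have 0: "(\<lambda>t. 0) \<in> ?A" by (rule aspan.ideal[OF RL_ideal_zero])
  have tree: "tmon t \<in> ?A" if "mleaves t \<subseteq> {..<m}" for t
    by (rule aspan_trans[OF tree_span[OF that]]) (auto intro: rbr_Hall[OF order_refl])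
  have mult: "(\<lambda>s. c * x s) \<in> ?A" if x: "x \<in> ?A" for c :: int and x
  proof (induction c rule: int_induct[where k = 0])
    case base
    then show ?case using 0 by simp
  next
    case (step1 i)
    from aspan.add[OF step1(2) x] show ?case by (simp add: algebra_simps)
  next
    case (step2 i)
    from aspan_diff[OF step2(2) x] show ?case by (simp add: algebra_simps)
  qed
  have "finite S \<Longrightarrow> (\<And>t. t \<in> S \<Longrightarrow> mleaves t \<subseteq> {..<m}) \<Longrightarrow> (\<lambda>s. \<Sum>t\<in>S. p t * tmon t s) \<in> ?A" for S
  proof (induction S rule: finite_induct)
    case empty
    then show ?case using 0 by simp
  next
    case (insert t S)
    then show ?case using aspan.add[OF mult[OF tree[of t], of "p t"]] by simp
  qed
  from this[of "{t. p t \<noteq> 0}"] have "(\<lambda>s. \<Sum>t | p t \<noteq> 0. p t * tmon t s) \<in> ?A"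
    using p by (auto simp: mcarrier_def)
  also have "(\<lambda>s. \<Sum>t | p t \<noteq> 0. p t * tmon t s) = p"
  proof
    fix s
    have "(\<Sum>t | p t \<noteq> 0. p t * tmon t s) = (\<Sum>t | p t \<noteq> 0. if s = t then p s else 0)"
      by (rule sum.cong) (auto simp: tmon_def)
    then show "(\<Sum>t | p t \<noteq> 0. p t * tmon t s) = p s"
      using mcarrier_finite[OF p] by simp
  qed
  finally show ?thesis .
qed

text \<open>The coefficients are stored as one Magnus element per largest letter, so that the
  evaluation is a sum of values of \<open>T k k\<close>.\<close>

definition hall_comb :: "nat \<Rightarrow> (nat \<Rightarrow> rmag) \<Rightarrow> mtree \<Rightarrow> int" where
  "hall_comb m a = (\<lambda>t. \<Sum>k<m. \<Sum>w\<in>dwords k. coef (a k) w * rbr (w @ [k]) t)"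

lemma ev_lincomb:
  assumes "finite S" "\<And>x. x \<in> S \<Longrightarrow> f x \<in> mcarrier m"
  shows "(\<lambda>t. \<Sum>x\<in>S. c x * f x t) \<in> mcarrier m \<and> ev (\<lambda>t. \<Sum>x\<in>S. c x * f x t) = (\<Sum>x\<in>S. of_int (c x) * ev (f x))"
  using assms
proof (induction S rule: finite_induct)
  case empty
  then show ?case by (simp add: mcarrier_zero)
next
  case (insert x S)
  have sm: "(\<lambda>t. d * p t) \<in> mcarrier m \<and> ev (\<lambda>t. d * p t) = of_int d * ev p"
    if p: "p \<in> mcarrier m" for d :: int and p
  proof -
    have "{t. d * p t \<noteq> 0} \<subseteq> {t. p t \<noteq> 0}" by auto
    then have "(\<lambda>t. d * p t) \<in> mcarrier m"
      using p by (auto simp: mcarrier_def intro: finite_subset)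
    moreover have "ev (\<lambda>t. d * p t) = (\<Sum>t | p t \<noteq> 0. of_int (d * p t) * evt t)"
      by (rule ev_eq) (use mcarrier_finite[OF p] in auto)
    ultimately show ?thesis by (simp add: ev_def sum_distrib_left mult.assoc)
  qed
  have fx: "f x \<in> mcarrier m" using insert by simp
  have S: "(\<lambda>t. \<Sum>x\<in>S. c x * f x t) \<in> mcarrier m"
    "ev (\<lambda>t. \<Sum>x\<in>S. c x * f x t) = (\<Sum>x\<in>S. of_int (c x) * ev (f x))" using insert by auto
  have e: "(\<lambda>t. \<Sum>x\<in>insert x S. c x * f x t) = (\<lambda>t. c x * f x t + (\<Sum>x\<in>S. c x * f x t))"
    using insert by simp
  have "ev (\<lambda>t. c x * f x t + (\<Sum>x\<in>S. c x * f x t)) = of_int (c x) * ev (f x) + (\<Sum>x\<in>S. of_int (c x) * ev (f x))"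
    using ev_add[OF mcarrier_finite mcarrier_finite, of "\<lambda>t. c x * f x t" m "\<lambda>t. \<Sum>x\<in>S. c x * f x t" m]
      S sm[OF fx, of "c x"] by simp
  then show ?case
    unfolding e using insert mcarrier_add[of _ m, OF _ S(1)] sm[OF fx, of "c x"] by simp
qed

lemma ev_hall_comb: "ev (hall_comb m a) = (\<Sum>k<m. T k k (a k))"
proof -
  have 1: "(\<lambda>t. \<Sum>w\<in>dwords k. coef (a k) w * rbr (w @ [k]) t) \<in> mcarrier m \<and>
    ev (\<lambda>t. \<Sum>w\<in>dwords k. coef (a k) w * rbr (w @ [k]) t) = T k k (a k)" if "k < m" for k
  proof -
    have "rbr (w @ [k]) \<in> mcarrier m" if "w \<in> dwords k" for w
      using that \<open>k < m\<close> by (intro rbr_mcarrier) (auto simp: dwords_def)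
    from ev_lincomb[OF finite_dwords this, where c = "coef (a k)"] show ?thesis
      by (simp add: ev_rbr T_def lin_def)
  qed
  have "ev (\<lambda>t. \<Sum>k<m. 1 * (\<Sum>w\<in>dwords k. coef (a k) w * rbr (w @ [k]) t))
      = (\<Sum>k<m. of_int 1 * ev (\<lambda>t. \<Sum>w\<in>dwords k. coef (a k) w * rbr (w @ [k]) t))"
    by (rule ev_lincomb[where m = m, THEN conjunct2]) (use 1 in auto)
  then show ?thesis using 1 by (simp add: hall_comb_def)
qed

lemma aspan_hall_comb:
  "p \<in> aspan m (Hall m) \<Longrightarrow> \<exists>a. (\<forall>k. a k \<in> rsub {..<k}) \<and> (\<lambda>t. p t - hall_comb m a t) \<in> RL_ideal m"
proof (induction rule: aspan.induct)
  case (base b)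
  then obtain w k where b: "b = rbr (w @ [k])" "k < m" "w \<in> dwords k" by (auto simp: Hall_def)
  define a where "a j = (if j = k then mon w else 0)" for j
  have "hall_comb m a t = b t" for t
  proof -
    have "(\<Sum>v\<in>dwords j. coef (a j) v * rbr (v @ [j]) t) = (if j = k then b t else 0)" for j
    proof (cases "j = k")
      case True
      have "(\<Sum>v\<in>dwords k. coef (mon w) v * rbr (v @ [k]) t) = (\<Sum>v\<in>dwords k. if v = w then b t else 0)"
        by (rule sum.cong) (use b in \<open>auto simp: coef_mon dwords_def\<close>)
      then show ?thesis using True b by (simp add: a_def)
    qed (simp add: a_def)
    then show ?thesis using b by (simp add: hall_comb_def)
  qed
  moreover have "a j \<in> rsub {..<j}" for j
    using b by (auto simp: a_def dwords_def intro!: rsub_mon)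
  ultimately show ?case by (intro exI[of _ a]) (simp add: RL_ideal_zero)
next
  case (ideal x)
  then show ?case by (intro exI[of _ "\<lambda>_. 0"]) (simp add: hall_comb_def)
next
  case (add x y)
  then obtain a b where a: "\<And>k. a k \<in> rsub {..<k}" "(\<lambda>t. x t - hall_comb m a t) \<in> RL_ideal m"
    and b: "\<And>k. b k \<in> rsub {..<k}" "(\<lambda>t. y t - hall_comb m b t) \<in> RL_ideal m" by blast
  have "hall_comb m (\<lambda>k. a k + b k) t = hall_comb m a t + hall_comb m b t" for t
    by (simp add: hall_comb_def algebra_simps sum.distrib)
  then have "(\<lambda>t. x t + y t - hall_comb m (\<lambda>k. a k + b k) t) \<in> RL_ideal m"
    using RL_ideal_add[OF a(2) b(2)] by (simp add: algebra_simps)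
  then show ?case using a(1) b(1) rsub_add by (intro exI[of _ "\<lambda>k. a k + b k"]) blast
next
  case (neg x)
  then obtain a where a: "\<And>k. a k \<in> rsub {..<k}" "(\<lambda>t. x t - hall_comb m a t) \<in> RL_ideal m" by blast
  have "hall_comb m (\<lambda>k. - a k) t = - hall_comb m a t" for t
    by (simp add: hall_comb_def sum_negf)
  then have "(\<lambda>t. - x t - hall_comb m (\<lambda>k. - a k) t) \<in> RL_ideal m"
    using RL_ideal_neg[OF a(2)] by (simp add: algebra_simps)
  then show ?case using a(1) rsub_minus by (intro exI[of _ "\<lambda>k. - a k"]) blast
qed

text \<open>Letters are peeled off from the top: \<open>kill m\<close> removes the last summand, and
  \<open>tail m\<close> recovers its coefficient.\<close>

lemma T_independent:
  "(\<And>k. a k \<in> rsub {..<k}) \<Longrightarrow> (\<Sum>k<m. T k k (a k)) = 0 \<Longrightarrow> k < m \<Longrightarrow> a k = 0"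
proof (induction m arbitrary: k)
  case (Suc m)
  have r: "(\<Sum>k<m. T k k (a k)) \<in> rsub {..<m}"
    by (intro rsub_sum rsub_mono[OF T_rsub[OF Suc.prems(1)]]) auto
  have "kill m (\<Sum>k<Suc m. T k k (a k)) = (\<Sum>k<m. T k k (a k))"
    using kill_rsub[OF r, of m] by (simp add: kill_cont[OF T_cont])
  then have z: "(\<Sum>k<m. T k k (a k)) = 0" by (metis Suc.prems(2) kill_0)
  show ?case
  proof (cases "k = m")
    case True
    have "T m m (a m) = 0" using Suc.prems(2) z by simp
    then have "kill m (a m) = 0" using tail_T[OF Suc.prems(1), of m m] by simp
    then show ?thesis using True kill_rsub[OF Suc.prems(1), of m m] by simp
  next
    case False
    then show ?thesis using Suc.IH[OF Suc.prems(1) z] Suc.prems(3) by simp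
  qed
qed simp

text \<open>Modulo the ideal, p is a combination of the spanning brackets with the same value; the
  values of these brackets are independent, so the combination is zero.\<close>

theorem ev_eq_0_iff:
  assumes "p \<in> mcarrier m"
  shows "ev p = 0 \<longleftrightarrow> p \<in> RL_ideal m"
proof
  assume e: "ev p = 0"
  obtain a where a: "\<And>k. a k \<in> rsub {..<k}" and I: "(\<lambda>t. p t - hall_comb m a t) \<in> RL_ideal m"
    using aspan_hall_comb[OF mcarrier_span[OF assms]] by blast
  have "hall_comb m a = (\<lambda>t. p t + (- (p t - hall_comb m a t)))" by simp
  then have "ev (hall_comb m a) = ev (\<lambda>t. p t + (- (p t - hall_comb m a t)))" by simp
  also have "\<dots> = ev p + ev (\<lambda>t. - (p t - hall_comb m a t))"
    by (rule ev_add) (rule mcarrier_finite[OF assms],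
      rule mcarrier_finite[OF RL_ideal_mcarrier[OF RL_ideal_neg[OF I]]])
  also have "\<dots> = 0" using e ev_RL_ideal[OF RL_ideal_neg[OF I]] by simp
  finally have "a k = 0" if "k < m" for k
    using T_independent[OF a _ that] ev_hall_comb by simp
  then have "hall_comb m a = (\<lambda>t. 0)" by (simp add: hall_comb_def)
  then show "p \<in> RL_ideal m" using I by simp
qed (rule ev_RL_ideal)

subsection \<open>Identification with the Lie elements\<close>

lemma mcls_self: "p \<in> mcls m p"
  unfolding mcls_def using RL_ideal_zero[of m] by force

lemma mrep_mcls:
  assumes "p \<in> mcarrier m"
  shows "mrep m (mcls m p) \<in> mcarrier m" "ev (mrep m (mcls m p)) = ev p"
proof -
  have "mrep m (mcls m p) \<in> mcls m p \<and> mrep m (mcls m p) \<in> mcarrier m"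
    unfolding mrep_def by (rule someI[of _ p]) (use assms mcls_self in auto)
  then obtain z where z: "z \<in> RL_ideal m" "mrep m (mcls m p) = (\<lambda>t. p t + z t)"
    and c: "mrep m (mcls m p) \<in> mcarrier m" by (auto simp: mcls_def)
  show "mrep m (mcls m p) \<in> mcarrier m" by (rule c)
  show "ev (mrep m (mcls m p)) = ev p"
    unfolding z(2)
    using ev_add[OF mcarrier_finite[OF assms] mcarrier_finite[OF RL_ideal_mcarrier[OF z(1)]]]
      ev_RL_ideal[OF z(1)] by simp
qed

lemma mcls_eqI:
  assumes "p \<in> mcarrier m" "q \<in> mcarrier m" "ev p = ev q"
  shows "mcls m p = mcls m q"
proof -
  have sub: "mcls m p \<subseteq> mcls m q" if pq: "p \<in> mcarrier m" "q \<in> mcarrier m" "ev p = ev q" for p q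
  proof -
    have "(\<lambda>t. p t + - q t) \<in> mcarrier m" using pq by (intro mcarrier_add mcarrier_neg)
    moreover have "ev (\<lambda>t. p t + - q t) = 0"
      using pq by (subst ev_add) (auto simp: mcarrier_finite mcarrier_neg ev_minus)
    ultimately have d: "(\<lambda>t. p t + - q t) \<in> RL_ideal m" using ev_eq_0_iff by blast
    show ?thesis
    proof
      fix x assume "x \<in> mcls m p"
      then obtain z where z: "z \<in> RL_ideal m" "x = (\<lambda>t. p t + z t)" by (auto simp: mcls_def)
      then have "x = (\<lambda>t. q t + ((p t + - q t) + z t))" by simp
      then show "x \<in> mcls m q"
        unfolding mcls_def using RL_ideal_add[OF d z(1)]
        by (intro CollectI exI[of _ "\<lambda>t. (p t + - q t) + z t"] conjI)
    qed
  qed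
  show ?thesis
    by (rule equalityI[OF sub[OF assms] sub[OF assms(2,1) assms(3)[symmetric]]])
qed

definition iota :: "nat \<Rightarrow> (mtree \<Rightarrow> int) set \<Rightarrow> rmag" where
  "iota m U = ev (mrep m U)"

lemma iota_mcls: "p \<in> mcarrier m \<Longrightarrow> iota m (mcls m p) = ev p"
  by (simp add: iota_def mrep_mcls)

lemma Lie_of_int: "x \<in> Lie n \<Longrightarrow> of_int c * x \<in> Lie n"
  by (induction c rule: int_induct[where k = 0])
    (auto simp: algebra_simps intro: Lie.intros Lie_diff)

lemma ev_Lie: "p \<in> mcarrier m \<Longrightarrow> ev p \<in> Lie m"
proof -
  assume p: "p \<in> mcarrier m"
  have t: "mleaves t \<subseteq> {..<m} \<Longrightarrow> evt t \<in> Lie m" for t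
    by (induction t) (auto intro: Lie.intros)
  have "finite S \<Longrightarrow> (\<And>t. t \<in> S \<Longrightarrow> mleaves t \<subseteq> {..<m}) \<Longrightarrow> (\<Sum>t\<in>S. of_int (p t) * evt t) \<in> Lie m" for S
    by (induction S rule: finite_induct) (auto intro: Lie.zero intro!: Lie.add Lie_of_int t)
  then show ?thesis using p by (auto simp: ev_def mcarrier_def)
qed

lemma RL_carrier: "U \<in> lcarrier (RL m) \<longleftrightarrow> (\<exists>p\<in>mcarrier m. U = mcls m p)"
  by (auto simp: RL_def)

lemma RL_mrep: "U \<in> lcarrier (RL m) \<Longrightarrow> mrep m U \<in> mcarrier m"
  by (auto simp: RL_carrier mrep_mcls)

lemma RL_zero: "lzero (RL m) \<in> lcarrier (RL m)" "iota m (lzero (RL m)) = 0"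
proof -
  have "lzero (RL m) = mcls m (\<lambda>t. 0)" by (simp add: RL_def mcls_def)
  then show "lzero (RL m) \<in> lcarrier (RL m)" "iota m (lzero (RL m)) = 0"
    using mcarrier_zero by (auto simp: RL_carrier iota_mcls)
qed

theorem RL_rep: "lie_rep (RL m) (iota m) comm (Lie m)"
proof -
  have ops: "ladd (RL m) U V \<in> lcarrier (RL m) \<and> iota m (ladd (RL m) U V) = iota m U + iota m V"
    "lbr (RL m) U V \<in> lcarrier (RL m) \<and> iota m (lbr (RL m) U V) = comm (iota m U) (iota m V)"
    "lneg (RL m) U \<in> lcarrier (RL m) \<and> iota m (lneg (RL m) U) = - iota m U"
    if "U \<in> lcarrier (RL m)" "V \<in> lcarrier (RL m)" for U V
  proof -
    have c: "mrep m U \<in> mcarrier m" "mrep m V \<in> mcarrier m" using that RL_mrep by auto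
    note f = mcarrier_finite[OF c(1)] mcarrier_finite[OF c(2)]
    show "ladd (RL m) U V \<in> lcarrier (RL m) \<and> iota m (ladd (RL m) U V) = iota m U + iota m V"
      using mcarrier_add[OF c] ev_add[OF f] by (auto simp: RL_def iota_mcls) (simp add: iota_def)
    show "lbr (RL m) U V \<in> lcarrier (RL m) \<and> iota m (lbr (RL m) U V) = comm (iota m U) (iota m V)"
      using mcarrier_mmul[OF c] ev_mmul[OF f] by (auto simp: RL_def iota_mcls) (simp add: iota_def)
    show "lneg (RL m) U \<in> lcarrier (RL m) \<and> iota m (lneg (RL m) U) = - iota m U"
      using mcarrier_neg[OF c(1)] by (auto simp: RL_def iota_mcls) (simp add: iota_def ev_minus)
  qed
  have inj: "inj_on (iota m) (lcarrier (RL m))"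
  proof (rule inj_onI)
    fix U V assume "U \<in> lcarrier (RL m)" "V \<in> lcarrier (RL m)" and e: "iota m U = iota m V"
    then obtain p q where "p \<in> mcarrier m" "U = mcls m p" "q \<in> mcarrier m" "V = mcls m q"
      by (auto simp: RL_carrier)
    then show "U = V" using e by (metis iota_mcls mcls_eqI)
  qed
  have "x \<in> iota m ` lcarrier (RL m)" if "x \<in> Lie m" for x
    using that
  proof (induction rule: Lie.induct)
    case (gen i)
    then have "mcls m (ygen i) \<in> lcarrier (RL m)" "iota m (mcls m (ygen i)) = mgen i"
      using ygen_mcarrier by (auto simp: RL_carrier iota_mcls ev_ygen)
    then show ?case by (metis image_eqI)
  next
    case zero
    show ?case using RL_zero(2) by (rule image_eqI[OF sym RL_zero(1)])
  next
    case (add x y)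
    then obtain U V where "U \<in> lcarrier (RL m)" "V \<in> lcarrier (RL m)" "x = iota m U" "y = iota m V" by blast
    then show ?case using ops(1)[of U V] by (metis image_eqI)
  next
    case (minus x)
    then obtain U where "U \<in> lcarrier (RL m)" "x = iota m U" by blast
    then show ?case using ops(3)[of U U] by (metis image_eqI)
  next
    case (comm x y)
    then obtain U V where "U \<in> lcarrier (RL m)" "V \<in> lcarrier (RL m)" "x = iota m U" "y = iota m V" by blast
    then show ?case using ops(2)[of U V] by (metis image_eqI)
  qed
  moreover have "iota m U \<in> Lie m" if "U \<in> lcarrier (RL m)" for U
    using that by (auto simp: RL_carrier iota_mcls ev_Lie)
  ultimately have "iota m ` lcarrier (RL m) = Lie m" by blast
  then show ?thesis
    unfolding lie_rep_def bij_betw_def using inj ops by (intro conjI ballI) auto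
qed

section \<open>Splitting the tangential derivations and matching their kernel with the block\<close>

section \<open>The semi-direct product decomposition\<close>

lemma lie_rep_cong:
  assumes "lie_rep L \<beta> br I" "\<And>a b. a \<in> I \<Longrightarrow> b \<in> I \<Longrightarrow> br a b = br' a b"
  shows "lie_rep L \<beta> br' I"
proof -
  have "\<beta> x \<in> I" if "x \<in> lcarrier L" for x
    using assms(1) that unfolding lie_rep_def bij_betw_def by blast
  then show ?thesis using assms unfolding lie_rep_def by simp
qed

text \<open>An internal splitting of D into an ideal and a complementary subring, pulled back to the
  three Lie rings; the action is the adjoint one. Jacobi is asked for on D only, which is where
  \<open>brD\<close> satisfies it. Closure of M under the bracket comes from K being realised on
  it.\<close>

lemma lie_rep_semidirect:
  fixes br :: "'v::ab_group_add \<Rightarrow> 'v \<Rightarrow> 'v"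
  assumes L: "lie_rep L \<phi> br D" and B: "lie_rep B \<beta> br I" and K: "lie_rep K \<kappa> br M"
    and add: "\<And>a b c. br (a + b) c = br a c + br b c" "\<And>a b c. br a (b + c) = br a b + br a c"
    and swap: "\<And>a b. br a b = - br b a"
    and jacobi: "\<And>a b c. a \<in> D \<Longrightarrow> b \<in> D \<Longrightarrow> c \<in> D \<Longrightarrow> br a (br b c) = br (br a b) c + br b (br a c)"
    and ID: "I \<subseteq> D" and MD: "M \<subseteq> D"
    and ideal: "\<And>d i. d \<in> D \<Longrightarrow> i \<in> I \<Longrightarrow> br d i \<in> I"
    and Dadd: "\<And>a b. a \<in> D \<Longrightarrow> b \<in> D \<Longrightarrow> a + b \<in> D"
    and decomp: "\<And>d. d \<in> D \<Longrightarrow> \<exists>i\<in>I. \<exists>m\<in>M. d = i + m"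
    and disj: "I \<inter> M \<subseteq> {0}"
  shows "\<exists>\<rho>. lie_action K B \<rho> \<and> (\<exists>f. lie_iso L (lsemi B K \<rho>) f)"
proof -
  note L' = L[unfolded lie_rep_def] and B' = B[unfolded lie_rep_def] and K' = K[unfolded lie_rep_def]
  have bij: "bij_betw \<phi> (lcarrier L) D" "bij_betw \<beta> (lcarrier B) I" "bij_betw \<kappa> (lcarrier K) M"
    using L' B' K' by auto
  have \<beta>I: "\<beta> x \<in> I" if "x \<in> lcarrier B" for x using bij(2) that by (auto simp: bij_betw_def)
  have \<kappa>M: "\<kappa> x \<in> M" if "x \<in> lcarrier K" for x using bij(3) that by (auto simp: bij_betw_def)
  have \<phi>D: "\<phi> x \<in> D" if "x \<in> lcarrier L" for x using bij(1) that by (auto simp: bij_betw_def)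
  have \<beta>inj: "x = y" if "x \<in> lcarrier B" "y \<in> lcarrier B" "\<beta> x = \<beta> y" for x y
    using bij(2) that by (auto simp: bij_betw_def inj_on_def)
  have \<kappa>inj: "x = y" if "x \<in> lcarrier K" "y \<in> lcarrier K" "\<kappa> x = \<kappa> y" for x y
    using bij(3) that by (auto simp: bij_betw_def inj_on_def)
  define bi where "bi = inv_into (lcarrier B) \<beta>"
  define ki where "ki = inv_into (lcarrier K) \<kappa>"
  have bi: "bi v \<in> lcarrier B" "\<beta> (bi v) = v" if "v \<in> I" for v
    using bij(2) that unfolding bi_def bij_betw_def by (auto simp: inv_into_into f_inv_into_f)
  have ki: "ki v \<in> lcarrier K" "\<kappa> (ki v) = v" if "v \<in> M" for v
    using bij(3) that unfolding ki_def bij_betw_def by (auto simp: inv_into_into f_inv_into_f)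
  have Bops: "lneg B x \<in> lcarrier B" "\<beta> (lneg B x) = - \<beta> x" "ladd B x y \<in> lcarrier B"
    "\<beta> (ladd B x y) = \<beta> x + \<beta> y" "lbr B x y \<in> lcarrier B" "\<beta> (lbr B x y) = br (\<beta> x) (\<beta> y)"
    if "x \<in> lcarrier B" "y \<in> lcarrier B" for x y
    using B' that by auto
  have Bneg: "lneg B x \<in> lcarrier B" "\<beta> (lneg B x) = - \<beta> x" if "x \<in> lcarrier B" for x
    using B' that by auto
  have Kops: "ladd K x y \<in> lcarrier K" "lneg K x \<in> lcarrier K" "\<kappa> (lneg K x) = - \<kappa> x"
    "\<kappa> (ladd K x y) = \<kappa> x + \<kappa> y" "lbr K x y \<in> lcarrier K" "\<kappa> (lbr K x y) = br (\<kappa> x) (\<kappa> y)"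
    if "x \<in> lcarrier K" "y \<in> lcarrier K" for x y
    using K' that by auto
  have Iadd: "a + b \<in> I" "- a \<in> I" if "a \<in> I" "b \<in> I" for a b
    using Bops[OF bi(1)[OF that(1)] bi(1)[OF that(2)]] bi(2) that \<beta>I by metis+
  have Madd: "a + b \<in> M" "- a \<in> M" if "a \<in> M" "b \<in> M" for a b
    using Kops[OF ki(1)[OF that(1)] ki(1)[OF that(2)]] ki(2) that \<kappa>M by metis+
  have Mbr: "br a b \<in> M" if "a \<in> M" "b \<in> M" for a b
    using Kops(5,6)[OF ki(1)[OF that(1)] ki(1)[OF that(2)]] ki(2) that \<kappa>M by metis
  have uniq: "i = i' \<and> m = m'" if "i \<in> I" "m \<in> M" "i' \<in> I" "m' \<in> M" "i + m = i' + m'" for i i' m m'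
  proof -
    have "i + - i' = m' + - m" using that(5) by (simp add: algebra_simps)
    moreover have "i + - i' \<in> I" "m' + - m \<in> M" using Iadd Madd that by blast+
    ultimately have "i + - i' = 0" "m' + - m = 0" using disj by auto
    then show ?thesis by simp
  qed
  define \<rho> where "\<rho> k b = bi (br (\<kappa> k) (\<beta> b))" for k b
  have \<rho>: "\<rho> k b \<in> lcarrier B" "\<beta> (\<rho> k b) = br (\<kappa> k) (\<beta> b)" if "k \<in> lcarrier K" "b \<in> lcarrier B" for k b
    unfolding \<rho>_def using bi ideal MD \<kappa>M[OF that(1)] \<beta>I[OF that(2)] by blast+
  have act: "lie_action K B \<rho>"
    unfolding lie_action_def
  proof (intro conjI ballI)
    fix k b assume kb: "k \<in> lcarrier K" "b \<in> lcarrier B"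
    show "\<rho> k b \<in> lcarrier B" by (rule \<rho>(1)[OF kb])
    fix b' assume b': "b' \<in> lcarrier B"
    show "\<rho> k (ladd B b b') = ladd B (\<rho> k b) (\<rho> k b')"
      by (rule \<beta>inj) (simp_all add: \<rho> Bops kb b' add)
    have "br (\<kappa> k) (br (\<beta> b) (\<beta> b')) = br (br (\<kappa> k) (\<beta> b)) (\<beta> b') + br (\<beta> b) (br (\<kappa> k) (\<beta> b'))"
      by (rule jacobi) (use \<kappa>M \<beta>I kb b' ID MD in blast)+
    then show "\<rho> k (lbr B b b') = ladd B (lbr B (\<rho> k b) b') (lbr B b (\<rho> k b'))"
      by (intro \<beta>inj) (simp_all add: \<rho> Bops kb b')
  next
    fix k k' b assume kb: "k \<in> lcarrier K" "k' \<in> lcarrier K" "b \<in> lcarrier B"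
    show "\<rho> (ladd K k k') b = ladd B (\<rho> k b) (\<rho> k' b)"
      by (rule \<beta>inj) (simp_all add: \<rho> Bops Kops kb add)
    have "br (\<kappa> k) (br (\<kappa> k') (\<beta> b)) = br (br (\<kappa> k) (\<kappa> k')) (\<beta> b) + br (\<kappa> k') (br (\<kappa> k) (\<beta> b))"
      by (rule jacobi) (use \<kappa>M \<beta>I kb ID MD in blast)+
    then show "\<rho> (lbr K k k') b = ladd B (\<rho> k (\<rho> k' b)) (lneg B (\<rho> k' (\<rho> k b)))"
      by (intro \<beta>inj) (simp_all add: \<rho> Bops Bneg Kops kb)
  qed
  obtain pI pM where p: "\<And>d. d \<in> D \<Longrightarrow> pI d \<in> I \<and> pM d \<in> M \<and> d = pI d + pM d"
    using decomp by metis
  define f where "f x = (bi (pI (\<phi> x)), ki (pM (\<phi> x)))" for x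
  have fI: "f x = (b, k)" if "x \<in> lcarrier L" "b \<in> lcarrier B" "k \<in> lcarrier K" "\<phi> x = \<beta> b + \<kappa> k" for x b k
  proof -
    have "pI (\<phi> x) = \<beta> b \<and> pM (\<phi> x) = \<kappa> k"
      using p[OF \<phi>D[OF that(1)]] that(4) \<beta>I[OF that(2)] \<kappa>M[OF that(3)] by (intro uniq) auto
    then show ?thesis
      unfolding f_def using that bi[OF \<beta>I[OF that(2)]] ki[OF \<kappa>M[OF that(3)]] \<beta>inj \<kappa>inj by auto
  qed
  have fx: "\<exists>b\<in>lcarrier B. \<exists>k\<in>lcarrier K. f x = (b, k) \<and> \<phi> x = \<beta> b + \<kappa> k" if "x \<in> lcarrier L" for x
    using p[OF \<phi>D[OF that]] bi ki unfolding f_def by metis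
  have "lie_iso L (lsemi B K \<rho>) f"
    unfolding lie_iso_def
  proof (intro conjI ballI)
    show "bij_betw f (lcarrier L) (lcarrier (lsemi B K \<rho>))"
      unfolding bij_betw_def
    proof (intro conjI equalityI subsetI)
      show "inj_on f (lcarrier L)"
      proof (rule inj_onI)
        fix x y assume xy: "x \<in> lcarrier L" "y \<in> lcarrier L" "f x = f y"
        then have "\<phi> x = \<phi> y" using fx[OF xy(1)] fx[OF xy(2)] by auto
        then show "x = y" using bij(1) xy by (auto simp: bij_betw_def inj_on_def)
      qed
    next
      fix z assume "z \<in> f ` lcarrier L"
      then obtain x where x: "x \<in> lcarrier L" "z = f x" by blast
      from fx[OF x(1)] show "z \<in> lcarrier (lsemi B K \<rho>)" by (auto simp: x(2) lsemi_def)
    next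
      fix z assume "z \<in> lcarrier (lsemi B K \<rho>)"
      then obtain b k where z: "z = (b, k)" "b \<in> lcarrier B" "k \<in> lcarrier K" by (auto simp: lsemi_def)
      have "\<beta> b + \<kappa> k \<in> D" using \<beta>I[OF z(2)] \<kappa>M[OF z(3)] ID MD by (intro Dadd) auto
      then obtain x where x: "x \<in> lcarrier L" "\<phi> x = \<beta> b + \<kappa> k" using bij(1) by (auto simp: bij_betw_def)
      then have "f x = z" using fI z by simp
      then show "z \<in> f ` lcarrier L" using x by blast
    qed
  next
    fix x y assume xy: "x \<in> lcarrier L" "y \<in> lcarrier L"
    obtain b k where b: "b \<in> lcarrier B" "k \<in> lcarrier K" "f x = (b, k)" "\<phi> x = \<beta> b + \<kappa> k"
      using fx[OF xy(1)] by blast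
    obtain b' k' where b': "b' \<in> lcarrier B" "k' \<in> lcarrier K" "f y = (b', k')" "\<phi> y = \<beta> b' + \<kappa> k'"
      using fx[OF xy(2)] by blast
    have a: "ladd L x y \<in> lcarrier L" "\<phi> (ladd L x y) = \<phi> x + \<phi> y"
      "lbr L x y \<in> lcarrier L" "\<phi> (lbr L x y) = br (\<phi> x) (\<phi> y)" using L' xy by auto
    have "f (ladd L x y) = (ladd B b b', ladd K k k')"
      by (rule fI) (simp_all add: a b b' Bops Kops)
    then show "f (ladd L x y) = ladd (lsemi B K \<rho>) (f x) (f y)"
      by (simp add: b b' lsemi_def)
    \<comment> \<open>The term with the action of k' on b enters \<open>lsemi\<close> with a minus
      sign, by antisymmetry.\<close>
    have sw: "br (\<beta> b) (\<kappa> k') = - br (\<kappa> k') (\<beta> b)" by (rule swap)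
    have "f (lbr L x y) = (ladd B (ladd B (lbr B b b') (\<rho> k b')) (lneg B (\<rho> k' b)), lbr K k k')"
      by (rule fI) (simp_all add: a b b' Bops Bneg Kops \<rho> add sw)
    then show "f (lbr L x y) = lbr (lsemi B K \<rho>) (f x) (f y)"
      by (simp add: b b' lsemi_def)
  qed
  then show ?thesis using act by blast
qed

subsection \<open>Ideals generated by a letter\<close>

abbreviation yid :: "nat \<Rightarrow> nat \<Rightarrow> (mtree \<Rightarrow> int) set set" where
  "yid m i \<equiv> lideal (RL m) {RLgen m i}"

lemma RL_ops:
  assumes "U \<in> lcarrier (RL m)" "V \<in> lcarrier (RL m)"
  shows "ladd (RL m) U V \<in> lcarrier (RL m)" "iota m (ladd (RL m) U V) = iota m U + iota m V"
    "lbr (RL m) U V \<in> lcarrier (RL m)" "iota m (lbr (RL m) U V) = comm (iota m U) (iota m V)"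
    "lneg (RL m) U \<in> lcarrier (RL m)" "iota m (lneg (RL m) U) = - iota m U"
  using RL_rep[of m] assms unfolding lie_rep_def by auto

lemma iota_Lie: "U \<in> lcarrier (RL m) \<Longrightarrow> iota m U \<in> Lie m"
  using RL_rep[of m] unfolding lie_rep_def bij_betw_def by blast

lemma iota_inj: "U \<in> lcarrier (RL m) \<Longrightarrow> V \<in> lcarrier (RL m) \<Longrightarrow> iota m U = iota m V \<Longrightarrow> U = V"
  using RL_rep[of m] unfolding lie_rep_def bij_betw_def inj_on_def by blast

lemma iota_surj: "x \<in> Lie m \<Longrightarrow> \<exists>U\<in>lcarrier (RL m). iota m U = x"
proof -
  assume x: "x \<in> Lie m"
  have "iota m ` lcarrier (RL m) = Lie m"
    using RL_rep[of m] unfolding lie_rep_def bij_betw_def by blast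
  then have "x \<in> iota m ` lcarrier (RL m)" using x by simp
  then show ?thesis by auto
qed

lemma RLgen_iota: "i < m \<Longrightarrow> RLgen m i \<in> lcarrier (RL m) \<and> iota m (RLgen m i) = mgen i"
  using ygen_mcarrier[of i m] by (auto simp: RLgen_def RL_carrier iota_mcls ev_ygen)

lemma yid_cont:
  assumes i: "i < m" and U: "U \<in> yid m i"
  shows "U \<in> lcarrier (RL m) \<and> iota m U \<in> cont i"
  using U
proof (induction rule: lideal.induct)
  case (gen s)
  then show ?case using RLgen_iota[OF i] by simp
next
  case zero
  then show ?case using RL_zero by simp
next
  case (add x y)
  then show ?case using RL_ops(1,2)[of x m y] by (auto intro: cont_add)
next
  case (neg x)
  then show ?case using RL_ops(5,6)[of x m x] by (auto intro: cont_minus)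
next
  case (brl a x)
  then show ?case using RL_ops(3,4)[of a m x] by (auto intro: comm_cont)
next
  case (brr a x)
  then show ?case using RL_ops(3,4)[of x m a] by (auto intro: comm_cont)
qed

text \<open>A Lie element containing \<open>y_i\<close> is a sum of brackets with innermost letter
  \<open>y_i\<close>, and these arise from the generator by left multiplications within the
  ideal.\<close>

lemma yid_surj:
  assumes i: "i < m" and x: "x \<in> Lie m" "x \<in> cont i"
  shows "\<exists>U\<in>yid m i. iota m U = x"
proof -
  let ?Y = "iota m ` yid m i"
  have c: "U \<in> lcarrier (RL m)" if "U \<in> yid m i" for U using yid_cont[OF i that] by simp
  have br: "rn_br (w @ [i]) \<in> ?Y" if "set w \<subseteq> {..<m}" for w
    using that
  proof (induction w)
    case Nil
    have "RLgen m i \<in> yid m i" by (rule lideal.gen) simp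
    then show ?case using RLgen_iota[OF i] by (metis append_Nil rn_br.simps(2) image_eqI)
  next
    case (Cons j w)
    then obtain U where U: "U \<in> yid m i" "iota m U = rn_br (w @ [i])" by auto
    have j: "RLgen m j \<in> lcarrier (RL m)" "iota m (RLgen m j) = mgen j" using RLgen_iota[of j m] Cons by auto
    have "lbr (RL m) (RLgen m j) U \<in> yid m i" by (rule lideal.brl[OF j(1) U(1)])
    moreover have "iota m (lbr (RL m) (RLgen m j) U) = rn_br ((j # w) @ [i])"
      using RL_ops(4)[OF j(1) c[OF U(1)]] j U by (simp add: rn_br_Cons)
    ultimately show ?case by (metis image_eqI)
  qed
  have "T m i (tail i x) \<in> ?Y"
    unfolding T_def
  proof (rule lin_closed)
    show "0 \<in> ?Y" using lideal.zero[of "RL m" "{RLgen m i}"] RL_zero(2)[of m] by (metis image_eqI)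
    fix a b assume "a \<in> ?Y" "b \<in> ?Y"
    then obtain U V where UV: "U \<in> yid m i" "a = iota m U" "V \<in> yid m i" "b = iota m V" by blast
    show "a + b \<in> ?Y"
      using lideal.add[OF UV(1,3)] RL_ops(2)[OF c[OF UV(1)] c[OF UV(3)]] UV by (metis image_eqI)
    show "- a \<in> ?Y"
      using lideal.neg[OF UV(1)] RL_ops(6)[OF c[OF UV(1)] c[OF UV(1)]] UV by (metis image_eqI)
  next
    fix w assume "w \<in> dwords m"
    then show "rn_br (w @ [i]) \<in> ?Y" by (intro br) (auto simp: dwords_def)
  qed
  then show ?thesis using Lie_cont_decomp[OF i x] by auto
qed

subsection \<open>The kernel of the projection\<close>

text \<open>The kernel of setting \<open>y_m = 0\<close> and forgetting s_m; accordingly s_m is left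
  unrestricted.\<close>

definition TDker :: "nat \<Rightarrow> rmag set" where
  "TDker m = {d \<in> TD (Suc m). \<forall>i<m. tail i d \<in> cont m}"

lemma delta_cont:
  assumes d: "d \<in> TDker m"
  shows "delta (Suc m) d f \<in> cont m"
proof -
  have z: "comm (tail i d) (mgen i) \<in> cont m" for i
  proof (cases i m rule: linorder_cases)
    case less
    then show ?thesis using d by (auto simp: TDker_def intro: comm_cont)
  next
    case equal
    then show ?thesis by (auto intro: comm_cont)
  next
    case greater
    then have "tail i d = 0" using d by (intro tail_rsub_ge[of d "Suc m"]) (auto simp: TDker_def TD_def)
    then show ?thesis by simp
  qed
  have "dw (\<lambda>i. comm (tail i d) (mgen i)) w \<in> cont m" for w
    by (induction w) (auto intro: cont_add cont_mult_left cont_mult_right z)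
  then show ?thesis unfolding delta_def by (intro cont_lin) auto
qed

text \<open>Differentiating a letter other than the innermost \<open>y_m\<close> creates a second
  \<open>y_m\<close> and gives zero. Differentiating \<open>y_m\<close> replaces it by its bracket
  with s_m, that is, multiplies the acting polynomial by s_m on the right.\<close>

lemma delta_T:
  assumes d: "d \<in> TDker m" and b: "b \<in> rsub {..<m}"
  shows "delta (Suc m) d (T m m b) = T (Suc m) m (b * tail m d)"
proof -
  have dT: "d \<in> TD (Suc m)" using d by (simp add: TDker_def)
  have w: "set w \<subseteq> {..<m} \<Longrightarrow> delta (Suc m) d (rn_br (w @ [m])) = T (Suc m) m (mon w * tail m d)" for w
  proof (induction w)
    case Nil
    have "comm (tail m d) (T (Suc m) m 1) = T (Suc m) m (tail m d * 1)"
      by (rule T_comm[OF TD_tail[OF dT]]) simp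
    then show ?case by (simp add: delta_mgen T_1)
  next
    case (Cons j w)
    have r: "mgen j \<in> rsub {..<Suc m}" "rn_br (w @ [m]) \<in> rsub {..<Suc m}"
      using Cons.prems by (auto intro!: rn_br_rsub)
    have "tail j d \<in> cont m" using d Cons.prems by (auto simp: TDker_def)
    then have "comm (tail j d) (mgen j) \<in> cont m" by (rule comm_cont)
    then have z: "comm (comm (tail j d) (mgen j)) (rn_br (w @ [m])) = 0"
      by (rule comm_cont_cont) (simp add: rn_br_cont)
    have "delta (Suc m) d (rn_br ((j # w) @ [m])) = comm (mgen j) (T (Suc m) m (mon w * tail m d))"
      using Cons z by (simp add: rn_br_Cons delta_comm[OF r] delta_mgen)
    also have "\<dots> = T (Suc m) m (mgen j * (mon w * tail m d))"
      by (rule T_comm_gen) (use Cons.prems in simp)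
    finally show ?case by (simp add: mon_Cons[of j w] mult.assoc)
  qed
  have "delta (Suc m) d (T m m b) = lin m (\<lambda>w. delta (Suc m) d (rn_br (w @ [m]))) b"
    unfolding T_def[of m] by (rule lin_hom) simp
  also have "\<dots> = lin m (\<lambda>w. T (Suc m) m (mon w * tail m d)) b"
    by (rule lin_cong) (auto intro: w simp: dwords_def)
  also have "\<dots> = T (Suc m) m (lin m mon b * tail m d)"
    by (rule lin_hom[symmetric, where h = "\<lambda>x. T (Suc m) m (x * tail m d)"]) (simp add: distrib_right)
  finally show ?thesis using b by (simp add: lin_mon_rsub)
qed

text \<open>Transports \<open>\<langle>y\<^sub>i\<rangle> \<subseteq> Lie m\<close> to the Lie elements on the letters other than \<open>i\<close> in which
  \<open>y\<^sub>m\<close> occurs: both are copies of the Magnus ring on the letters other than \<open>i\<close> and \<open>m\<close>.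
  The bracket with \<open>r\<close> is left multiplication on the first and right multiplication by \<open>- r\<close> on the
  second, whence the antipode.\<close>

definition theta :: "nat \<Rightarrow> nat \<Rightarrow> rmag \<Rightarrow> rmag" where
  "theta m i x = T m m (antip (tail i x))"

text \<open>The minus sign has two effects. The component at m of a bracket of derivations is the
  bracket of the components in reversed order, and the sign restores the order; and right
  multiplication by \<open>- r\<close> is the antipode of left multiplication by r.\<close>

definition block_emb :: "nat \<Rightarrow> (nat \<Rightarrow> (mtree \<Rightarrow> int) set) \<times> (mtree \<Rightarrow> int) set \<Rightarrow> rmag" where
  "block_emb m = (\<lambda>(a, r). \<Sum>j<Suc m. (if j < m then theta m j (iota m (a j)) else - iota m r) * mgen j)"

lemma antip_tail_rsub: "x \<in> Lie m \<Longrightarrow> antip (tail i x) \<in> rsub {..<m}"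
  by (intro antip_rsub rsub_mono[OF tail_rsub[OF Lie_rsub]]) auto

lemma kill_antip_tail: "kill i (antip (tail i x)) = antip (tail i x)"
  by (simp add: kill_antip)

lemma theta_Lie: "x \<in> Lie m \<Longrightarrow> theta m i x \<in> Lie (Suc m)"
  unfolding theta_def using T_mono[of m "Suc m" "antip (tail i x)" m] antip_tail_rsub[of x m i] T_Lie[of m "Suc m"]
  by (metis lessI less_imp_le)

lemma kill_theta: "i < m \<Longrightarrow> kill i (theta m i x) = theta m i x"
  unfolding theta_def by (simp add: kill_T kill_antip_tail)

lemma theta_cont: "theta m i x \<in> cont m"
  unfolding theta_def by (rule T_cont)

lemma tail_theta: "x \<in> Lie m \<Longrightarrow> tail m (theta m i x) = antip (tail i x)"
  unfolding theta_def using tail_T[OF antip_tail_rsub] kill_rsub[OF antip_tail_rsub, of x m m i] by simp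

lemma theta_inj:
  assumes "i < m" "x \<in> Lie m" "x \<in> cont i" "y \<in> Lie m" "y \<in> cont i" "theta m i x = theta m i y"
  shows "x = y"
proof -
  have "antip (antip (tail i x)) = antip (antip (tail i y))"
    using tail_theta[of x m i] tail_theta[of y m i] assms by simp
  then have "tail i x = tail i y" by simp
  then show ?thesis using Lie_cont_decomp[of i m x] Lie_cont_decomp[of i m y] assms by simp
qed

lemma theta_surj:
  assumes i: "i < m" and z: "z \<in> Lie (Suc m)" "z \<in> cont m" "kill i z = z"
  shows "\<exists>x\<in>Lie m. x \<in> cont i \<and> theta m i x = z"
proof -
  let ?c = "tail m z"
  have c: "?c \<in> rsub {..<m}"
    by (rule rsub_mono[OF tail_rsub[OF Lie_rsub[OF z(1)]]]) auto
  have kc: "kill i ?c = ?c"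
    by (rule rmag_eqI) (metis coef_kill coef_tail z(3) in_set_conv_decomp set_append UnCI append_assoc append_Cons append_Nil)
  have zc: "z = T m m ?c"
    using Lie_cont_decomp[OF _ z(1,2)] T_mono[OF _ c, of "Suc m" m] by simp
  \<comment> \<open>The inverse of \<open>theta\<close>: the antipode is an involution, and
    \<open>T m i\<close> undoes \<open>tail i\<close>.\<close>
  let ?x = "T m i (antip ?c)"
  have "tail i ?x = kill i (antip ?c)" by (rule tail_T[OF antip_rsub[OF c]])
  then have "tail i ?x = antip ?c" using kc by (simp add: kill_antip)
  then have "theta m i ?x = z" using zc by (simp add: theta_def)
  then show ?thesis using T_Lie[OF i] T_cont by blast
qed

lemma block_emb_TD:
  assumes "\<And>i. i < m \<Longrightarrow> iota m (a i) \<in> Lie m" "iota m r \<in> Lie m"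
  shows "block_emb m (a, r) \<in> TD (Suc m)"
  unfolding block_emb_def prod.case
  by (rule TD_sumI) (use assms in \<open>auto intro: theta_Lie Lie.minus Lie_mono\<close>)

lemma tail_block_emb:
  shows "i < m \<Longrightarrow> tail i (block_emb m (a, r)) = theta m i (iota m (a i))"
    and "iota m r \<in> Lie m \<Longrightarrow> tail m (block_emb m (a, r)) = - iota m r"
proof -
  show "tail i (block_emb m (a, r)) = theta m i (iota m (a i))" if "i < m"
    unfolding block_emb_def prod.case using that by (subst tail_sum_mgen) (auto simp: kill_theta)
  show "tail m (block_emb m (a, r)) = - iota m r" if "iota m r \<in> Lie m"
    unfolding block_emb_def prod.case using kill_rsub[OF Lie_rsub[OF that], of m] by (subst tail_sum_mgen) auto
qed

lemma TDker_eqI: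
  assumes "d \<in> TD (Suc m)" "e \<in> TD (Suc m)" "\<And>i. i < m \<Longrightarrow> tail i d = tail i e" "tail m d = tail m e"
  shows "d = e"
  by (rule TD_eqI[OF assms(1,2)]) (use assms(3,4) in \<open>auto simp: less_Suc_eq\<close>)

lemma tail_brD_block_emb:
  assumes x: "\<And>i. i < m \<Longrightarrow> iota m (a i) \<in> Lie m" "iota m r \<in> Lie m"
    and y: "\<And>i. i < m \<Longrightarrow> iota m (a' i) \<in> Lie m" "iota m r' \<in> Lie m"
    and xc: "\<And>i. i < m \<Longrightarrow> iota m (a i) \<in> cont i" and yc: "\<And>i. i < m \<Longrightarrow> iota m (a' i) \<in> cont i"
  shows "i < m \<Longrightarrow> tail i (brD (Suc m) (block_emb m (a, r)) (block_emb m (a', r')))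
      = theta m i (comm (iota m r) (iota m (a' i)) - comm (iota m r') (iota m (a i)))"
    and "tail m (brD (Suc m) (block_emb m (a, r)) (block_emb m (a', r'))) = - comm (iota m r) (iota m r')"
proof -
  let ?d = "block_emb m (a, r)" and ?e = "block_emb m (a', r')"
  have TD: "?d \<in> TD (Suc m)" "?e \<in> TD (Suc m)" using block_emb_TD x y by auto
  have TDker: "?d \<in> TDker m" "?e \<in> TDker m" using TD by (auto simp: TDker_def tail_block_emb theta_cont)
  \<comment> \<open>The derivation multiplies by \<open>- \<rho>\<close> on the right, which the
    antipode turns into left multiplication by \<rho>. This is the bracket with \<rho> as seen by
    \<open>tail i\<close>, since the other product contributes nothing: all words of \<alpha>
    contain i.\<close>
  have half: "kill i (delta (Suc m) d (theta m i \<alpha>)) = theta m i (comm \<rho> \<alpha>)"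
    if d: "d \<in> TDker m" "tail m d = - \<rho>" and rho: "\<rho> \<in> Lie m" and al: "\<alpha> \<in> Lie m" "\<alpha> \<in> cont i" and i: "i < m"
    for d \<rho> \<alpha> i
  proof -
    let ?b = "antip (tail i \<alpha>)"
    have "kill i (delta (Suc m) d (theta m i \<alpha>)) = kill i (T (Suc m) m (- (?b * \<rho>)))"
      unfolding theta_def delta_T[OF d(1) antip_tail_rsub[OF al(1)]] d(2) by simp
    also have "\<dots> = T (Suc m) m (- (?b * kill i \<rho>))"
      using i by (simp add: kill_T kill_antip_tail)
    also have "- (?b * kill i \<rho>) = antip (kill i \<rho> * tail i \<alpha>)"
      using antip_Lie[OF Lie_kill[OF rho, of i]] by (simp add: antip_mult)
    also have "kill i \<rho> * tail i \<alpha> = tail i (comm \<rho> \<alpha>)"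
      by (simp add: comm_def tail_mult_0 Lie_coef_Nil[OF rho] Lie_coef_Nil[OF al(1)] kill_cont[OF al(2)])
    also have "T (Suc m) m (antip (tail i (comm \<rho> \<alpha>))) = theta m i (comm \<rho> \<alpha>)"
      unfolding theta_def by (rule T_mono) (auto intro: antip_tail_rsub Lie.comm rho al)
    finally show ?thesis .
  qed
  show "tail i (brD (Suc m) ?d ?e) = theta m i (comm (iota m r) (iota m (a' i)) - comm (iota m r') (iota m (a i)))"
    if i: "i < m"
  proof -
    have "comm (tail i ?e) (tail i ?d) = 0"
      using i by (simp add: tail_block_emb comm_cont_cont[OF theta_cont theta_cont])
    then have "tail i (brD (Suc m) ?d ?e)
        = kill i (delta (Suc m) ?d (theta m i (iota m (a' i)))) - kill i (delta (Suc m) ?e (theta m i (iota m (a i))))"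
      using i TD by (simp add: tail_brD tail_block_emb)
    also have "\<dots> = theta m i (comm (iota m r) (iota m (a' i))) - theta m i (comm (iota m r') (iota m (a i)))"
      using half[OF TDker(1) tail_block_emb(2)[OF x(2)] x(2) y(1)[OF i] yc[OF i] i]
        half[OF TDker(2) tail_block_emb(2)[OF y(2)] y(2) x(1)[OF i] xc[OF i] i] by simp
    finally show ?thesis by (simp add: theta_def)
  qed
  have "tail m (brD (Suc m) ?d ?e) = kill m (delta (Suc m) ?d (tail m ?e)) - kill m (delta (Suc m) ?e (tail m ?d))
      + kill m (comm (tail m ?e) (tail m ?d))"
    using TD by (simp add: tail_brD)
  also have "\<dots> = comm (kill m (iota m r')) (kill m (iota m r))"
    using x(2) y(2) by (simp add: kill_cont[OF delta_cont[OF TDker(1)]] kill_cont[OF delta_cont[OF TDker(2)]]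
        tail_block_emb(2) comm_minus)
  also have "\<dots> = - comm (iota m r) (iota m r')"
    using kill_rsub[OF Lie_rsub[OF x(2)], of m] kill_rsub[OF Lie_rsub[OF y(2)], of m]
    by (simp add: comm_swap[of "iota m r'"])
  finally show "tail m (brD (Suc m) ?d ?e) = - comm (iota m r) (iota m r')" .
qed

abbreviation block :: "nat \<Rightarrow> ((nat \<Rightarrow> (mtree \<Rightarrow> int) set) \<times> (mtree \<Rightarrow> int) set) liering" where
  "block m \<equiv> lsemi (lprod m (\<lambda>i. (RL m)\<lparr>lcarrier := lideal (RL m) {RLgen m i}\<rparr>)) (RL m) (diag_act m (RL m))"

lemma block_carrier: "(a, r) \<in> lcarrier (block m) \<longleftrightarrow>
    (\<forall>i<m. a i \<in> yid m i) \<and> (\<forall>i\<ge>m. a i = undefined) \<and> r \<in> lcarrier (RL m)"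
  by (auto simp: lsemi_def lprod_def)

lemma block_bij: "bij_betw (block_emb m) (lcarrier (block m)) (TDker m)"
  unfolding bij_betw_def
proof (intro conjI equalityI subsetI)
  show "inj_on (block_emb m) (lcarrier (block m))"
  proof (rule inj_onI)
    fix x y assume xy: "x \<in> lcarrier (block m)" "y \<in> lcarrier (block m)" and e: "block_emb m x = block_emb m y"
    obtain a r a' r' where x: "x = (a, r)" and y: "y = (a', r')" by (cases x, cases y)
    have c: "\<And>i. i < m \<Longrightarrow> a i \<in> yid m i" "\<And>i. m \<le> i \<Longrightarrow> a i = undefined" "r \<in> lcarrier (RL m)"
      "\<And>i. i < m \<Longrightarrow> a' i \<in> yid m i" "\<And>i. m \<le> i \<Longrightarrow> a' i = undefined" "r' \<in> lcarrier (RL m)"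
      using xy unfolding x y block_carrier by auto
    have "a i = a' i" for i
    proof (cases "i < m")
      case True
      note y1 = yid_cont[OF True c(1)[OF True]] and y2 = yid_cont[OF True c(4)[OF True]]
      have "theta m i (iota m (a i)) = theta m i (iota m (a' i))"
        using e tail_block_emb(1)[OF True] unfolding x y by metis
      then have "iota m (a i) = iota m (a' i)"
        using theta_inj[OF True] y1 y2 iota_Lie by blast
      then show ?thesis using iota_inj y1 y2 by blast
    next
      case False
      then show ?thesis using c by simp
    qed
    moreover have "r = r'"
    proof -
      have "- iota m r = - iota m r'"
        using e tail_block_emb(2)[OF iota_Lie] c(3,6) unfolding x y by metis
      then show ?thesis using iota_inj c(3,6) by simp
    qed
    ultimately show "x = y" unfolding x y by auto
  qed
next
  fix d assume "d \<in> block_emb m ` lcarrier (block m)"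
  then obtain a r where d: "d = block_emb m (a, r)" "(a, r) \<in> lcarrier (block m)" by auto
  then have c: "\<And>i. i < m \<Longrightarrow> a i \<in> yid m i" "r \<in> lcarrier (RL m)" by (auto simp: block_carrier)
  have "block_emb m (a, r) \<in> TD (Suc m)" using yid_cont c by (intro block_emb_TD) (auto intro: iota_Lie)
  then show "d \<in> TDker m" unfolding d(1) TDker_def by (simp add: tail_block_emb(1) theta_cont)
next
  fix d assume d: "d \<in> TDker m"
  then have dT: "d \<in> TD (Suc m)" by (simp add: TDker_def)
  have "\<exists>U\<in>yid m i. theta m i (iota m U) = tail i d" if i: "i < m" for i
  proof -
    have "\<exists>x\<in>Lie m. x \<in> cont i \<and> theta m i x = tail i d"
      by (rule theta_surj[OF i TD_tail[OF dT]]) (use i d in \<open>auto simp: TDker_def\<close>)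
    then show ?thesis using yid_surj[OF i] by metis
  qed
  then obtain a where a: "\<And>i. i < m \<Longrightarrow> a i \<in> yid m i \<and> theta m i (iota m (a i)) = tail i d"
    by metis
  have td: "tail m d \<in> rsub {..<m}"
    by (rule rsub_mono[OF tail_rsub[OF TD_rsub[OF dT]]]) auto
  have "kill m (tail m d) \<in> Lie m" by (rule Lie_kill_Suc[OF TD_tail[OF dT]]) simp
  then have "- tail m d \<in> Lie m" by (simp add: Lie.minus)
  then obtain r where r: "r \<in> lcarrier (RL m)" "iota m r = - tail m d" using iota_surj by blast
  \<comment> \<open>The carrier of \<open>lprod\<close> prescribes the value
    \<open>undefined\<close> from m on.\<close>
  let ?a = "\<lambda>i. if i < m then a i else undefined"
  have "(?a, r) \<in> lcarrier (block m)" using a r by (simp add: block_carrier)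
  moreover have "block_emb m (?a, r) = d"
  proof (rule TDker_eqI[OF _ dT])
    show "block_emb m (?a, r) \<in> TD (Suc m)"
    proof (rule block_emb_TD)
      fix i assume i: "i < m"
      then show "iota m (?a i) \<in> Lie m" using a[OF i] yid_cont[OF i] iota_Lie by simp
    qed (rule iota_Lie[OF r(1)])
  qed (use a r iota_Lie[OF r(1)] in \<open>simp_all add: tail_block_emb\<close>)
  ultimately show "d \<in> block_emb m ` lcarrier (block m)" by (rule rev_image_eqI[OF _ sym])
qed

theorem block_rep: "lie_rep (block m) (block_emb m) (brD (Suc m)) (TDker m)"
  unfolding lie_rep_def
proof (intro conjI ballI block_bij)
  fix x assume "x \<in> lcarrier (block m)"
  then obtain a r where x: "x = (a, r)" and a: "\<And>i. i < m \<Longrightarrow> a i \<in> yid m i"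
    and r: "r \<in> lcarrier (RL m)" by (cases x) (auto simp: block_carrier)
  have ac: "a i \<in> lcarrier (RL m)" "iota m (a i) \<in> cont i" "iota m (a i) \<in> Lie m" if "i < m" for i
    using yid_cont[OF that a[OF that]] iota_Lie by auto
  have rL: "iota m r \<in> Lie m" using iota_Lie[OF r] .
  have bT: "block_emb m (a, r) \<in> TD (Suc m)" using block_emb_TD ac rL by auto
  let ?na = "\<lambda>i. if i < m then lneg (RL m) (a i) else undefined"
  have n: "lneg (block m) x = (?na, lneg (RL m) r)" by (simp add: x lsemi_def lprod_def fun_eq_iff)
  have nc: "lneg (RL m) (a i) \<in> yid m i" if "i < m" for i using a[OF that] by (rule lideal.neg)
  show "lneg (block m) x \<in> lcarrier (block m)"
    unfolding n block_carrier using nc RL_ops(5)[OF r r] by simp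
  show "block_emb m (lneg (block m) x) = - block_emb m x"
    unfolding n unfolding x
  proof (rule TDker_eqI[OF block_emb_TD TD_minus[OF bT]])
    show "iota m (?na i) \<in> Lie m" if "i < m" for i
      using that ac(3)[OF that] RL_ops(6)[OF ac(1)[OF that] ac(1)[OF that]] by (simp add: Lie.minus)
    show nr: "iota m (lneg (RL m) r) \<in> Lie m" using RL_ops(5)[OF r r] iota_Lie by blast
    show "tail i (block_emb m (?na, lneg (RL m) r)) = tail i (- block_emb m (a, r))" if "i < m" for i
      using that RL_ops(6)[OF ac(1)[OF that] ac(1)[OF that]] by (simp add: tail_block_emb theta_def)
    show "tail m (block_emb m (?na, lneg (RL m) r)) = tail m (- block_emb m (a, r))"
      using nr rL RL_ops(6)[OF r r] by (simp add: tail_block_emb)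
  qed
  fix y assume "y \<in> lcarrier (block m)"
  then obtain a' r' where y: "y = (a', r')" and a': "\<And>i. i < m \<Longrightarrow> a' i \<in> yid m i"
    and r': "r' \<in> lcarrier (RL m)" by (cases y) (auto simp: block_carrier)
  have ac': "a' i \<in> lcarrier (RL m)" "iota m (a' i) \<in> cont i" "iota m (a' i) \<in> Lie m" if "i < m" for i
    using yid_cont[OF that a'[OF that]] iota_Lie by auto
  have rL': "iota m r' \<in> Lie m" using iota_Lie[OF r'] .
  have bT': "block_emb m (a', r') \<in> TD (Suc m)" using block_emb_TD ac' rL' by auto
  let ?sa = "\<lambda>i. if i < m then ladd (RL m) (a i) (a' i) else undefined"
  have s: "ladd (block m) x y = (?sa, ladd (RL m) r r')" by (simp add: x y lsemi_def lprod_def fun_eq_iff)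
  have sc: "ladd (RL m) (a i) (a' i) \<in> yid m i" if "i < m" for i using a[OF that] a'[OF that] by (rule lideal.add)
  show "ladd (block m) x y \<in> lcarrier (block m)"
    unfolding s block_carrier using sc RL_ops(1)[OF r r'] by simp
  show "block_emb m (ladd (block m) x y) = block_emb m x + block_emb m y"
    unfolding s unfolding x y
  proof (rule TDker_eqI[OF block_emb_TD TD_add[OF bT bT']])
    show "iota m (?sa i) \<in> Lie m" if "i < m" for i
      using that ac(3)[OF that] ac'(3)[OF that] RL_ops(2)[OF ac(1)[OF that] ac'(1)[OF that]] by (simp add: Lie.add)
    show sr: "iota m (ladd (RL m) r r') \<in> Lie m" using RL_ops(1)[OF r r'] iota_Lie by blast
    show "tail i (block_emb m (?sa, ladd (RL m) r r')) = tail i (block_emb m (a, r) + block_emb m (a', r'))" if "i < m" for i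
      using that RL_ops(2)[OF ac(1)[OF that] ac'(1)[OF that]] by (simp add: tail_block_emb theta_def)
    show "tail m (block_emb m (?sa, ladd (RL m) r r')) = tail m (block_emb m (a, r) + block_emb m (a', r'))"
      using sr rL rL' RL_ops(2)[OF r r'] by (simp add: tail_block_emb)
  qed
  let ?b = "\<lambda>i. ladd (RL m) (ladd (RL m) (lbr (RL m) (a i) (a' i)) (lbr (RL m) r (a' i))) (lneg (RL m) (lbr (RL m) r' (a i)))"
  let ?ba = "\<lambda>i. if i < m then ?b i else undefined"
  have b: "lbr (block m) x y = (?ba, lbr (RL m) r r')"
    by (simp add: x y lsemi_def lprod_def diag_act_def fun_eq_iff)
  have bc: "?b i \<in> yid m i" if "i < m" for i
    using a[OF that] a'[OF that] ac(1)[OF that] r r' by (intro lideal.add lideal.neg lideal.brl)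
  \<comment> \<open>The ideal generated by \<open>y_i\<close> is abelian, so its own bracket drops
    out of the semidirect formula.\<close>
  have bi: "iota m (?b i) = comm (iota m r) (iota m (a' i)) - comm (iota m r') (iota m (a i))" if "i < m" for i
  proof -
    have "comm (iota m (a i)) (iota m (a' i)) = 0" using ac(2) ac'(2) that by (intro comm_cont_cont)
    then show ?thesis using ac(1)[OF that] ac'(1)[OF that] r r' by (simp add: RL_ops)
  qed
  have br: "iota m (lbr (RL m) r r') = comm (iota m r) (iota m r')" by (rule RL_ops(4)[OF r r'])
  show "lbr (block m) x y \<in> lcarrier (block m)"
    unfolding b block_carrier using bc RL_ops(3)[OF r r'] by simp
  show "block_emb m (lbr (block m) x y) = brD (Suc m) (block_emb m x) (block_emb m y)"
    unfolding b unfolding x y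
  proof (rule TDker_eqI[OF block_emb_TD brD_TD[OF bT bT']])
    show "iota m (?ba i) \<in> Lie m" if "i < m" for i
      using that bc[OF that] yid_cont iota_Lie by simp
    show brL: "iota m (lbr (RL m) r r') \<in> Lie m" using RL_ops(3)[OF r r'] iota_Lie by blast
    note tb = tail_brD_block_emb[of m a r a' r', OF ac(3) rL ac'(3) rL' ac(2) ac'(2)]
    show "tail i (block_emb m (?ba, lbr (RL m) r r')) = tail i (brD (Suc m) (block_emb m (a, r)) (block_emb m (a', r')))"
      if "i < m" for i
      using that tb(1)[OF _ _ _ _ that] by (simp add: tail_block_emb bi)
    show "tail m (block_emb m (?ba, lbr (RL m) r r')) = tail m (brD (Suc m) (block_emb m (a, r)) (block_emb m (a', r')))"
      using tb(2) brL by (simp add: tail_block_emb br)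
  qed
qed

text \<open>A tangential derivation sends each letter to an element containing that letter, so it
  never removes m from a word.\<close>

lemma brD_TDker:
  assumes d: "d \<in> TD (Suc m)" and e: "e \<in> TDker m"
  shows "brD (Suc m) d e \<in> TDker m"
proof -
  have eT: "e \<in> TD (Suc m)" using e by (simp add: TDker_def)
  have "tail i (brD (Suc m) d e) \<in> cont m" if i: "i < m" for i
  proof -
    have ti: "tail i e \<in> cont m" using e i by (simp add: TDker_def)
    have c: "comm (tail i d) (mgen i) \<in> cont i" for i by (rule comm_cont) simp
    have "delta (Suc m) d (tail i e) \<in> cont m"
      unfolding delta_def
      by (rule cont_lin, rule dw_cont[OF c]) (use ti in \<open>auto simp: cont_def\<close>)
    moreover have "delta (Suc m) e (tail i d) \<in> cont m" by (rule delta_cont[OF e])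
    moreover have "comm (tail i e) (tail i d) \<in> cont m" by (rule comm_cont(1)[OF ti])
    ultimately have "delta (Suc m) d (tail i e) - delta (Suc m) e (tail i d) + comm (tail i e) (tail i d) \<in> cont m"
      by (intro cont_add cont_diff)
    then show ?thesis using i d eT by (subst tail_brD) (auto intro: kill_cont_closed simp del: kill_add kill_diff kill_comm)
  qed
  then show ?thesis using brD_TD[OF d eT] by (simp add: TDker_def)
qed

lemma TD_mono: "d \<in> TD m \<Longrightarrow> d \<in> TD (Suc m)"
proof -
  assume d: "d \<in> TD m"
  have "tail j d \<in> Lie (Suc m)" if "j < Suc m" for j
  proof (cases "j < m")
    case True
    show ?thesis by (rule Lie_mono[OF TD_tail[OF d True]]) simp
  next
    case False
    then show ?thesis using tail_rsub_ge[OF TD_rsub[OF d], of j] by (simp add: Lie.zero)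
  qed
  then show ?thesis using d rsub_mono[OF TD_rsub[OF d], of "{..<Suc m}"] by (auto simp: TD_def)
qed

text \<open>Setting \<open>y_m = 0\<close> in the components below m gives the part of rank m; the
  component at m goes entirely into the kernel.\<close>

lemma TD_decomp:
  assumes d: "d \<in> TD (Suc m)"
  shows "\<exists>i\<in>TDker m. \<exists>k\<in>TD m. d = i + k"
proof -
  let ?k = "\<Sum>j<m. kill m (tail j d) * mgen j"
  have k: "?k \<in> TD m"
    by (rule TD_sumI) (auto intro!: Lie_kill_Suc TD_tail[OF d])
  have "tail i (d - ?k) \<in> cont m" if i: "i < m" for i
  proof -
    have "kill i (kill m (tail i d)) = kill m (tail i d)"
      by (rule rmag_eqI) (auto simp: coef_kill coef_tail)
    then have "tail i (d - ?k) = tail i d - kill m (tail i d)"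
      using tail_sum_mgen[OF i, of "\<lambda>j. kill m (tail j d)"] by simp
    then show ?thesis by (simp add: diff_kill_cont)
  qed
  then have "d - ?k \<in> TDker m" using TD_diff[OF d TD_mono[OF k]] by (simp add: TDker_def)
  then show ?thesis using k by (metis diff_add_cancel)
qed

lemma TDker_TD_disjoint: "TDker m \<inter> TD m \<subseteq> {0}"
proof
  fix d assume d: "d \<in> TDker m \<inter> TD m"
  have "d = 0"
  proof (rule TD_eqI[of _ m])
    show "d \<in> TD m" using d by simp
    fix j assume j: "j < m"
    have "tail j d \<in> rsub {..<m}" using d j TD_tail Lie_rsub by blast
    then have "kill m (tail j d) = tail j d" by (rule kill_rsub) simp
    then show "tail j d = tail j 0" using d j kill_cont[of "tail j d" m] by (simp add: TDker_def)
  qed simp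
  then show "d \<in> {0}" by simp
qed

theorem theorem4p8:
  fixes n :: nat
  assumes "2 \<le> n"
  shows "\<exists>\<rho>. lie_action (LieG (hPSigma (n - 1)))
                 (lsemi (lprod (n - 1) (\<lambda>i. (RL (n - 1))\<lparr>lcarrier := lideal (RL (n - 1)) {RLgen (n - 1) i}\<rparr>))
                        (RL (n - 1)) (diag_act (n - 1) (RL (n - 1)))) \<rho>
          \<and> (\<exists>f. lie_iso (LieG (hPSigma n))
                 (lsemi
                   (lsemi (lprod (n - 1) (\<lambda>i. (RL (n - 1))\<lparr>lcarrier := lideal (RL (n - 1)) {RLgen (n - 1) i}\<rparr>))
                          (RL (n - 1)) (diag_act (n - 1) (RL (n - 1))))
                   (LieG (hPSigma (n - 1))) \<rho>) f)"
proof -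
  define m where "m = n - 1"
  have n: "n = Suc m" using assms by (simp add: m_def)
  obtain F where F: "lie_rep (LieG (hPSigma n)) F (brD (Suc m)) (TD (Suc m))"
    using LieG_hPSigma_rep[of n] unfolding n by blast
  obtain G where G: "lie_rep (LieG (hPSigma m)) G (brD m) (TD m)"
    using LieG_hPSigma_rep[of m] by blast
  \<comment> \<open>The smaller Lie ring is realised with the bracket of the larger rank, so that
    all three realisations share one bracket.\<close>
  have G': "lie_rep (LieG (hPSigma m)) G (brD (Suc m)) (TD m)"
    by (rule lie_rep_cong[OF G], rule brD_mono[symmetric]) auto
  show ?thesis
    unfolding m_def[symmetric]
  proof (rule lie_rep_semidirect[OF F block_rep G' brD_add_left brD_add_right brD_swap brD_jacobi])
    show "TDker m \<subseteq> TD (Suc m)" by (auto simp: TDker_def)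
    show "TD m \<subseteq> TD (Suc m)" using TD_mono by blast
  qed (assumption | erule (1) brD_TDker | erule (1) TD_add | erule TD_decomp | rule TDker_TD_disjoint)+
qed

end
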